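(* Let $d\ge1$ and let $F_d$ be the free group on $d$ generators $g_1,\dots,g_d$. For $[\Gamma,S]\in X_d$ with $S=(s_1,\dots,s_d)$, let $\varphi=\varphi_{(\Gamma,S)}:F_d\to\Gamma$ be the epimorphism with $\varphi(g_i)=s_i$ for $1\le i\le d$, and let $\varphi_*:L^1(F_d)\to L^1(\Gamma)$ be the induced homomorphism. (a) For every $\tilde f\in L^1(F_d)$ the function $$T(\tilde f):X_d\to\mathbb{C},\qquad T(\tilde f)[\Gamma,S]=\tau_{\mathcal{N}\Gamma}(\varphi_*(\tilde f))$$ is continuous. (b) For every $\tilde f\in L^1(F_d)^\times$ the function $$D(\tilde f):X_d\to\mathbb{R}^{>0},\qquad D(\tilde f)[\Gamma,S]=\det\nolimits_{\mathcal{N}\Gamma}(\varphi_*(\tilde f))$$ is continuous.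
   Context: For a discrete group $\Gamma$ and $p=1,2$, elements of $L^p(\Gamma)$ are written as formal series $\sum_{\gamma\in\Gamma} x_\gamma \gamma$ with $x_\gamma\in\mathbb{C}$, $\sum_\gamma |x_\gamma|^p<\infty$. $L^1(\Gamma)$ is a unital Banach $*$-algebra under convolution, and $L^1(\Gamma)^\times$ is its group of units. The von Neumann algebra $\mathcal{N}\Gamma$ is the algebra of bounded operators $A: L^2(\Gamma)\to L^2(\Gamma)$ that commute with left multiplication by every $\gamma\in\Gamma$. Its canonical trace is $\tau_{\mathcal{N}\Gamma}(A) = (A e, e)$, where $e\in\Gamma\subset L^2(\Gamma)$ is the unit element. Fuglede–Kadison determinant: for invertible $A\in\mathcal{N}\Gamma$, $\det_{\mathcal{N}\Gamma}A = \exp \tau_{\mathcal{N}\Gamma}(\log|A|)$ with $|A|=(A^*A)^{1/2}$; for arbitrary $A\in\mathcal{N}\Gamma$, $\det_{\mathcal{N}\Gamma}A=\lim_{\varepsilon\to0+}\det_{\mathcal{N}\Gamma}(|A|+\varepsilon)$. $L^1(\Gamma)$ is viewed as a subalgebra of $\mathcal{N}\Gamma$ via the injective homomorphism $r: L^1(\Gamma)\to\mathcal{N}\Gamma$, $r(\sum_\gamma f_\gamma\gamma)=\sum_\gamma f_\gamma R_{\gamma^{-1}}$, where $R_\gamma(x)=x\gamma$ on $L^2(\Gamma)$. So $\det_{\mathcal{N}\Gamma} f$ and $\tau_{\mathcal{N}\Gamma}(f)$ mean $\det_{\mathcal{N}\Gamma} r(f)$ and $\tau_{\mathcal{N}\Gamma}(r(f))$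 (the latter equals the coefficient $f_e$). For a homomorphism $\varphi:\Gamma\to\Gamma'$ of discrete groups, $\varphi_*:L^1(\Gamma)\to L^1(\Gamma')$ is defined by $\varphi_*(\sum_\gamma f_\gamma\gamma)=\sum_\gamma f_\gamma\varphi(\gamma)$. Space of marked groups: $X_d$ is the set of isomorphism classes $[\Gamma,S]$ of pairs $(\Gamma,S)$, where $\Gamma$ is a discrete group and $S=(s_1,\dots,s_d)$ is a family of $d$ generators (repetitions allowed); $(\Gamma,S)\cong(\Gamma',S')$ if some group isomorphism $\alpha:\Gamma\to\Gamma'$ satisfies $\alpha(s_i)=s_i'$ for all $i$. $X_d$ is an ultrametric space with distance $2^{-N}$ between $[\Gamma_1,S_1]$ and $[\Gamma_2,S_2]$, where $N\le\infty$ is the largest radius such that the balls of radius $N$ around the origin in the two Cayley graphs are isomorphic as oriented graphs with edges labelled by $1,\dots,d$. An equivalent metric is $\delta([\Gamma_1,S_1],[\Gamma_2,S_2])=2^{-M}$, where $M\le\infty$ is maximal such that the correspondence of the $i$-th generators induces a bijection between the $S_1$-relations and the $S_2$-relations of length less than $M$; here an $S$-relation is a finite string of elements of $S$ and their inverses whose evaluation in the group is $e$, and its length is the number of entries in the string. *)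

theory Defs
  imports "HOL-Analysis.Analysis" "HOL-Algebra.Generated_Groups" "HOL-Algebra.Weak_Morphisms"
begin

section \<open>Formal series over a discrete group\<close>

text \<open>A formal series is a coefficient function vanishing outside the carrier, so that two
  series are equal as elements of \<open>L\<^sup>p\<close> iff they are equal as functions.\<close>

definition Lp :: "nat \<Rightarrow> ('a, 'b) monoid_scheme \<Rightarrow> ('a \<Rightarrow> complex) set" where
  "Lp p G = {x. (\<forall>g. g \<notin> carrier G \<longrightarrow> x g = 0) \<and> (\<lambda>g. cmod (x g) ^ p) summable_on carrier G}"

definition delta :: "'a \<Rightarrow> 'a \<Rightarrow> complex" where
  "delta a = (\<lambda>g. if g = a then 1 else 0)"

definition conv :: "('a, 'b) monoid_scheme \<Rightarrow> ('a \<Rightarrow> complex) \<Rightarrow> ('a \<Rightarrow> complex) \<Rightarrow> 'a \<Rightarrow> complex" where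
  "conv G x y = (\<lambda>g. if g \<in> carrier G
     then infsum (\<lambda>h. x h * y (inv\<^bsub>G\<^esub> h \<otimes>\<^bsub>G\<^esub> g)) (carrier G) else 0)"

definition L1_algebra :: "('a, 'b) monoid_scheme \<Rightarrow> ('a \<Rightarrow> complex) ring" where
  "L1_algebra G = \<lparr>carrier = Lp 1 G, mult = conv G, one = delta \<one>\<^bsub>G\<^esub>,
     zero = (\<lambda>g. 0), add = (\<lambda>x y g. x g + y g)\<rparr>"

definition push_forward ::
  "('a, 'c) monoid_scheme \<Rightarrow> ('a \<Rightarrow> 'b) \<Rightarrow> ('a \<Rightarrow> complex) \<Rightarrow> 'b \<Rightarrow> complex" where
  "push_forward F \<phi> f = (\<lambda>g. infsum f {x \<in> carrier F. \<phi> x = g})"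

section \<open>The group von Neumann algebra\<close>

definition l2_inner :: "('a, 'b) monoid_scheme \<Rightarrow> ('a \<Rightarrow> complex) \<Rightarrow> ('a \<Rightarrow> complex) \<Rightarrow> complex" where
  "l2_inner G x y = infsum (\<lambda>g. x g * cnj (y g)) (carrier G)"

definition l2_norm :: "('a, 'b) monoid_scheme \<Rightarrow> ('a \<Rightarrow> complex) \<Rightarrow> real" where
  "l2_norm G x = sqrt (infsum (\<lambda>g. (cmod (x g))\<^sup>2) (carrier G))"

type_synonym 'a l2_op = "('a \<Rightarrow> complex) \<Rightarrow> 'a \<Rightarrow> complex"

text \<open>Operators are extensional functions on \<open>Lp 2 G\<close>, so that they are equal as
  operators iff they are equal as HOL functions.\<close>

definition bounded_ops :: "('a, 'b) monoid_scheme \<Rightarrow> 'a l2_op set" where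
  "bounded_ops G = {A \<in> Lp 2 G \<rightarrow>\<^sub>E Lp 2 G.
     (\<forall>x\<in>Lp 2 G. \<forall>y\<in>Lp 2 G. A (\<lambda>g. x g + y g) = (\<lambda>g. A x g + A y g)) \<and>
     (\<forall>x\<in>Lp 2 G. \<forall>c. A (\<lambda>g. c * x g) = (\<lambda>g. c * A x g)) \<and>
     (\<exists>K. \<forall>x\<in>Lp 2 G. l2_norm G (A x) \<le> K * l2_norm G x)}"

definition op_id :: "('a, 'b) monoid_scheme \<Rightarrow> 'a l2_op" where
  "op_id G = (\<lambda>x\<in>Lp 2 G. x)"

definition op_add :: "('a, 'b) monoid_scheme \<Rightarrow> 'a l2_op \<Rightarrow> 'a l2_op \<Rightarrow> 'a l2_op" where
  "op_add G A B = (\<lambda>x\<in>Lp 2 G. \<lambda>g. A x g + B x g)"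

definition op_scale :: "('a, 'b) monoid_scheme \<Rightarrow> complex \<Rightarrow> 'a l2_op \<Rightarrow> 'a l2_op" where
  "op_scale G c A = (\<lambda>x\<in>Lp 2 G. \<lambda>g. c * A x g)"

definition op_norm :: "('a, 'b) monoid_scheme \<Rightarrow> 'a l2_op \<Rightarrow> real" where
  "op_norm G A = (SUP x \<in> {x \<in> Lp 2 G. l2_norm G x \<le> 1}. l2_norm G (A x))"

text \<open>\<open>left_translate G a x\<close> is \<open>a x\<close>, and \<open>right_translate G a x\<close> is \<open>x a\<close>.\<close>

definition left_translate :: "('a, 'b) monoid_scheme \<Rightarrow> 'a \<Rightarrow> 'a l2_op" where
  "left_translate G a x = (\<lambda>g. if g \<in> carrier G then x (inv\<^bsub>G\<^esub> a \<otimes>\<^bsub>G\<^esub> g) else 0)"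

definition right_translate :: "('a, 'b) monoid_scheme \<Rightarrow> 'a \<Rightarrow> 'a l2_op" where
  "right_translate G a x = (\<lambda>g. if g \<in> carrier G then x (g \<otimes>\<^bsub>G\<^esub> inv\<^bsub>G\<^esub> a) else 0)"

definition vN :: "('a, 'b) monoid_scheme \<Rightarrow> 'a l2_op ring" where
  "vN G = \<lparr>carrier = {A \<in> bounded_ops G. \<forall>a\<in>carrier G. \<forall>x\<in>Lp 2 G.
                        A (left_translate G a x) = left_translate G a (A x)},
           mult = compose (Lp 2 G), one = op_id G,
           zero = (\<lambda>x\<in>Lp 2 G. \<lambda>g. 0), add = op_add G\<rparr>"

definition vN_trace :: "('a, 'b) monoid_scheme \<Rightarrow> 'a l2_op \<Rightarrow> complex" where
  "vN_trace G A = l2_inner G (A (delta \<one>\<^bsub>G\<^esub>)) (delta \<one>\<^bsub>G\<^esub>)"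

text \<open>The embedding \<open>r\<close> of \<open>L\<^sup>1\<close>; the norm-convergent sum of operators is written out
  coefficientwise.\<close>

definition L1_rep :: "('a, 'b) monoid_scheme \<Rightarrow> ('a \<Rightarrow> complex) \<Rightarrow> 'a l2_op" where
  "L1_rep G f = (\<lambda>x\<in>Lp 2 G. \<lambda>g.
     infsum (\<lambda>a. f a * right_translate G (inv\<^bsub>G\<^esub> a) x g) (carrier G))"

section \<open>Functional calculus and the Fuglede-Kadison determinant\<close>

definition adjoint_op :: "('a, 'b) monoid_scheme \<Rightarrow> 'a l2_op \<Rightarrow> 'a l2_op" where
  "adjoint_op G A = (THE B. B \<in> carrier (vN G) \<and>
     (\<forall>x\<in>Lp 2 G. \<forall>y\<in>Lp 2 G. l2_inner G (A x) y = l2_inner G x (B y)))"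

definition spectrum :: "('a, 'b) monoid_scheme \<Rightarrow> 'a l2_op \<Rightarrow> complex set" where
  "spectrum G A = {z. op_add G A (op_scale G (- z) (op_id G)) \<notin> Units (vN G)}"

definition op_poly :: "('a, 'b) monoid_scheme \<Rightarrow> real poly \<Rightarrow> 'a l2_op \<Rightarrow> 'a l2_op" where
  "op_poly G p A = (\<lambda>x\<in>Lp 2 G. \<lambda>g. \<Sum>i\<le>degree p. of_real (coeff p i) * (A ^^ i) x g)"

text \<open>Continuous functional calculus for self-adjoint \<open>A\<close> (whose spectrum is real): \<open>h(A)\<close> is
  the norm limit of \<open>p\<^sub>n(A)\<close> for real polynomials \<open>p\<^sub>n\<close> converging to \<open>h\<close> uniformly on the spectrum.\<close>

definition cfc :: "('a, 'b) monoid_scheme \<Rightarrow> (real \<Rightarrow> real) \<Rightarrow> 'a l2_op \<Rightarrow> 'a l2_op" where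
  "cfc G h A = (THE B. B \<in> carrier (vN G) \<and>
     (\<forall>p :: nat \<Rightarrow> real poly.
        uniform_limit {t. complex_of_real t \<in> spectrum G A} (\<lambda>n. poly (p n)) h sequentially \<longrightarrow>
        (\<lambda>n. op_norm G (op_add G (op_poly G (p n) A) (op_scale G (-1) B))) \<longlonglongrightarrow> 0))"

definition op_abs :: "('a, 'b) monoid_scheme \<Rightarrow> 'a l2_op \<Rightarrow> 'a l2_op" where
  "op_abs G A = cfc G sqrt (adjoint_op G A \<otimes>\<^bsub>vN G\<^esub> A)"

text \<open>\<open>log |A|\<close> is self-adjoint, hence has real trace; \<open>Re\<close> is only a coercion here.\<close>

definition fk_det_inv :: "('a, 'b) monoid_scheme \<Rightarrow> 'a l2_op \<Rightarrow> real" where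
  "fk_det_inv G A = exp (Re (vN_trace G (cfc G ln (op_abs G A))))"

definition fk_det :: "('a, 'b) monoid_scheme \<Rightarrow> 'a l2_op \<Rightarrow> real" where
  "fk_det G A = (if A \<in> Units (vN G) then fk_det_inv G A
     else Lim (at_right 0) (\<lambda>\<epsilon>. fk_det_inv G
            (op_add G (op_abs G A) (op_scale G (of_real \<epsilon>) (op_id G)))))"

section \<open>Words and free groups\<close>

text \<open>\<open>(i, True)\<close> stands for the \<open>i\<close>-th generator and \<open>(i, False)\<close> for its inverse. Generators
  are numbered \<open>0, \<dots>, d - 1\<close>.\<close>

type_synonym letter = "nat \<times> bool"

definition letter_inv :: "letter \<Rightarrow> letter" where
  "letter_inv a = (fst a, \<not> snd a)"

definition red_words :: "nat \<Rightarrow> letter list set" where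
  "red_words d = {w. fst ` set w \<subseteq> {..<d} \<and> successively (\<lambda>a b. b \<noteq> letter_inv a) w}"

fun red_Cons :: "letter \<Rightarrow> letter list \<Rightarrow> letter list" where
  "red_Cons a [] = [a]"
| "red_Cons a (b # w) = (if b = letter_inv a then w else a # b # w)"

definition free_group :: "nat \<Rightarrow> letter list monoid" where
  "free_group d = \<lparr>carrier = red_words d, mult = foldr red_Cons, one = []\<rparr>"

definition letter_eval :: "('a, 'b) monoid_scheme \<Rightarrow> 'a list \<Rightarrow> letter \<Rightarrow> 'a" where
  "letter_eval G S a = (if snd a then S ! fst a else inv\<^bsub>G\<^esub> (S ! fst a))"

definition word_eval :: "('a, 'b) monoid_scheme \<Rightarrow> 'a list \<Rightarrow> letter list \<Rightarrow> 'a" where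
  "word_eval G S w = foldr (\<lambda>a x. letter_eval G S a \<otimes>\<^bsub>G\<^esub> x) w \<one>\<^bsub>G\<^esub>"

lemma letter_inv_simps [simp]:
  "letter_inv (letter_inv a) = a" "fst (letter_inv a) = fst a" "snd (letter_inv a) = (\<not> snd a)"
  by (simp_all add: letter_inv_def)

lemma red_Cons_in: "w \<in> red_words d \<Longrightarrow> fst a < d \<Longrightarrow> red_Cons a w \<in> red_words d"
  by (cases w) (auto simp: red_words_def successively_Cons)

lemma red_words_tl: "a # w \<in> red_words d \<Longrightarrow> w \<in> red_words d \<and> fst a < d"
  by (auto simp: red_words_def successively_Cons)

lemma red_Cons_red: "a # w \<in> red_words d \<Longrightarrow> red_Cons a w = a # w"
  by (cases w) (auto simp: red_words_def)

lemma red_Cons_cancel: "w \<in> red_words d \<Longrightarrow> red_Cons a (red_Cons (letter_inv a) w) = w"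
proof (cases w)
  case (Cons b v)
  moreover assume "w \<in> red_words d"
  ultimately show ?thesis using red_Cons_red by (cases "b = a") auto
qed simp

lemma foldr_red_in:
  "w \<in> red_words d \<Longrightarrow> fst ` set u \<subseteq> {..<d} \<Longrightarrow> foldr red_Cons u w \<in> red_words d"
  by (induction u) (auto intro: red_Cons_in)

lemma foldr_red_Cons:
  assumes "w \<in> red_words d" "x \<in> red_words d"
  shows "foldr red_Cons (red_Cons a x) w = red_Cons a (foldr red_Cons x w)"
proof (cases x)
  case (Cons b y)
  have "fst ` set y \<subseteq> {..<d}" using assms(2) Cons by (auto simp: red_words_def)
  then have "foldr red_Cons y w \<in> red_words d" using assms(1) by (rule foldr_red_in[rotated])
  then show ?thesis using Cons red_Cons_cancel by auto
qed simp

lemma foldr_red_assoc: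
  assumes "v \<in> red_words d" "w \<in> red_words d" "u \<in> red_words d"
  shows "foldr red_Cons (foldr red_Cons u v) w = foldr red_Cons u (foldr red_Cons v w)"
  using assms(3)
proof (induction u)
  case (Cons a u)
  then have u: "u \<in> red_words d" using red_words_tl by blast
  then have "foldr red_Cons u v \<in> red_words d"
    using assms(1) by (intro foldr_red_in) (auto simp: red_words_def)
  then show ?case using Cons.IH[OF u] foldr_red_Cons[OF assms(2)] by simp
qed simp

lemma foldr_red_Nil: "u \<in> red_words d \<Longrightarrow> foldr red_Cons u [] = u"
proof (induction u)
  case (Cons a u)
  then show ?case using red_words_tl[OF Cons.prems] red_Cons_red[OF Cons.prems] by simp
qed simp

lemma foldr_red_inverse: "foldr red_Cons (map letter_inv (rev u)) u = []"
  by (induction u) auto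

theorem group_free_group: "group (free_group d)"
proof (rule groupI)
  fix x assume "x \<in> carrier (free_group d)"
  then have "map letter_inv (rev x) \<in> carrier (free_group d)"
    by (auto simp: free_group_def red_words_def successively_map
        elim!: successively_mono)
  then show "\<exists>y\<in>carrier (free_group d). y \<otimes>\<^bsub>free_group d\<^esub> x = \<one>\<^bsub>free_group d\<^esub>"
    using foldr_red_inverse by (force simp: free_group_def)
qed (auto simp: free_group_def foldr_red_assoc intro!: foldr_red_in,
  auto simp: red_words_def)

context group
begin

lemma letter_eval_closed:
  "set S \<subseteq> carrier G \<Longrightarrow> fst a < length S \<Longrightarrow> letter_eval G S a \<in> carrier G"
  by (auto simp: letter_eval_def intro: inv_closed dest: nth_mem)

lemma word_eval_closed:
  "set S \<subseteq> carrier G \<Longrightarrow> fst ` set w \<subseteq> {..<length S} \<Longrightarrow> word_eval G S w \<in> carrier G"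
  by (induction w) (auto simp: word_eval_def letter_eval_closed)

lemma word_eval_append:
  assumes "set S \<subseteq> carrier G" "fst ` set v \<subseteq> {..<length S}" "fst ` set w \<subseteq> {..<length S}"
  shows "word_eval G S (v @ w) = word_eval G S v \<otimes> word_eval G S w"
  using assms(2)
proof (induction v)
  case Nil
  then show ?case using word_eval_closed[OF assms(1,3)] by (simp add: word_eval_def)
next
  case (Cons a v)
  have "word_eval G S v \<in> carrier G" "letter_eval G S a \<in> carrier G"
    using Cons.prems assms(1) by (auto intro!: word_eval_closed letter_eval_closed)
  then show ?case
    using Cons word_eval_closed[OF assms(1,3)] by (auto simp: word_eval_def m_assoc)
qed

lemma word_eval_red_Cons:
  assumes "set S \<subseteq> carrier G" "fst a < length S" "fst ` set w \<subseteq> {..<length S}"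
  shows "word_eval G S (red_Cons a w) = letter_eval G S a \<otimes> word_eval G S w"
proof (cases w)
  case (Cons b v)
  show ?thesis
  proof (cases "b = letter_inv a")
    case True
    have v: "word_eval G S v \<in> carrier G" and s: "S ! fst a \<in> carrier G"
      using assms Cons by (auto intro!: word_eval_closed)
    have "letter_eval G S a \<otimes> (letter_eval G S (letter_inv a) \<otimes> word_eval G S v) = word_eval G S v"
      using v s by (simp add: letter_eval_def flip: m_assoc)
    then show ?thesis using True Cons by (simp add: word_eval_def)
  qed (simp add: Cons word_eval_def)
qed (simp add: word_eval_def)

theorem word_eval_hom:
  assumes "set S \<subseteq> carrier G"
  shows "word_eval G S \<in> hom (free_group (length S)) G"
proof (rule homI)
  fix u v assume uv: "u \<in> carrier (free_group (length S))" "v \<in> carrier (free_group (length S))"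
  have v: "v \<in> red_words (length S)" using uv by (simp add: free_group_def)
  have "fst ` set u \<subseteq> {..<length S}" using uv by (auto simp: free_group_def red_words_def)
  then have "word_eval G S (foldr red_Cons u v) = word_eval G S u \<otimes> word_eval G S v"
  proof (induction u)
    case Nil
    then show ?case using word_eval_closed[OF assms] v by (simp add: word_eval_def red_words_def)
  next
    case (Cons a u)
    have "foldr red_Cons u v \<in> red_words (length S)"
      using Cons.prems v by (intro foldr_red_in) auto
    then have "word_eval G S (foldr red_Cons (a # u) v)
        = letter_eval G S a \<otimes> word_eval G S (foldr red_Cons u v)"
      using Cons.prems assms by (auto intro!: word_eval_red_Cons simp: red_words_def)
    moreover have "word_eval G S u \<in> carrier G" "letter_eval G S a \<in> carrier G"
        "word_eval G S v \<in> carrier G"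
      using Cons.prems assms v
      by (auto intro!: word_eval_closed letter_eval_closed simp: red_words_def)
    ultimately show ?case using Cons by (simp add: word_eval_def m_assoc)
  qed
  then show "word_eval G S (u \<otimes>\<^bsub>free_group (length S)\<^esub> v) = word_eval G S u \<otimes> word_eval G S v"
    by (simp add: free_group_def)
qed (auto intro!: word_eval_closed[OF assms] simp: free_group_def red_words_def)

lemma word_eval_generator:
  "set S \<subseteq> carrier G \<Longrightarrow> i < length S \<Longrightarrow> word_eval G S [(i, True)] = S ! i"
  by (simp add: word_eval_def letter_eval_def subsetD)

end

section \<open>The space of marked groups\<close>

definition marked_groups :: "nat \<Rightarrow> ('a monoid \<times> 'a list) set" where
  "marked_groups d = {(G, S). group G \<and> set S \<subseteq> carrier G \<and> length S = d \<and>
                              generate G (set S) = carrier G}"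

definition marked_isomorphic :: "'a monoid \<times> 'a list \<Rightarrow> 'b monoid \<times> 'b list \<Rightarrow> bool" where
  "marked_isomorphic p q \<longleftrightarrow> (\<exists>\<alpha>\<in>iso (fst p) (fst q). map \<alpha> (snd p) = snd q)"

definition marked_rel :: "nat \<Rightarrow> (('a monoid \<times> 'a list) \<times> ('a monoid \<times> 'a list)) set" where
  "marked_rel d = {(p, q). p \<in> marked_groups d \<and> q \<in> marked_groups d \<and> marked_isomorphic p q}"

definition marked_class :: "'a monoid \<Rightarrow> 'a list \<Rightarrow> ('a monoid \<times> 'a list) set" where
  "marked_class G S = marked_rel (length S) `` {(G, S)}"

text \<open>HOL has no type of all groups, so \<open>marked_space d\<close> consists of classes of groups whose carrier lies in
  a type \<open>'a\<close>. A \<open>d\<close>-generated group is countable, so already \<open>'a = nat\<close> (hence every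
  infinite \<open>'a\<close>) contains a representative of every class; see \<open>marked_group_on_nat\<close> below.\<close>

definition marked_space :: "nat \<Rightarrow> ('a monoid \<times> 'a list) set set" where
  "marked_space d = marked_groups d // marked_rel d"

text \<open>The Cayley graph has an edge labelled \<open>i\<close> from \<open>x\<close> to \<open>x s\<^sub>i\<close>. Balls are full subgraphs,
  and isomorphisms of balls preserve the origin.\<close>

definition cayley_edge :: "'a monoid \<times> 'a list \<Rightarrow> nat \<Rightarrow> 'a \<Rightarrow> 'a \<Rightarrow> bool" where
  "cayley_edge p i x y \<longleftrightarrow> x \<in> carrier (fst p) \<and> i < length (snd p) \<and> y = x \<otimes>\<^bsub>fst p\<^esub> (snd p ! i)"

definition cayley_ball :: "'a monoid \<times> 'a list \<Rightarrow> nat \<Rightarrow> 'a set" where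
  "cayley_ball p n = {word_eval (fst p) (snd p) w |w.
     fst ` set w \<subseteq> {..<length (snd p)} \<and> length w \<le> n}"

definition ball_iso :: "nat \<Rightarrow> 'a monoid \<times> 'a list \<Rightarrow> 'b monoid \<times> 'b list \<Rightarrow> bool" where
  "ball_iso n p q \<longleftrightarrow> (\<exists>\<psi>. bij_betw \<psi> (cayley_ball p n) (cayley_ball q n) \<and>
     \<psi> \<one>\<^bsub>fst p\<^esub> = \<one>\<^bsub>fst q\<^esub> \<and>
     (\<forall>i. \<forall>x\<in>cayley_ball p n. \<forall>y\<in>cayley_ball p n.
        cayley_edge p i x y \<longleftrightarrow> cayley_edge q i (\<psi> x) (\<psi> y)))"

text \<open>If not even the balls of radius \<open>0\<close> are isomorphic (their loops may differ), the supremum is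
  \<open>0\<close> and the distance is \<open>1\<close>.\<close>

definition marked_dist :: "'a monoid \<times> 'a list \<Rightarrow> 'b monoid \<times> 'b list \<Rightarrow> real" where
  "marked_dist p q = (case Sup (enat ` {n. ball_iso n p q}) of enat n \<Rightarrow> (1/2) ^ n | \<infinity> \<Rightarrow> 0)"

text \<open>The choice of representatives is immaterial; see \<open>class_dist_eq\<close> below.\<close>

definition class_dist :: "('a monoid \<times> 'a list) set \<Rightarrow> ('a monoid \<times> 'a list) set \<Rightarrow> real" where
  "class_dist c c' = marked_dist (SOME p. p \<in> c) (SOME q. q \<in> c')"

definition marked_top :: "nat \<Rightarrow> ('a monoid \<times> 'a list) set topology" where
  "marked_top d = Metric_space.mtopology (marked_space d) class_dist"

lemma ball_iso_word_eval:
  assumes G: "group G" "set S \<subseteq> carrier G" and H: "group H" "set S' \<subseteq> carrier H"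
    and len: "length S' = length S"
    and one: "\<psi> \<one>\<^bsub>G\<^esub> = \<one>\<^bsub>H\<^esub>"
    and im: "\<psi> ` cayley_ball (G, S) n \<subseteq> cayley_ball (H, S') n"
    and edge: "\<And>i x y. x \<in> cayley_ball (G, S) n \<Longrightarrow> y \<in> cayley_ball (G, S) n \<Longrightarrow>
                 cayley_edge (G, S) i x y \<longleftrightarrow> cayley_edge (H, S') i (\<psi> x) (\<psi> y)"
    and w: "fst ` set w \<subseteq> {..<length S}" "length w \<le> n"
  shows "\<psi> (word_eval G S w) = word_eval H S' w"
  using w
proof (induction w rule: rev_induct)
  case Nil
  then show ?case using one by (simp add: word_eval_def)
next
  case (snoc a w)
  interpret G: group G by fact
  interpret H: group H by fact
  let ?x = "word_eval G S w" and ?y = "word_eval G S (w @ [a])"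
  let ?x' = "word_eval H S' w" and ?y' = "word_eval H S' (w @ [a])"
  have i: "fst a < length S" and lw: "fst ` set w \<subseteq> {..<length S}" using snoc.prems by auto
  have s: "S ! fst a \<in> carrier G" "S' ! fst a \<in> carrier H" using i G H len by auto
  have x: "?x \<in> carrier G" "?x' \<in> carrier H"
    using G.word_eval_closed[OF G(2) lw] H.word_eval_closed[OF H(2), of w] lw len by simp_all
  have y: "?y \<in> carrier G" "?y' \<in> carrier H"
    using G.word_eval_closed[OF G(2) snoc.prems(1)] H.word_eval_closed[OF H(2), of "w @ [a]"]
      snoc.prems(1) len by simp_all
  have xb: "?x \<in> cayley_ball (G, S) n" and yb: "?y \<in> cayley_ball (G, S) n"
    using snoc.prems lw unfolding cayley_ball_def by force+
  have IH: "\<psi> ?x = ?x'" using snoc lw by simp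
  have py: "\<psi> ?y \<in> carrier H"
  proof -
    have "\<psi> ?y \<in> cayley_ball (H, S') n" using im yb by blast
    then obtain v where "fst ` set v \<subseteq> {..<length S'}" "\<psi> ?y = word_eval H S' v"
      by (auto simp: cayley_ball_def)
    then show ?thesis using H.word_eval_closed[OF H(2), of v] by simp
  qed
  have yx: "?y = ?x \<otimes>\<^bsub>G\<^esub> letter_eval G S a" "?y' = ?x' \<otimes>\<^bsub>H\<^esub> letter_eval H S' a"
    using G.word_eval_append[of S w "[a]"] H.word_eval_append[of S' w "[a]"] lw i G H len
      G.letter_eval_closed[of S a] H.letter_eval_closed[of S' a]
    by (simp_all add: word_eval_def)
  show ?case
  proof (cases "snd a")
    case True
    then have "cayley_edge (G, S) (fst a) ?x ?y"
      using yx x i by (simp add: cayley_edge_def letter_eval_def)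
    then have "cayley_edge (H, S') (fst a) ?x' (\<psi> ?y)" using edge[OF xb yb] IH by simp
    then show ?thesis using yx True by (simp add: cayley_edge_def letter_eval_def)
  next
    case False
    then have "?x = ?y \<otimes>\<^bsub>G\<^esub> (S ! fst a)"
      using yx x s by (simp add: letter_eval_def G.m_assoc)
    then have "cayley_edge (G, S) (fst a) ?y ?x" using y i by (simp add: cayley_edge_def)
    then have "?x' = \<psi> ?y \<otimes>\<^bsub>H\<^esub> (S' ! fst a)"
      using edge[OF yb xb, of "fst a"] IH unfolding cayley_edge_def by simp
    then have "\<psi> ?y = ?x' \<otimes>\<^bsub>H\<^esub> inv\<^bsub>H\<^esub> (S' ! fst a)"
      using py s x by (simp add: H.m_assoc)
    then show ?thesis using yx False by (simp add: letter_eval_def)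
  qed
qed

lemma marked_groupsD:
  assumes "p \<in> marked_groups d"
  shows "group (fst p)" "set (snd p) \<subseteq> carrier (fst p)" "length (snd p) = d"
  using assms by (auto simp: marked_groups_def)

lemma ball_iso_word_evalD:
  assumes p: "p \<in> marked_groups d" and q: "q \<in> marked_groups d" and "ball_iso n p q"
  shows "\<exists>\<psi>. bij_betw \<psi> (cayley_ball p n) (cayley_ball q n) \<and>
     \<psi> \<one>\<^bsub>fst p\<^esub> = \<one>\<^bsub>fst q\<^esub> \<and>
     (\<forall>i. \<forall>x\<in>cayley_ball p n. \<forall>y\<in>cayley_ball p n.
        cayley_edge p i x y \<longleftrightarrow> cayley_edge q i (\<psi> x) (\<psi> y)) \<and>
     (\<forall>w. fst ` set w \<subseteq> {..<d} \<and> length w \<le> n \<longrightarrow>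
        \<psi> (word_eval (fst p) (snd p) w) = word_eval (fst q) (snd q) w)"
proof -
  obtain \<psi> where \<psi>: "bij_betw \<psi> (cayley_ball p n) (cayley_ball q n)" "\<psi> \<one>\<^bsub>fst p\<^esub> = \<one>\<^bsub>fst q\<^esub>"
     "\<forall>i. \<forall>x\<in>cayley_ball p n. \<forall>y\<in>cayley_ball p n.
        cayley_edge p i x y \<longleftrightarrow> cayley_edge q i (\<psi> x) (\<psi> y)"
    using assms(3) by (auto simp: ball_iso_def)
  have "\<psi> (word_eval (fst p) (snd p) w) = word_eval (fst q) (snd q) w"
    if "fst ` set w \<subseteq> {..<d}" "length w \<le> n" for w
    by (rule ball_iso_word_eval[where n = n])
      (use marked_groupsD[OF p] marked_groupsD[OF q] \<psi> that in \<open>auto simp: bij_betw_def\<close>)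
  then show ?thesis using \<psi> by blast
qed

lemma ball_iso_sym:
  assumes "ball_iso n p q"
  shows "ball_iso n q p"
proof -
  obtain \<psi> where \<psi>: "bij_betw \<psi> (cayley_ball p n) (cayley_ball q n)" "\<psi> \<one>\<^bsub>fst p\<^esub> = \<one>\<^bsub>fst q\<^esub>"
     "\<forall>i. \<forall>x\<in>cayley_ball p n. \<forall>y\<in>cayley_ball p n.
        cayley_edge p i x y \<longleftrightarrow> cayley_edge q i (\<psi> x) (\<psi> y)"
    using assms by (auto simp: ball_iso_def)
  let ?\<theta> = "inv_into (cayley_ball p n) \<psi>"
  have one: "\<one>\<^bsub>fst p\<^esub> \<in> cayley_ball p n"
    by (auto simp: cayley_ball_def word_eval_def intro!: exI[of _ "[]"])
  have b: "bij_betw ?\<theta> (cayley_ball q n) (cayley_ball p n)" using \<psi>(1) by (rule bij_betw_inv_into)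
  have r: "\<psi> (?\<theta> x) = x" "?\<theta> x \<in> cayley_ball p n" if "x \<in> cayley_ball q n" for x
    using \<psi>(1) that b by (auto simp: bij_betw_inv_into_right bij_betw_apply)
  have "?\<theta> \<one>\<^bsub>fst q\<^esub> = \<one>\<^bsub>fst p\<^esub>" using bij_betw_inv_into_left[OF \<psi>(1) one] \<psi>(2) by simp
  moreover have "\<forall>i. \<forall>x\<in>cayley_ball q n. \<forall>y\<in>cayley_ball q n.
        cayley_edge q i x y \<longleftrightarrow> cayley_edge p i (?\<theta> x) (?\<theta> y)"
    using \<psi>(3) r by metis
  ultimately show ?thesis using b unfolding ball_iso_def by blast
qed

lemma ball_iso_trans:
  assumes "ball_iso n p q" "ball_iso n q r"
  shows "ball_iso n p r"
proof -
  obtain \<psi> where \<psi>: "bij_betw \<psi> (cayley_ball p n) (cayley_ball q n)" "\<psi> \<one>\<^bsub>fst p\<^esub> = \<one>\<^bsub>fst q\<^esub>"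
     "\<forall>i. \<forall>x\<in>cayley_ball p n. \<forall>y\<in>cayley_ball p n.
        cayley_edge p i x y \<longleftrightarrow> cayley_edge q i (\<psi> x) (\<psi> y)"
    using assms(1) by (auto simp: ball_iso_def)
  obtain \<theta> where \<theta>: "bij_betw \<theta> (cayley_ball q n) (cayley_ball r n)" "\<theta> \<one>\<^bsub>fst q\<^esub> = \<one>\<^bsub>fst r\<^esub>"
     "\<forall>i. \<forall>x\<in>cayley_ball q n. \<forall>y\<in>cayley_ball q n.
        cayley_edge q i x y \<longleftrightarrow> cayley_edge r i (\<theta> x) (\<theta> y)"
    using assms(2) by (auto simp: ball_iso_def)
  have "bij_betw (\<theta> \<circ> \<psi>) (cayley_ball p n) (cayley_ball r n)"
    using \<psi>(1) \<theta>(1) by (rule bij_betw_trans)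
  moreover have "(\<theta> \<circ> \<psi>) \<one>\<^bsub>fst p\<^esub> = \<one>\<^bsub>fst r\<^esub>" using \<psi> \<theta> by simp
  moreover have "\<forall>i. \<forall>x\<in>cayley_ball p n. \<forall>y\<in>cayley_ball p n.
        cayley_edge p i x y \<longleftrightarrow> cayley_edge r i ((\<theta> \<circ> \<psi>) x) ((\<theta> \<circ> \<psi>) y)"
    using \<psi>(3) \<theta>(3) \<psi>(1) by (simp add: bij_betw_apply)
  ultimately show ?thesis unfolding ball_iso_def by blast
qed

lemma ball_iso_mono:
  assumes p: "p \<in> marked_groups d" and q: "q \<in> marked_groups d" and "ball_iso n p q" "m \<le> n"
  shows "ball_iso m p q"
proof -
  obtain \<psi> where \<psi>: "bij_betw \<psi> (cayley_ball p n) (cayley_ball q n)" "\<psi> \<one>\<^bsub>fst p\<^esub> = \<one>\<^bsub>fst q\<^esub>"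
     "\<forall>i. \<forall>x\<in>cayley_ball p n. \<forall>y\<in>cayley_ball p n.
        cayley_edge p i x y \<longleftrightarrow> cayley_edge q i (\<psi> x) (\<psi> y)"
     "\<forall>w. fst ` set w \<subseteq> {..<d} \<and> length w \<le> n \<longrightarrow>
        \<psi> (word_eval (fst p) (snd p) w) = word_eval (fst q) (snd q) w"
    using ball_iso_word_evalD[OF assms(1-3)] by blast
  have sub: "cayley_ball p m \<subseteq> cayley_ball p n" using \<open>m \<le> n\<close> unfolding cayley_ball_def
    by (blast intro: order_trans)
  have len: "length (snd p) = d" "length (snd q) = d" using marked_groupsD p q by blast+
  have im: "\<psi> ` cayley_ball p m = cayley_ball q m"
  proof (intro equalityI subsetI)
    fix y assume "y \<in> \<psi> ` cayley_ball p m"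
    then obtain w where "fst ` set w \<subseteq> {..<d}" "length w \<le> m"
        "y = \<psi> (word_eval (fst p) (snd p) w)"
      using len by (auto simp: cayley_ball_def)
    then show "y \<in> cayley_ball q m" using \<psi>(4) \<open>m \<le> n\<close> len
      by (auto simp: cayley_ball_def intro!: exI[of _ w])
  next
    fix y assume "y \<in> cayley_ball q m"
    then obtain w where w: "fst ` set w \<subseteq> {..<d}" "length w \<le> m" "y = word_eval (fst q) (snd q) w"
      using len by (auto simp: cayley_ball_def)
    then have "y = \<psi> (word_eval (fst p) (snd p) w)" using \<psi>(4) \<open>m \<le> n\<close> by auto
    moreover have "word_eval (fst p) (snd p) w \<in> cayley_ball p m"
      using w len by (auto simp: cayley_ball_def)
    ultimately show "y \<in> \<psi> ` cayley_ball p m" by blast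
  qed
  have "bij_betw \<psi> (cayley_ball p m) (cayley_ball q m)"
    using bij_betw_subset[OF \<psi>(1) sub im] .
  then show ?thesis unfolding ball_iso_def using \<psi>(2,3) sub by blast
qed

lemma marked_group_word:
  assumes "p \<in> marked_groups d" "x \<in> carrier (fst p)"
  shows "\<exists>w. fst ` set w \<subseteq> {..<d} \<and> x = word_eval (fst p) (snd p) w"
proof -
  obtain G S where [simp]: "p = (G, S)" by (cases p)
  interpret group G using marked_groupsD[OF assms(1)] by simp
  have S: "set S \<subseteq> carrier G" "length S = d" using marked_groupsD[OF assms(1)] by auto
  have "x \<in> generate G (set S)" using assms by (auto simp: marked_groups_def)
  then have "\<exists>w. fst ` set w \<subseteq> {..<d} \<and> x = word_eval G S w"
  proof induction
    case one
    then show ?case by (intro exI[of _ "[]"]) (simp add: word_eval_def)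
  next
    case (incl h)
    then obtain i where "i < d" "h = S ! i" using S by (metis in_set_conv_nth)
    then show ?case using S incl
      by (intro exI[of _ "[(i, True)]"]) (auto simp: word_eval_def letter_eval_def subsetD)
  next
    case (inv h)
    then obtain i where "i < d" "h = S ! i" using S by (metis in_set_conv_nth)
    then show ?case using S inv
      by (intro exI[of _ "[(i, False)]"]) (auto simp: word_eval_def letter_eval_def subsetD)
  next
    case (eng h1 h2)
    then obtain u v where "fst ` set u \<subseteq> {..<d}" "h1 = word_eval G S u"
        "fst ` set v \<subseteq> {..<d}" "h2 = word_eval G S v" by blast
    then show ?case using word_eval_append[of S u v] S
      by (intro exI[of _ "u @ v"]) auto
  qed
  then show ?thesis by simp
qed

lemma marked_isomorphic_word_eval:
  assumes "group G" "group H" "set S \<subseteq> carrier G" "\<alpha> \<in> hom G H"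
    "fst ` set w \<subseteq> {..<length S}"
  shows "\<alpha> (word_eval G S w) = word_eval H (map \<alpha> S) w"
  using assms(5)
proof (induction w)
  case Nil
  then show ?case using hom_one[OF assms(4,1,2)] by (simp add: word_eval_def)
next
  case (Cons a w)
  interpret group_hom G H \<alpha>
    using assms by (simp add: group_hom_def group_hom_axioms_def)
  have "S ! fst a \<in> carrier G" using Cons.prems assms(3) by auto
  then have "\<alpha> (letter_eval G S a) = letter_eval H (map \<alpha> S) a"
    using Cons.prems by (auto simp: letter_eval_def)
  moreover have "letter_eval G S a \<in> carrier G" "word_eval G S w \<in> carrier G"
    using Cons.prems assms(3) by (auto intro!: G.letter_eval_closed G.word_eval_closed)
  ultimately show ?case using Cons by (simp add: word_eval_def)
qed

lemma marked_isomorphic_ball_iso: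
  assumes p: "p \<in> marked_groups d" and q: "q \<in> marked_groups d" and "marked_isomorphic p q"
  shows "ball_iso n p q"
proof -
  obtain G S H S' where [simp]: "p = (G, S)" "q = (H, S')" by (cases p, cases q)
  have G: "group G" "set S \<subseteq> carrier G" "length S = d" and H: "group H" "length S' = d"
    using marked_groupsD[OF p] marked_groupsD[OF q] by auto
  interpret G: group G by fact
  obtain \<alpha> where \<alpha>: "\<alpha> \<in> iso G H" "map \<alpha> S = S'"
    using assms(3) by (auto simp: marked_isomorphic_def)
  have hom: "\<alpha> \<in> hom G H" and bij: "bij_betw \<alpha> (carrier G) (carrier H)"
    using \<alpha>(1) by (auto simp: iso_def)
  have ev: "\<alpha> (word_eval G S w) = word_eval H S' w" if "fst ` set w \<subseteq> {..<d}" for w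
    using marked_isomorphic_word_eval[OF G(1) H(1) G(2) hom] that \<alpha>(2) G(3) by simp
  have sub: "cayley_ball p n \<subseteq> carrier G"
    using G by (auto simp: cayley_ball_def intro!: G.word_eval_closed)
  have im: "\<alpha> ` cayley_ball p n = cayley_ball q n"

  proof (intro equalityI subsetI)
    fix y assume "y \<in> \<alpha> ` cayley_ball p n"
    then obtain w where "fst ` set w \<subseteq> {..<d}" "length w \<le> n" "y = \<alpha> (word_eval G S w)"
      using G(3) by (auto simp: cayley_ball_def)
    then show "y \<in> cayley_ball q n"
      using ev[of w] H(2) by (auto simp: cayley_ball_def intro!: exI[of _ w])
  next
    fix y assume "y \<in> cayley_ball q n"
    then obtain w where w: "fst ` set w \<subseteq> {..<d}" "length w \<le> n" "y = word_eval H S' w"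
      using H(2) by (auto simp: cayley_ball_def)
    then have "word_eval G S w \<in> cayley_ball p n" using G(3) by (auto simp: cayley_ball_def)
    then show "y \<in> \<alpha> ` cayley_ball p n" using ev[of w] w by (metis imageI)
  qed
  have "\<alpha> \<one>\<^bsub>G\<^esub> = \<one>\<^bsub>H\<^esub>" using hom_one[OF hom G(1) H(1)] .
  moreover have "cayley_edge p i x y \<longleftrightarrow> cayley_edge q i (\<alpha> x) (\<alpha> y)"
    if "x \<in> cayley_ball p n" "y \<in> cayley_ball p n" for i x y
  proof -
    have xy: "x \<in> carrier G" "y \<in> carrier G" using that sub by auto
    have "\<alpha> y = \<alpha> x \<otimes>\<^bsub>H\<^esub> S' ! i \<longleftrightarrow> y = x \<otimes>\<^bsub>G\<^esub> S ! i" if i: "i < d"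
    proof -
      have s: "S ! i \<in> carrier G" "S' ! i = \<alpha> (S ! i)" using i G \<alpha>(2) by auto
      have "\<alpha> x \<otimes>\<^bsub>H\<^esub> S' ! i = \<alpha> (x \<otimes>\<^bsub>G\<^esub> S ! i)" using hom xy s by (simp add: hom_mult)
      then show ?thesis using bij xy s by (auto simp: bij_betw_def inj_on_def)
    qed
    then show ?thesis using xy G H bij by (auto simp: cayley_edge_def bij_betw_apply)
  qed
  ultimately show ?thesis
    unfolding ball_iso_def using bij_betw_subset[OF bij sub im] by auto
qed

lemma ball_iso_marked_isomorphic:
  assumes p: "p \<in> marked_groups d" and q: "q \<in> marked_groups d" and iso: "\<And>n. ball_iso n p q"
  shows "marked_isomorphic p q"
proof -
  obtain G S H S' where [simp]: "p = (G, S)" "q = (H, S')" by (cases p, cases q)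
  have G: "group G" "set S \<subseteq> carrier G" "length S = d"
    and H: "group H" "set S' \<subseteq> carrier H" "length S' = d"
    using marked_groupsD[OF p] marked_groupsD[OF q] by auto
  interpret G: group G by fact
  interpret H: group H by fact
  define W where "W = {w :: letter list. fst ` set w \<subseteq> {..<d}}"
  have key: "word_eval G S u = word_eval G S v \<longleftrightarrow> word_eval H S' u = word_eval H S' v"
    if "u \<in> W" "v \<in> W" for u v
  proof -
    define n where "n = max (length u) (length v)"
    obtain \<psi> where \<psi>: "bij_betw \<psi> (cayley_ball p n) (cayley_ball q n)"
       "\<forall>w. fst ` set w \<subseteq> {..<d} \<and> length w \<le> n \<longrightarrow>
          \<psi> (word_eval (fst p) (snd p) w) = word_eval (fst q) (snd q) w"
      using ball_iso_word_evalD[OF p q iso] by blast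
    have "word_eval G S u \<in> cayley_ball p n" "word_eval G S v \<in> cayley_ball p n"
      using that G unfolding W_def cayley_ball_def n_def by auto
    moreover have "\<psi> (word_eval G S u) = word_eval H S' u" "\<psi> (word_eval G S v) = word_eval H S' v"
      using \<psi>(2) that by (auto simp: W_def n_def)
    moreover have "inj_on \<psi> (cayley_ball p n)" using \<psi>(1) by (simp add: bij_betw_def)
    ultimately show ?thesis using inj_on_eq_iff by metis
  qed
  have surj: "\<exists>w\<in>W. x = word_eval G S w" if "x \<in> carrier G" for x
    using marked_group_word[OF p] that by (auto simp: W_def)
  have surj': "\<exists>w\<in>W. x = word_eval H S' w" if "x \<in> carrier H" for x
    using marked_group_word[OF q] that by (auto simp: W_def)
  define \<alpha> where "\<alpha> x = word_eval H S' (SOME w. w \<in> W \<and> x = word_eval G S w)" for x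
  have \<alpha>: "\<alpha> (word_eval G S w) = word_eval H S' w" if "w \<in> W" for w
  proof -
    let ?v = "SOME v. v \<in> W \<and> word_eval G S w = word_eval G S v"
    have "?v \<in> W \<and> word_eval G S w = word_eval G S ?v" using that by (intro someI) auto
    then show ?thesis using key[OF that, of ?v] by (simp add: \<alpha>_def)
  qed
  have cl: "word_eval G S w \<in> carrier G" "word_eval H S' w \<in> carrier H" if "w \<in> W" for w
    using that G H by (auto simp: W_def intro!: G.word_eval_closed H.word_eval_closed)
  have "\<alpha> \<in> hom G H"
  proof (rule homI)
    fix x y assume "x \<in> carrier G" "y \<in> carrier G"
    then obtain u v where uv: "u \<in> W" "v \<in> W" "x = word_eval G S u" "y = word_eval G S v"
      using surj by blast
    then have "u @ v \<in> W" by (auto simp: W_def)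
    then show "\<alpha> (x \<otimes>\<^bsub>G\<^esub> y) = \<alpha> x \<otimes>\<^bsub>H\<^esub> \<alpha> y"
      using uv \<alpha>[of "u @ v"] \<alpha>[of u] \<alpha>[of v]
        G.word_eval_append[of S u v] H.word_eval_append[of S' u v] G H
      by (simp add: W_def)
  next
    fix x assume "x \<in> carrier G"
    then obtain u where "u \<in> W" "x = word_eval G S u" using surj by blast
    then show "\<alpha> x \<in> carrier H" using \<alpha> cl by simp
  qed
  moreover have "bij_betw \<alpha> (carrier G) (carrier H)"
  proof (rule bij_betw_imageI)
    show "inj_on \<alpha> (carrier G)" 
    proof (rule inj_onI)
      fix x y assume "x \<in> carrier G" "y \<in> carrier G" and e: "\<alpha> x = \<alpha> y"
      then obtain u v where uv: "u \<in> W" "v \<in> W" "x = word_eval G S u" "y = word_eval G S v"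
        using surj by blast
      then show "x = y" using e \<alpha> key by simp
    qed
    show "\<alpha> ` carrier G = carrier H" 
    proof (intro equalityI subsetI)
      fix y assume "y \<in> \<alpha> ` carrier G"
      then obtain u where "u \<in> W" "y = \<alpha> (word_eval G S u)" using surj by blast
      then show "y \<in> carrier H" using \<alpha> cl by simp
    next
      fix y assume "y \<in> carrier H"
      then obtain u where u: "u \<in> W" "y = word_eval H S' u" using surj' by blast
      then have "y = \<alpha> (word_eval G S u)" using \<alpha> by simp
      then show "y \<in> \<alpha> ` carrier G" using u cl by blast
    qed
  qed
  moreover have "map \<alpha> S = S'"
  proof (rule nth_equalityI)
    fix i assume "i < length (map \<alpha> S)"
    then have i: "i < d" using G by simp
    then have "\<alpha> (word_eval G S [(i, True)]) = word_eval H S' [(i, True)]"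
      by (intro \<alpha>) (simp add: W_def)
    then show "map \<alpha> S ! i = S' ! i"
      using i G H by (simp add: G.word_eval_generator H.word_eval_generator)
  qed (simp add: G H)
  ultimately show ?thesis by (auto simp: marked_isomorphic_def iso_def)
qed

lemma equiv_marked_rel: "equiv (marked_groups d) (marked_rel d)"
proof (rule equivI)
  show "marked_rel d \<subseteq> marked_groups d \<times> marked_groups d" by (auto simp: marked_rel_def)
  show "refl_on (marked_groups d) (marked_rel d)"
    by (rule refl_onI)
      (auto simp: marked_rel_def marked_isomorphic_def intro!: bexI[of _ "\<lambda>x. x"] iso_set_refl)
  show "sym (marked_rel d)"
  proof (rule symI)
    fix p q assume "(p, q) \<in> marked_rel d"
    then have m: "p \<in> marked_groups d" "q \<in> marked_groups d" "marked_isomorphic p q"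
      by (auto simp: marked_rel_def)
    have "marked_isomorphic q p"
      by (rule ball_iso_marked_isomorphic[OF m(2,1)])
        (rule ball_iso_sym[OF marked_isomorphic_ball_iso[OF m]])
    then show "(q, p) \<in> marked_rel d" using m by (simp add: marked_rel_def)
  qed
  show "trans (marked_rel d)"
  proof (rule transI)
    fix p q r assume "(p, q) \<in> marked_rel d" "(q, r) \<in> marked_rel d"
    then have m: "p \<in> marked_groups d" "q \<in> marked_groups d" "marked_isomorphic p q"
        "r \<in> marked_groups d" "marked_isomorphic q r"
      by (auto simp: marked_rel_def)
    have "marked_isomorphic p r"
      by (rule ball_iso_marked_isomorphic[OF m(1,4)])
        (rule ball_iso_trans[OF marked_isomorphic_ball_iso[OF m(1-3)]
            marked_isomorphic_ball_iso[OF m(2,4,5)]])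
    then show "(p, r) \<in> marked_rel d" using m by (simp add: marked_rel_def)
  qed
qed

lemma Sup_enat_downward_closed:
  fixes A :: "nat set"
  assumes "\<And>m n. n \<in> A \<Longrightarrow> m \<le> n \<Longrightarrow> m \<in> A" "enat n \<le> Sup (enat ` A)" "n \<noteq> 0"
  shows "n \<in> A"
proof (rule ccontr)
  assume "n \<notin> A"
  then have "m \<le> n - 1" if "m \<in> A" for m using assms(1)[OF that, of n] by (cases "m < n") auto
  then have "Sup (enat ` A) \<le> enat (n - 1)" by (intro Sup_least) auto
  then have "enat n \<le> enat (n - 1)" using assms(2) by (rule order_trans[rotated])
  then show False using assms(3) by simp
qed

lemma marked_dist_le_iff:
  fixes p :: "'a monoid \<times> 'a list" and q :: "'b monoid \<times> 'b list"
  assumes "p \<in> marked_groups d" "q \<in> marked_groups d" "n \<noteq> 0"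
  shows "marked_dist p q \<le> (1/2) ^ n \<longleftrightarrow> ball_iso n p q"
proof -
  let ?A = "{n. ball_iso n p q}"
  have "marked_dist p q \<le> (1/2) ^ n \<longleftrightarrow> enat n \<le> Sup (enat ` ?A)"
    by (cases "Sup (enat ` ?A)") (auto simp: marked_dist_def power_decreasing_iff)
  also have "\<dots> \<longleftrightarrow> n \<in> ?A"
    using Sup_enat_downward_closed[of ?A n] ball_iso_mono[OF assms(1,2)] assms(3)
    by (auto intro: Sup_upper)
  finally show ?thesis by simp
qed

lemma marked_dist_values: "marked_dist p q = 0 \<or> (\<exists>n. marked_dist p q = (1/2) ^ n)"
  by (auto simp: marked_dist_def split: enat.split)

lemma marked_dist_commute: "marked_dist p q = marked_dist q p"
proof -
  have "ball_iso n p q \<longleftrightarrow> ball_iso n q p" for n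
    by (rule iffI; rule ball_iso_sym)
  then show ?thesis by (simp add: marked_dist_def)
qed

lemma marked_dist_nonneg: "0 \<le> marked_dist p q"
  and marked_dist_le_1: "marked_dist p q \<le> 1"
  using marked_dist_values[of p q] by (auto simp: power_le_one)

lemma marked_dist_ultrametric:
  fixes p :: "'a monoid \<times> 'a list" and q :: "'b monoid \<times> 'b list" and r :: "'c monoid \<times> 'c list"
  assumes "p \<in> marked_groups d" "q \<in> marked_groups d" "r \<in> marked_groups d"
  shows "marked_dist p r \<le> max (marked_dist p q) (marked_dist q r)"
proof -
  have le: "marked_dist p r \<le> (1/2) ^ n"
    if "marked_dist p q \<le> (1/2) ^ n" "marked_dist q r \<le> (1/2) ^ n" for n
  proof (cases "n = 0")
    case True
    then show ?thesis using marked_dist_le_1[of p r] by simp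
  next
    case False
    then have "ball_iso n p q" "ball_iso n q r"
      using that marked_dist_le_iff[OF assms(1,2)] marked_dist_le_iff[OF assms(2,3)] by simp_all
    then have "ball_iso n p r" by (rule ball_iso_trans)
    then show ?thesis using marked_dist_le_iff[OF assms(1,3) False] by simp
  qed
  show ?thesis
  proof (cases "max (marked_dist p q) (marked_dist q r) = 0")
    case True
    then have "marked_dist p q \<le> 0" "marked_dist q r \<le> 0" by linarith+
    then have "marked_dist p r \<le> (1/2) ^ n" for n
      by (intro le) (auto intro: order_trans)
    moreover have "(\<lambda>n. (1/2) ^ n :: real) \<longlonglongrightarrow> 0" by (rule LIMSEQ_power_zero) simp
    ultimately have "marked_dist p r \<le> 0" by (intro LIMSEQ_le_const) auto
    then show ?thesis using True by simp
  next
    case False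
    then have "\<exists>n. max (marked_dist p q) (marked_dist q r) = (1/2) ^ n"
      using marked_dist_values[of p q] marked_dist_values[of q r] by (metis max_def)
    then obtain n where n: "max (marked_dist p q) (marked_dist q r) = (1/2) ^ n" by blast
    then show ?thesis using le[of n] by linarith
  qed
qed

lemma marked_dist_eq_0_iff:
  fixes p :: "'a monoid \<times> 'a list" and q :: "'b monoid \<times> 'b list"
  assumes "p \<in> marked_groups d" "q \<in> marked_groups d"
  shows "marked_dist p q = 0 \<longleftrightarrow> marked_isomorphic p q"
proof
  assume 0: "marked_dist p q = 0"
  have "ball_iso (Suc n) p q" for n using marked_dist_le_iff[OF assms, of "Suc n"] 0 by simp
  then have "ball_iso n p q" for n using ball_iso_mono[OF assms] le_SucI by blast
  then show "marked_isomorphic p q" using ball_iso_marked_isomorphic assms by blast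
next
  assume "marked_isomorphic p q"
  then have "marked_dist p q \<le> (1/2) ^ n" for n
    using marked_dist_le_iff[OF assms, of n] marked_isomorphic_ball_iso[OF assms] marked_dist_le_1[of p q]
    by (cases "n = 0") auto
  moreover have "(\<lambda>n. (1/2) ^ n :: real) \<longlonglongrightarrow> 0" by (rule LIMSEQ_power_zero) simp
  ultimately have "marked_dist p q \<le> 0" by (intro LIMSEQ_le_const) auto
  then show "marked_dist p q = 0" using marked_dist_nonneg[of p q] by simp
qed

lemma class_dist_eq:
  assumes "c \<in> marked_space d" "c' \<in> marked_space d" "p \<in> c" "q \<in> c'"
  shows "class_dist c c' = marked_dist p q"
proof -
  have "marked_dist p' q' = marked_dist p q" if "p' \<in> c" "q' \<in> c'" for p' q'
  proof -
    have "(p, p') \<in> marked_rel d" "(q, q') \<in> marked_rel d"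
      using assms that equiv_marked_rel quotient_eq_iff unfolding marked_space_def by metis+
    then have m: "p \<in> marked_groups d" "p' \<in> marked_groups d" "q \<in> marked_groups d" "q' \<in> marked_groups d"
      and i: "marked_isomorphic p p'" "marked_isomorphic q q'"
      by (auto simp: marked_rel_def)
    have z: "marked_dist p p' = 0" "marked_dist q q' = 0"
      using marked_dist_eq_0_iff[OF m(1,2)] marked_dist_eq_0_iff[OF m(3,4)] i by auto
    have "marked_dist p' q' \<le> marked_dist p q"
      using marked_dist_ultrametric[OF m(2,1,4)] marked_dist_ultrametric[OF m(1,3,4)] z
        marked_dist_commute[of p p'] marked_dist_nonneg[of p q] by linarith
    moreover have "marked_dist p q \<le> marked_dist p' q'"
      using marked_dist_ultrametric[OF m(1,2,3)] marked_dist_ultrametric[OF m(2,4,3)] z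
        marked_dist_commute[of q q'] marked_dist_nonneg[of p' q'] by linarith
    ultimately show ?thesis by linarith
  qed
  moreover have "(SOME p. p \<in> c) \<in> c" "(SOME q. q \<in> c') \<in> c'"
    using assms(3,4) by (auto intro: someI)
  ultimately show ?thesis by (simp add: class_dist_def)
qed

theorem Metric_space_marked_space:
  "Metric_space (marked_space d :: ('a monoid \<times> 'a list) set set) class_dist"
proof
  have ne: "\<exists>p. p \<in> c \<and> p \<in> marked_groups d" if c: "c \<in> marked_space d"
    for c :: "('a monoid \<times> 'a list) set"
  proof -
    obtain p where p: "p \<in> marked_groups d" "c = marked_rel d `` {p}"
      using c unfolding marked_space_def by (rule quotientE)
    have "p \<in> c" unfolding p(2) by (rule equiv_class_self[OF equiv_marked_rel p(1)])
    then show ?thesis using p(1) by (intro exI conjI)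
  qed
  show "0 \<le> class_dist c c'" for c c' by (simp add: class_dist_def marked_dist_nonneg)
  show "class_dist c c' = class_dist c' c" for c c'
    unfolding class_dist_def by (rule marked_dist_commute)
  fix c c' :: "('a monoid \<times> 'a list) set"
  assume c: "c \<in> marked_space d" "c' \<in> marked_space d"
  obtain p where p: "p \<in> c" "p \<in> marked_groups d" using ne[OF c(1)] by (elim exE conjE)
  obtain q where q: "q \<in> c'" "q \<in> marked_groups d" using ne[OF c(2)] by (elim exE conjE)
  show "class_dist c c' = 0 \<longleftrightarrow> c = c'"
    using class_dist_eq[OF c p(1) q(1)] marked_dist_eq_0_iff[OF p(2) q(2)] p q
      quotient_eq_iff[OF equiv_marked_rel c[unfolded marked_space_def] p(1) q(1)]
    by (simp add: marked_rel_def)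
  fix c'' :: "('a monoid \<times> 'a list) set"
  assume c'': "c'' \<in> marked_space d"
  obtain r where r: "r \<in> c''" "r \<in> marked_groups d" using ne[OF c''] by (elim exE conjE)
  show "class_dist c c'' \<le> class_dist c c' + class_dist c' c''"
    using class_dist_eq[OF c p(1) q(1)] class_dist_eq[OF c(2) c'' q(1) r(1)]
      class_dist_eq[OF c(1) c'' p(1) r(1)] marked_dist_ultrametric[OF p(2) q(2) r(2)]
      marked_dist_nonneg[of p q] marked_dist_nonneg[of q r] by linarith
qed

lemma marked_group_on_nat:
  fixes p :: "'a monoid \<times> 'a list"
  assumes p: "p \<in> marked_groups d"
  shows "\<exists>q :: nat monoid \<times> nat list. q \<in> marked_groups d \<and> marked_isomorphic p q"
proof -
  obtain G S where [simp]: "p = (G, S)" by (cases p)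
  interpret G: group G using marked_groupsD[OF p] by simp
  have S: "set S \<subseteq> carrier G" "length S = d" "generate G (set S) = carrier G"
    using p by (auto simp: marked_groups_def)
  have "carrier G \<subseteq> word_eval G S ` UNIV" using marked_group_word[OF p] by auto
  then have "countable (carrier G)" by (rule countable_subset) simp
  then obtain f :: "'a \<Rightarrow> nat" where f: "inj_on f (carrier G)" by (auto simp: countable_def)
  define H where "H = image_group f G"
  have H: "group H" and iso: "f \<in> iso G H"
    using G.inj_imp_image_group_is_group[OF f] inj_imp_image_group_iso[OF f] by (auto simp: H_def)
  interpret group_hom G H f
    using H iso by (simp add: group_hom_def group_hom_axioms_def iso_def G.is_group)
  have "generate H (f ` set S) = f ` carrier G" using generate_img[OF S(1)] S(3) by simp
  also have "\<dots> = carrier H" using iso by (simp add: iso_def bij_betw_def)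
  finally have "(H, map f S) \<in> marked_groups d"
    using H S iso by (auto simp: marked_groups_def)
  moreover have "marked_isomorphic p (H, map f S)" using iso by (auto simp: marked_isomorphic_def)
  ultimately show ?thesis by blast
qed

section \<open>The functions on the space of marked groups\<close>

text \<open>On reduced words, \<open>word_eval G S\<close> is the epimorphism from the free group
  sending the \<open>i\<close>-th generator to \<open>S ! i\<close>.\<close>

definition marking_push :: "'a monoid \<Rightarrow> 'a list \<Rightarrow> (letter list \<Rightarrow> complex) \<Rightarrow> 'a \<Rightarrow> complex" where
  "marking_push G S = push_forward (free_group (length S)) (word_eval G S)"

definition T_fun :: "(letter list \<Rightarrow> complex) \<Rightarrow> ('a monoid \<times> 'a list) set \<Rightarrow> complex" where
  "T_fun f c = the_elem ((\<lambda>(G, S). vN_trace G (L1_rep G (marking_push G S f))) ` c)"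

definition D_fun :: "(letter list \<Rightarrow> complex) \<Rightarrow> ('a monoid \<times> 'a list) set \<Rightarrow> real" where
  "D_fun f c = the_elem ((\<lambda>(G, S). fk_det G (L1_rep G (marking_push G S f))) ` c)"

end

theory Submission
  imports Defs "HOL-Library.Function_Algebras" "HOL-Computational_Algebra.Fundamental_Theorem_Algebra"
begin

text \<open>The group algebra \<open>L\<^sup>1(F\<^sub>d)\<close> acts on every \<open>L\<^sup>2(\<Gamma>)\<close> through the marking \<open>\<phi>\<close>, and the trace of the
  operator of \<open>f\<close> is the sum of \<open>f\<close> over \<open>ker \<phi>\<close>. Up to a small tail of \<open>f\<close> this sum involves finitely
  many words, and two markings with isomorphic large balls have the same relations among them; hence (a).
  For (b), a unit \<open>f\<close> with inverse \<open>k\<close> satisfies \<open>2 ln det f = \<tau>(ln (f\<^sup>*f))\<close>, where the spectrum of \<open>f\<^sup>*f\<close>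
  lies in an interval in \<open>(0, \<infinity>)\<close> that depends only on the norms of \<open>f\<close> and \<open>k\<close>. Approximating \<open>ln\<close>
  uniformly on that interval by polynomials \<open>p\<close> exhibits \<open>ln det\<close> as a uniform limit of the functions
  \<open>\<tau>(p(f\<^sup>*f)) / 2\<close>, which are continuous by (a).\<close>

section \<open>The Hilbert space of square-summable functions\<close>

text \<open>\<open>cfc\<close> is a definite description over all polynomial sequences that converge
  on the spectrum, so nothing is known about the determinant until the norm of \<open>p(H)\<close>
  is bounded by the supremum of \<open>|p|\<close> over the spectrum of a self-adjoint
  \<open>H\<close>. Three elementary facts give this bound. Perturbation through Banach's fixed
  point theorem locates spectra. The fundamental theorem of algebra factors \<open>q(H)\<close> into
  shifts, so a non-invertible \<open>q(H)\<close> forces a root of \<open>q\<close> into the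
  spectrum. And \<open>K\<^sup>2 - c\<^sup>2\<close> is never invertible for self-adjoint
  \<open>K\<close> of norm \<open>c > 0\<close>; with \<open>K = p(H)\<close> it produces a spectral
  point where \<open>|p|\<close> equals the norm. The interval for \<open>f\<^sup>*f\<close> has
  upper end \<open>\<parallel>f\<parallel>\<^sup>2\<close> because the representation does not
  increase norms, and its lower end comes from \<open>\<parallel>x\<parallel> = \<parallel>k f
  x\<parallel> \<le> \<parallel>k\<parallel> \<parallel>f x\<parallel>\<close>; neither sees the
  group. The functions live on isomorphism classes. Independence of the representative follows from
  the continuity estimate itself, because isomorphic markings have isomorphic balls of every
  radius.\<close>

definition cscale :: "complex \<Rightarrow> ('a \<Rightarrow> complex) \<Rightarrow> 'a \<Rightarrow> complex" (infixr "\<odot>" 75)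
  where "c \<odot> x = (\<lambda>g. c * x g)"

lemma cscale_apply [simp]: "(c \<odot> x) g = c * x g"
  by (simp add: cscale_def)

lemma cscale_one [simp]: "1 \<odot> x = x"
  and cscale_zero [simp]: "0 \<odot> x = 0" "c \<odot> 0 = 0"
  and cscale_cscale [simp]: "a \<odot> b \<odot> x = (a * b) \<odot> x"
  and cscale_minus_one: "(-1) \<odot> x = - x"
  by (auto simp: fun_eq_iff)

lemma cscale_add_right: "c \<odot> (x + y) = c \<odot> x + c \<odot> y"
  and cscale_add_left: "(a + b) \<odot> x = a \<odot> x + b \<odot> x"
  and cscale_minus_left: "(- a) \<odot> x = - (a \<odot> x)"
  by (auto simp: fun_eq_iff algebra_simps)

lemma l2_zero_outside: "x \<in> Lp 2 G \<Longrightarrow> g \<notin> carrier G \<Longrightarrow> x g = 0"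
  by (simp add: Lp_def)

lemma l2_summable: "x \<in> Lp 2 G \<Longrightarrow> (\<lambda>g. (cmod (x g))\<^sup>2) summable_on carrier G"
  by (simp add: Lp_def)

lemma l2_norm_power2: "(l2_norm G x)\<^sup>2 = infsum (\<lambda>g. (cmod (x g))\<^sup>2) (carrier G)"
  by (simp add: l2_norm_def infsum_nonneg)

lemma l2_norm_nonneg [simp]: "0 \<le> l2_norm G x"
  by (simp add: l2_norm_def infsum_nonneg)

lemma L2_set_le_l2_norm:
  assumes "x \<in> Lp 2 G" "finite F" "F \<subseteq> carrier G"
  shows "L2_set (\<lambda>g. cmod (x g)) F \<le> l2_norm G x"
  unfolding L2_set_def l2_norm_def
  by (rule real_sqrt_le_mono, rule finite_sum_le_infsum) (use assms l2_summable in auto)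

lemma cmod_le_l2_norm:
  assumes "x \<in> Lp 2 G"
  shows "cmod (x g) \<le> l2_norm G x"
proof (cases "g \<in> carrier G")
  case True
  then show ?thesis using L2_set_le_l2_norm[OF assms, of "{g}"] by (simp add: L2_set_def)
qed (use assms in \<open>simp add: l2_zero_outside\<close>)

text \<open>Membership and norm bound are both tested on finite subsets, where \<open>L2_set\<close>
  has the Minkowski inequality; sums, limits and the operators of \<open>L^1\<close> are treated
  this way.\<close>

lemma l2_boundI:
  assumes "\<And>g. g \<notin> carrier G \<Longrightarrow> x g = 0"
    and "\<And>F. finite F \<Longrightarrow> F \<subseteq> carrier G \<Longrightarrow> L2_set (\<lambda>g. cmod (x g)) F \<le> K"
  shows "x \<in> Lp 2 G" "l2_norm G x \<le> K"
proof -
  have K: "0 \<le> K" using assms(2)[of "{}"] by simp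
  have le: "(\<Sum>g\<in>F. (cmod (x g))\<^sup>2) \<le> K\<^sup>2" if "finite F" "F \<subseteq> carrier G" for F
    using assms(2)[OF that] K unfolding L2_set_def
    by (metis real_sqrt_le_iff real_sqrt_unique)
  have s: "(\<lambda>g. (cmod (x g))\<^sup>2) summable_on carrier G"
    by (rule nonneg_bdd_above_summable_on) (auto intro!: bdd_aboveI2[where M = "K\<^sup>2"] le)
  then show "x \<in> Lp 2 G" using assms(1) by (simp add: Lp_def)
  have "infsum (\<lambda>g. (cmod (x g))\<^sup>2) (carrier G) \<le> K\<^sup>2"
    using s le by (rule infsum_le_finite_sums)
  then show "l2_norm G x \<le> K" using K unfolding l2_norm_def by (simp add: real_le_lsqrt)
qed

lemma l2_add:
  assumes "x \<in> Lp 2 G" "y \<in> Lp 2 G"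
  shows "x + y \<in> Lp 2 G" "l2_norm G (x + y) \<le> l2_norm G x + l2_norm G y"
proof -
  have "L2_set (\<lambda>g. cmod ((x + y) g)) F \<le> l2_norm G x + l2_norm G y"
    if "finite F" "F \<subseteq> carrier G" for F
  proof -
    have "L2_set (\<lambda>g. cmod ((x + y) g)) F \<le> L2_set (\<lambda>g. cmod (x g) + cmod (y g)) F"
      by (rule L2_set_mono) (auto simp: norm_triangle_ineq)
    also have "\<dots> \<le> L2_set (\<lambda>g. cmod (x g)) F + L2_set (\<lambda>g. cmod (y g)) F"
      by (rule L2_set_triangle_ineq)
    also have "\<dots> \<le> l2_norm G x + l2_norm G y"
      using L2_set_le_l2_norm[OF assms(1) that] L2_set_le_l2_norm[OF assms(2) that] by simp
    finally show ?thesis .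
  qed
  then show "x + y \<in> Lp 2 G" "l2_norm G (x + y) \<le> l2_norm G x + l2_norm G y"
    using l2_boundI[of G "x + y" "l2_norm G x + l2_norm G y"] assms
    by (auto simp: l2_zero_outside)
qed

lemma l2_scale:
  assumes "x \<in> Lp 2 G"
  shows "c \<odot> x \<in> Lp 2 G"
  using assms by (auto simp: Lp_def norm_mult power_mult_distrib intro!: summable_on_cmult_right)

lemma l2_norm_scale: "l2_norm G (c \<odot> x) = cmod c * l2_norm G x"
  by (simp add: l2_norm_def norm_mult power_mult_distrib infsum_cmult_right' real_sqrt_mult)

lemma l2_zero [simp]: "0 \<in> Lp 2 G" "l2_norm G 0 = 0"
  by (auto simp: Lp_def l2_norm_def)

lemma l2_minus: "x \<in> Lp 2 G \<Longrightarrow> - x \<in> Lp 2 G"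
  using l2_scale[of x G "-1"] by (simp add: cscale_minus_one)

lemma l2_norm_minus [simp]: "l2_norm G (- x) = l2_norm G x"
  using l2_norm_scale[of G "-1" x] by (simp add: cscale_minus_one)

lemma l2_diff: "x \<in> Lp 2 G \<Longrightarrow> y \<in> Lp 2 G \<Longrightarrow> x - y \<in> Lp 2 G"
  using l2_add(1)[of x G "- y"] l2_minus[of y G] by simp

lemma l2_norm_diff_commute: "l2_norm G (x - y) = l2_norm G (y - x)"
  by (metis l2_norm_minus minus_diff_eq)

lemma l2_norm_diff_triangle:
  assumes "x \<in> Lp 2 G" "y \<in> Lp 2 G" "z \<in> Lp 2 G"
  shows "l2_norm G (x - z) \<le> l2_norm G (x - y) + l2_norm G (y - z)"
  using l2_add(2)[OF l2_diff[OF assms(1,2)] l2_diff[OF assms(2,3)]] by simp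

lemma l2_norm_diff_le:
  assumes "x \<in> Lp 2 G" "y \<in> Lp 2 G"
  shows "l2_norm G (x - y) \<le> l2_norm G x + l2_norm G y"
  using l2_add(2)[OF assms(1) l2_minus[OF assms(2)]] by simp

lemma l2_norm_eq_0:
  assumes "x \<in> Lp 2 G" "l2_norm G x = 0"
  shows "x = 0"
  using cmod_le_l2_norm[OF assms(1)] assms(2) by (auto simp: fun_eq_iff)

text \<open>Cauchy-Schwarz on finite subsets, passed to the supremum. The absolute form is kept
  because it also licenses the interchange of sums in \<open>hom_rep_inner\<close>.\<close>

lemma l2_prod_summable:
  assumes "x \<in> Lp 2 G" "y \<in> Lp 2 G"
  shows "(\<lambda>g. cmod (x g * cnj (y g))) summable_on carrier G"
    and "infsum (\<lambda>g. cmod (x g * cnj (y g))) (carrier G) \<le> l2_norm G x * l2_norm G y"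
proof -
  have le: "(\<Sum>g\<in>F. cmod (x g * cnj (y g))) \<le> l2_norm G x * l2_norm G y"
    if "finite F" "F \<subseteq> carrier G" for F
  proof -
    have "(\<Sum>g\<in>F. cmod (x g * cnj (y g))) \<le> L2_set (\<lambda>g. cmod (x g)) F * L2_set (\<lambda>g. cmod (y g)) F"
      using L2_set_mult_ineq[of "\<lambda>g. cmod (x g)" "\<lambda>g. cmod (y g)" F] by (simp add: norm_mult)
    also have "\<dots> \<le> l2_norm G x * l2_norm G y"
      by (intro mult_mono L2_set_le_l2_norm assms that) auto
    finally show ?thesis .
  qed
  show s: "(\<lambda>g. cmod (x g * cnj (y g))) summable_on carrier G"
    by (rule nonneg_bdd_above_summable_on)
      (auto intro!: bdd_aboveI2[where M = "l2_norm G x * l2_norm G y"] le)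
  show "infsum (\<lambda>g. cmod (x g * cnj (y g))) (carrier G) \<le> l2_norm G x * l2_norm G y"
    using s le by (rule infsum_le_finite_sums)
qed

lemma l2_Cauchy_Schwarz:
  assumes "x \<in> Lp 2 G" "y \<in> Lp 2 G"
  shows "cmod (l2_inner G x y) \<le> l2_norm G x * l2_norm G y"
  unfolding l2_inner_def
  using norm_infsum_bound[OF l2_prod_summable(1)[OF assms]] l2_prod_summable(2)[OF assms] by linarith

lemma l2_inner_add_left:
  assumes "x \<in> Lp 2 G" "y \<in> Lp 2 G" "z \<in> Lp 2 G"
  shows "l2_inner G (x + y) z = l2_inner G x z + l2_inner G y z"
  unfolding l2_inner_def using assms
  by (simp add: distrib_right infsum_add abs_summable_summable[OF l2_prod_summable(1)])

lemma l2_inner_scale_left: "l2_inner G (c \<odot> x) z = c * l2_inner G x z"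
  by (simp add: l2_inner_def infsum_cmult_right' mult.assoc)

lemma l2_inner_commute: "l2_inner G x y = cnj (l2_inner G y x)"
  by (simp add: l2_inner_def mult.commute flip: infsum_cnj)

lemma l2_inner_diff_left:
  assumes "x \<in> Lp 2 G" "y \<in> Lp 2 G" "z \<in> Lp 2 G"
  shows "l2_inner G (x - y) z = l2_inner G x z - l2_inner G y z"
  using l2_inner_add_left[OF assms(1) l2_minus[OF assms(2)] assms(3)]
    l2_inner_scale_left[of G "-1" y z] by (simp add: cscale_minus_one)

lemma l2_inner_add_right:
  assumes "x \<in> Lp 2 G" "y \<in> Lp 2 G" "z \<in> Lp 2 G"
  shows "l2_inner G z (x + y) = l2_inner G z x + l2_inner G z y"
  using l2_inner_add_left[OF assms] l2_inner_commute[of G z] by simp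

lemma l2_inner_diff_right:
  assumes "x \<in> Lp 2 G" "y \<in> Lp 2 G" "z \<in> Lp 2 G"
  shows "l2_inner G z (x - y) = l2_inner G z x - l2_inner G z y"
  using l2_inner_diff_left[OF assms] l2_inner_commute[of G z] by simp

lemma l2_inner_scale_right: "l2_inner G z (c \<odot> x) = cnj c * l2_inner G z x"
  using l2_inner_scale_left[of G c x z] l2_inner_commute[of G z] by simp

lemma l2_inner_self:
  assumes "x \<in> Lp 2 G"
  shows "l2_inner G x x = of_real ((l2_norm G x)\<^sup>2)"
proof -
  have "((\<lambda>g. complex_of_real ((cmod (x g))\<^sup>2)) has_sum of_real ((l2_norm G x)\<^sup>2)) (carrier G)"
    unfolding l2_norm_power2 by (intro has_sum_of_real has_sum_infsum l2_summable assms)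
  then show ?thesis unfolding l2_inner_def complex_norm_square[symmetric] by (rule infsumI)
qed

lemma l2_inner_eq_0:
  assumes "x \<in> Lp 2 G" "\<And>y. y \<in> Lp 2 G \<Longrightarrow> l2_inner G y x = 0"
  shows "x = 0"
  using assms(2)[OF assms(1)] l2_norm_eq_0[OF assms(1)] by (simp add: l2_inner_self[OF assms(1)])

text \<open>Coordinates are dominated by the norm, so the sequence converges pointwise. The Cauchy
  estimate survives on each finite set of coordinates when one index tends to infinity, and
  \<open>l2_boundI\<close> reassembles the norm.\<close>

lemma l2_complete:
  assumes X: "\<And>n. X n \<in> Lp 2 G"
    and Cauchy: "\<And>e. e > 0 \<Longrightarrow> \<exists>M. \<forall>m\<ge>M. \<forall>n\<ge>M. l2_norm G (X m - X n) < e"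
  shows "\<exists>x\<in>Lp 2 G. (\<lambda>n. l2_norm G (X n - x)) \<longlonglongrightarrow> 0"
proof -
  have d: "X m - X n \<in> Lp 2 G" for m n using X by (rule l2_diff) (rule X)
  have "\<exists>l. (\<lambda>n. X n g) \<longlonglongrightarrow> l" for g
  proof -
    have "Cauchy (\<lambda>n. X n g)"
    proof (rule CauchyI)
      fix e :: real assume "0 < e"
      then obtain M where M: "\<forall>m\<ge>M. \<forall>n\<ge>M. l2_norm G (X m - X n) < e" using Cauchy by blast
      have "cmod (X m g - X n g) < e" if "m \<ge> M" "n \<ge> M" for m n
        using cmod_le_l2_norm[OF d[of m n], of g] M that by force
      then show "\<exists>M. \<forall>m\<ge>M. \<forall>n\<ge>M. cmod (X m g - X n g) < e" by blast
    qed
    then show ?thesis by (simp add: Cauchy_convergent_iff convergent_def)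
  qed
  then obtain x where x: "\<And>g. (\<lambda>n. X n g) \<longlonglongrightarrow> x g" by metis
  have x0: "x g = 0" if "g \<notin> carrier G" for g
    using x[of g] l2_zero_outside[OF X that] by (simp add: LIMSEQ_const_iff)
  have *: "\<exists>M. \<forall>m\<ge>M. X m - x \<in> Lp 2 G \<and> l2_norm G (X m - x) \<le> e" if "e > 0" for e
  proof -
    obtain M where M: "\<forall>m\<ge>M. \<forall>n\<ge>M. l2_norm G (X m - X n) < e" using Cauchy \<open>e > 0\<close> by blast
    have "L2_set (\<lambda>g. cmod ((X m - x) g)) F \<le> e" if "m \<ge> M" "finite F" "F \<subseteq> carrier G" for m F
    proof (rule tendsto_upperbound)
      show "(\<lambda>n. L2_set (\<lambda>g. cmod (X m g - X n g)) F) \<longlonglongrightarrow> L2_set (\<lambda>g. cmod ((X m - x) g)) F"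
        unfolding L2_set_def by (auto intro!: tendsto_intros x)
      show "\<forall>\<^sub>F n in sequentially. L2_set (\<lambda>g. cmod (X m g - X n g)) F \<le> e"
        unfolding eventually_sequentially
      proof (intro exI allI impI)
        fix n assume "n \<ge> M"
        then have "l2_norm G (X m - X n) < e" using M that by blast
        then show "L2_set (\<lambda>g. cmod (X m g - X n g)) F \<le> e"
          using L2_set_le_l2_norm[OF d[of m n] that(2,3)] by simp
      qed
    qed simp
    then show ?thesis using l2_boundI[of G "X m - x" e for m] x0 l2_zero_outside[OF X]
      by (intro exI[of _ M]) auto
  qed
  obtain m where "X m - x \<in> Lp 2 G" using *[of 1] by auto
  then have "X m - (X m - x) \<in> Lp 2 G" by (rule l2_diff[OF X])
  then have "x \<in> Lp 2 G" by simp
  moreover have "(\<lambda>n. l2_norm G (X n - x)) \<longlonglongrightarrow> 0"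
  proof (rule LIMSEQ_I)
    fix e :: real assume "0 < e"
    then obtain M where "\<forall>m\<ge>M. l2_norm G (X m - x) \<le> e / 2" using *[of "e/2"] by auto
    then show "\<exists>M. \<forall>n\<ge>M. norm (l2_norm G (X n - x) - 0) < e"
      using \<open>0 < e\<close> by (intro exI[of _ M]) force
  qed
  ultimately show ?thesis by blast
qed

text \<open>The vectors form a set and not a type, so the metric is handed to the set-based locale,
  which provides Banach's fixed point theorem for \<open>Units_perturb\<close>.\<close>

lemma Metric_space_l2: "Metric_space (Lp 2 G) (\<lambda>x y. l2_norm G (x - y))"
proof
  show "l2_norm G (x - y) = l2_norm G (y - x)" for x y by (rule l2_norm_diff_commute)
  show "l2_norm G (x - y) = 0 \<longleftrightarrow> x = y" if "x \<in> Lp 2 G" "y \<in> Lp 2 G" for x y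
    using l2_norm_eq_0[OF l2_diff[OF that]] by auto
qed (auto intro: l2_norm_diff_triangle)

lemma mcomplete_l2: "Metric_space.mcomplete (Lp 2 G) (\<lambda>x y. l2_norm G (x - y))"
proof -
  interpret Metric_space "Lp 2 G" "\<lambda>x y. l2_norm G (x - y)" by (rule Metric_space_l2)
  show ?thesis unfolding mcomplete_def
  proof (intro allI impI)
    fix X assume X: "MCauchy X"
    then have X': "X n \<in> Lp 2 G" for n by (auto simp: MCauchy_def)
    have "\<exists>M. \<forall>m\<ge>M. \<forall>n\<ge>M. l2_norm G (X m - X n) < e" if "e > 0" for e
      using X that by (simp add: MCauchy_def)
    from l2_complete[of X G, OF X' this]
    obtain x where "x \<in> Lp 2 G" "(\<lambda>n. l2_norm G (X n - x)) \<longlonglongrightarrow> 0" by blast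
    then show "\<exists>x. limitin mtopology X x sequentially"
      using X' by (auto simp: limitin_metric_dist_null)
  qed
qed

section \<open>Operators in the group von Neumann algebra\<close>

text \<open>Spelled exactly like the norm inside \<open>cfc\<close>, with
  \<open>op_scale G (-1)\<close> for the minus sign, so that limit statements match that
  definition.\<close>

abbreviation op_dist :: "('a, 'b) monoid_scheme \<Rightarrow> 'a l2_op \<Rightarrow> 'a l2_op \<Rightarrow> real" where
  "op_dist G A B \<equiv> op_norm G (op_add G A (op_scale G (-1) B))"

abbreviation op_shift :: "('a, 'b) monoid_scheme \<Rightarrow> 'a l2_op \<Rightarrow> complex \<Rightarrow> 'a l2_op" where
  "op_shift G A z \<equiv> op_add G A (op_scale G (- z) (op_id G))"

text \<open>Stated by inner products, because \<open>adjoint_op\<close> is a definite description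
  that says nothing until an adjoint has been exhibited.\<close>

definition self_adjoint :: "('a, 'b) monoid_scheme \<Rightarrow> 'a l2_op \<Rightarrow> bool" where
  "self_adjoint G A \<longleftrightarrow> (\<forall>x\<in>Lp 2 G. \<forall>y\<in>Lp 2 G. l2_inner G (A x) y = l2_inner G x (A y))"

lemma op_add_apply [simp]: "x \<in> Lp 2 G \<Longrightarrow> op_add G A B x = A x + B x"
  by (simp add: op_add_def fun_eq_iff)

lemma op_scale_apply [simp]: "x \<in> Lp 2 G \<Longrightarrow> op_scale G c A x = c \<odot> A x"
  by (simp add: op_scale_def fun_eq_iff)

lemma op_id_apply [simp]: "x \<in> Lp 2 G \<Longrightarrow> op_id G x = x"
  by (simp add: op_id_def)

lemma vN_mult_apply [simp]: "x \<in> Lp 2 G \<Longrightarrow> (A \<otimes>\<^bsub>vN G\<^esub> B) x = A (B x)"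
  by (simp add: vN_def compose_def)

lemma vN_one: "\<one>\<^bsub>vN G\<^esub> = op_id G"
  by (simp add: vN_def)

lemma left_translate_add: "left_translate G a (x + y) = left_translate G a x + left_translate G a y"
  and left_translate_scale: "left_translate G a (c \<odot> x) = c \<odot> left_translate G a x"
  by (auto simp: left_translate_def fun_eq_iff)

lemma vN_I:
  assumes "A \<in> extensional (Lp 2 G)" "\<And>x. x \<in> Lp 2 G \<Longrightarrow> A x \<in> Lp 2 G"
    and "\<And>x y. x \<in> Lp 2 G \<Longrightarrow> y \<in> Lp 2 G \<Longrightarrow> A (x + y) = A x + A y"
    and "\<And>x c. x \<in> Lp 2 G \<Longrightarrow> A (c \<odot> x) = c \<odot> A x"
    and "\<And>x. x \<in> Lp 2 G \<Longrightarrow> l2_norm G (A x) \<le> K * l2_norm G x"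
    and "\<And>a x. a \<in> carrier G \<Longrightarrow> x \<in> Lp 2 G \<Longrightarrow> A (left_translate G a x) = left_translate G a (A x)"
  shows "A \<in> carrier (vN G)"
  using assms
  by (auto simp: vN_def bounded_ops_def PiE_def Pi_def plus_fun_def cscale_def intro!: exI[of _ K])

lemma vN_D:
  assumes "A \<in> carrier (vN G)"
  shows vN_extensional: "A \<in> extensional (Lp 2 G)"
    and vN_closed: "x \<in> Lp 2 G \<Longrightarrow> A x \<in> Lp 2 G"
    and vN_add: "x \<in> Lp 2 G \<Longrightarrow> y \<in> Lp 2 G \<Longrightarrow> A (x + y) = A x + A y"
    and vN_scale: "x \<in> Lp 2 G \<Longrightarrow> A (c \<odot> x) = c \<odot> A x"
    and vN_translate: "a \<in> carrier G \<Longrightarrow> x \<in> Lp 2 G \<Longrightarrow>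
      A (left_translate G a x) = left_translate G a (A x)"
  using assms by (auto simp: vN_def bounded_ops_def plus_fun_def cscale_def PiE_iff)

lemma vN_minus:
  assumes "A \<in> carrier (vN G)" "x \<in> Lp 2 G"
  shows "A (- x) = - A x"
  using vN_scale[OF assms, of "-1"] by (simp add: cscale_minus_one)

lemma vN_diff:
  assumes "A \<in> carrier (vN G)" "x \<in> Lp 2 G" "y \<in> Lp 2 G"
  shows "A (x - y) = A x - A y"
  using vN_add[OF assms(1,2) l2_minus[OF assms(3)]] vN_minus[OF assms(1,3)] by simp

lemma vN_zero: "A \<in> carrier (vN G) \<Longrightarrow> A 0 = 0"
  using vN_scale[of A G 0 0] by simp

lemma vN_eqI:
  assumes "A \<in> carrier (vN G)" "B \<in> carrier (vN G)" "\<And>x. x \<in> Lp 2 G \<Longrightarrow> A x = B x"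
  shows "A = B"
  using vN_extensional[OF assms(1)] vN_extensional[OF assms(2)] assms(3) by (rule extensionalityI)

section \<open>The operator norm\<close>

lemma vN_bounded:
  assumes "A \<in> carrier (vN G)"
  shows "\<exists>K\<ge>0. \<forall>x\<in>Lp 2 G. l2_norm G (A x) \<le> K * l2_norm G x"
proof -
  obtain K where K: "\<And>x. x \<in> Lp 2 G \<Longrightarrow> l2_norm G (A x) \<le> K * l2_norm G x"
    using assms unfolding vN_def bounded_ops_def by fastforce
  have "l2_norm G (A x) \<le> \<bar>K\<bar> * l2_norm G x" if "x \<in> Lp 2 G" for x
    using K[OF that] mult_right_mono[OF abs_ge_self[of K] l2_norm_nonneg[of G x]] by linarith
  then show ?thesis by (intro exI[of _ "\<bar>K\<bar>"]) simp
qed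

lemma bdd_above_op_norm:
  assumes "A \<in> carrier (vN G)"
  shows "bdd_above ((\<lambda>x. l2_norm G (A x)) ` {x \<in> Lp 2 G. l2_norm G x \<le> 1})"
proof -
  obtain K where "K \<ge> 0" "\<forall>x\<in>Lp 2 G. l2_norm G (A x) \<le> K * l2_norm G x"
    using vN_bounded[OF assms] by blast
  then show ?thesis
    by (intro bdd_aboveI2[where M = K]) (auto intro: order_trans mult_left_le)
qed

lemma op_norm_ge_0:
  assumes "A \<in> carrier (vN G)"
  shows "0 \<le> op_norm G A"
  unfolding op_norm_def
  by (rule cSUP_upper2[OF bdd_above_op_norm[OF assms], of 0]) (auto simp: vN_zero[OF assms])

lemma op_norm_bound:
  assumes "A \<in> carrier (vN G)" "x \<in> Lp 2 G"
  shows "l2_norm G (A x) \<le> op_norm G A * l2_norm G x"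
proof (cases "l2_norm G x = 0")
  case True
  then show ?thesis using l2_norm_eq_0[OF assms(2) True] vN_zero[OF assms(1)] by simp
next
  case False
  then have pos: "l2_norm G x > 0" using l2_norm_nonneg[of G x] by linarith
  let ?c = "complex_of_real (inverse (l2_norm G x))"
  have "l2_norm G (A (?c \<odot> x)) \<le> op_norm G A"
    unfolding op_norm_def
    by (rule cSUP_upper[OF _ bdd_above_op_norm[OF assms(1)]])
      (use assms(2) pos in \<open>auto simp: l2_scale l2_norm_scale norm_inverse\<close>)
  then show ?thesis
    using pos by (simp add: vN_scale[OF assms] l2_norm_scale norm_divide divide_simps mult.commute)
qed

lemma op_norm_leI:
  assumes "0 \<le> K" "\<And>x. x \<in> Lp 2 G \<Longrightarrow> l2_norm G (A x) \<le> K * l2_norm G x"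
  shows "op_norm G A \<le> K"
  unfolding op_norm_def
proof (rule cSUP_least)
  show "{x \<in> Lp 2 G. l2_norm G x \<le> 1} \<noteq> {}" using l2_zero[of G] by (auto intro!: exI[of _ 0])
  fix x assume "x \<in> {x \<in> Lp 2 G. l2_norm G x \<le> 1}"
  then have "l2_norm G (A x) \<le> K * l2_norm G x" "K * l2_norm G x \<le> K"
    using assms by (auto intro: mult_left_le)
  then show "l2_norm G (A x) \<le> K" by (rule order_trans)
qed

lemma (in group) left_translate_closed:
  assumes a: "a \<in> carrier G" and x: "x \<in> Lp 2 G"
  shows "left_translate G a x \<in> Lp 2 G"
proof -
  have "bij_betw (\<lambda>g. inv a \<otimes> g) (carrier G) (carrier G)"
    using a by (intro bij_betwI[of _ _ _ "\<lambda>g. a \<otimes> g"]) (auto simp flip: m_assoc)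
  then have "(\<lambda>g. (cmod (x (inv a \<otimes> g)))\<^sup>2) summable_on carrier G"
    using summable_on_reindex_bij_betw[of _ _ _ "\<lambda>g. (cmod (x g))\<^sup>2"] l2_summable[OF x] by blast
  then show ?thesis
    by (auto simp: Lp_def left_translate_def cong: summable_on_cong)
qed

context group
begin

lemma op_add_closed:
  assumes A: "A \<in> carrier (vN G)" and B: "B \<in> carrier (vN G)"
  shows "op_add G A B \<in> carrier (vN G)"
proof (rule vN_I)
  show "l2_norm G (op_add G A B x) \<le> (op_norm G A + op_norm G B) * l2_norm G x"
    if x: "x \<in> Lp 2 G" for x
    using l2_add(2)[OF vN_closed[OF A x] vN_closed[OF B x]] op_norm_bound[OF A x]
      op_norm_bound[OF B x] x
    by (simp add: algebra_simps)
qed (simp_all add: l2_add l2_scale vN_closed[OF A] vN_closed[OF B] vN_add[OF A] vN_add[OF B]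
  vN_scale[OF A] vN_scale[OF B] vN_translate[OF A] vN_translate[OF B] left_translate_add
  left_translate_closed cscale_add_right, simp add: op_add_def)

lemma op_scale_closed:
  assumes A: "A \<in> carrier (vN G)"
  shows "op_scale G c A \<in> carrier (vN G)"
proof (rule vN_I)
  show "l2_norm G (op_scale G c A x) \<le> (cmod c * op_norm G A) * l2_norm G x"
    if x: "x \<in> Lp 2 G" for x
    using op_norm_bound[OF A x] x by (simp add: l2_norm_scale mult.assoc mult_left_mono)
qed (simp_all add: l2_add l2_scale vN_closed[OF A] vN_add[OF A] vN_scale[OF A]
  vN_translate[OF A] left_translate_scale left_translate_closed cscale_add_right mult.commute,
  simp add: op_scale_def)

lemma op_id_closed: "op_id G \<in> carrier (vN G)"
  by (rule vN_I[where K = 1]) (auto simp: l2_add l2_scale left_translate_closed, simp add: op_id_def)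

lemma vN_mult_closed:
  assumes A: "A \<in> carrier (vN G)" and B: "B \<in> carrier (vN G)"
  shows "A \<otimes>\<^bsub>vN G\<^esub> B \<in> carrier (vN G)"
proof (rule vN_I)
  show "l2_norm G ((A \<otimes>\<^bsub>vN G\<^esub> B) x) \<le> (op_norm G A * op_norm G B) * l2_norm G x"
    if x: "x \<in> Lp 2 G" for x
    using op_norm_bound[OF A vN_closed[OF B x]]
      mult_left_mono[OF op_norm_bound[OF B x] op_norm_ge_0[OF A]] x by (simp add: mult.assoc)
  show "A \<otimes>\<^bsub>vN G\<^esub> B \<in> extensional (Lp 2 G)" by (simp add: vN_def)
qed (simp_all add: l2_add(1) l2_scale vN_closed[OF A] vN_closed[OF B] vN_add[OF A] vN_add[OF B]
  vN_scale[OF A] vN_scale[OF B] vN_translate[OF A] vN_translate[OF B] left_translate_closed,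
  simp_all add: fun_eq_iff)

lemmas vN_intros = op_add_closed op_scale_closed op_id_closed vN_mult_closed

lemma monoid_vN: "monoid (vN G)"
proof (rule monoidI)
  fix A B C assume A: "A \<in> carrier (vN G)" and B: "B \<in> carrier (vN G)" and C: "C \<in> carrier (vN G)"
  show "A \<otimes>\<^bsub>vN G\<^esub> B \<otimes>\<^bsub>vN G\<^esub> C = A \<otimes>\<^bsub>vN G\<^esub> (B \<otimes>\<^bsub>vN G\<^esub> C)"
    by (rule vN_eqI[where G = G]) (auto intro!: vN_mult_closed A B C simp: vN_closed[OF C])
next
  fix A assume A: "A \<in> carrier (vN G)"
  show "\<one>\<^bsub>vN G\<^esub> \<otimes>\<^bsub>vN G\<^esub> A = A" "A \<otimes>\<^bsub>vN G\<^esub> \<one>\<^bsub>vN G\<^esub> = A"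
    by (rule vN_eqI[where G = G]; auto intro!: vN_mult_closed A op_id_closed simp: vN_one vN_closed[OF A])+
qed (auto simp: vN_one intro: vN_mult_closed op_id_closed)

section \<open>Norm distance, norm limits and completeness\<close>

lemma op_dist_closed:
  assumes "A \<in> carrier (vN G)" "B \<in> carrier (vN G)"
  shows "op_add G A (op_scale G (-1) B) \<in> carrier (vN G)"
  by (intro vN_intros assms)

lemma op_dist_nonneg: "A \<in> carrier (vN G) \<Longrightarrow> B \<in> carrier (vN G) \<Longrightarrow> 0 \<le> op_dist G A B"
  by (rule op_norm_ge_0[OF op_dist_closed])

lemma op_dist_bound:
  assumes "A \<in> carrier (vN G)" "B \<in> carrier (vN G)" "x \<in> Lp 2 G"
  shows "l2_norm G (A x - B x) \<le> op_dist G A B * l2_norm G x"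
  using op_norm_bound[OF op_dist_closed[OF assms(1,2)] assms(3)] assms(3)
  by (simp add: cscale_minus_one)

lemma op_dist_leI:
  assumes "0 \<le> K" "\<And>x. x \<in> Lp 2 G \<Longrightarrow> l2_norm G (A x - B x) \<le> K * l2_norm G x"
  shows "op_dist G A B \<le> K"
  by (rule op_norm_leI) (use assms in \<open>auto simp: cscale_minus_one\<close>)

lemma op_dist_commute:
  assumes "A \<in> carrier (vN G)" "B \<in> carrier (vN G)"
  shows "op_dist G A B = op_dist G B A"
  by (rule antisym; rule op_dist_leI; (subst l2_norm_diff_commute)?)
    (use assms in \<open>auto intro: op_dist_nonneg op_dist_bound\<close>)

lemma op_dist_triangle:
  assumes A: "A \<in> carrier (vN G)" and B: "B \<in> carrier (vN G)" and C: "C \<in> carrier (vN G)"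
  shows "op_dist G A C \<le> op_dist G A B + op_dist G B C"
proof (rule op_dist_leI)
  show "0 \<le> op_dist G A B + op_dist G B C" by (intro add_nonneg_nonneg op_dist_nonneg A B C)
  fix x assume x: "x \<in> Lp 2 G"
  have "l2_norm G (A x - C x) \<le> l2_norm G (A x - B x) + l2_norm G (B x - C x)"
    by (intro l2_norm_diff_triangle vN_closed[OF A] vN_closed[OF B] vN_closed[OF C] A B C x)
  then show "l2_norm G (A x - C x) \<le> (op_dist G A B + op_dist G B C) * l2_norm G x"
    using op_dist_bound[OF A B x] op_dist_bound[OF B C x] by (simp add: distrib_right)
qed

lemma op_norm_triangle:
  assumes A: "A \<in> carrier (vN G)" and B: "B \<in> carrier (vN G)"
  shows "op_norm G A \<le> op_norm G B + op_dist G A B"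
proof (rule op_norm_leI)
  show "0 \<le> op_norm G B + op_dist G A B" by (intro add_nonneg_nonneg op_norm_ge_0 op_dist_nonneg A B)
  fix x assume x: "x \<in> Lp 2 G"
  have "l2_norm G (B x + (A x - B x)) \<le> l2_norm G (B x) + l2_norm G (A x - B x)"
    by (intro l2_add l2_diff vN_closed[OF A] vN_closed[OF B] A B x)
  then show "l2_norm G (A x) \<le> (op_norm G B + op_dist G A B) * l2_norm G x"
    using op_dist_bound[OF A B x] op_norm_bound[OF B x] by (simp add: distrib_right)
qed

lemma op_dist_eq_0D:
  assumes A: "A \<in> carrier (vN G)" and B: "B \<in> carrier (vN G)" and "op_dist G A B \<le> 0"
  shows "A = B"
proof (rule vN_eqI[OF A B])
  fix x assume x: "x \<in> Lp 2 G"
  have "op_dist G A B * l2_norm G x \<le> 0" using assms(3) by (simp add: mult_nonpos_nonneg)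
  then have "l2_norm G (A x - B x) = 0"
    using op_dist_bound[OF A B x] l2_norm_nonneg[of G "A x - B x"] by linarith
  then have "A x - B x = 0" by (rule l2_norm_eq_0[OF l2_diff[OF vN_closed[OF A x] vN_closed[OF B x]]])
  then show "A x = B x" by simp
qed

text \<open>Supplies the uniqueness that the definite description in \<open>cfc\<close>
  requires.\<close>

lemma op_limit_unique:
  assumes "\<And>n. A n \<in> carrier (vN G)" "B \<in> carrier (vN G)" "C \<in> carrier (vN G)"
    and "(\<lambda>n. op_dist G (A n) B) \<longlonglongrightarrow> 0" "(\<lambda>n. op_dist G (A n) C) \<longlonglongrightarrow> 0"
  shows "B = C"
proof (rule op_dist_eq_0D[OF assms(2,3)])
  have "(\<lambda>n. op_dist G (A n) B + op_dist G (A n) C) \<longlonglongrightarrow> 0 + 0"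
    by (intro tendsto_add assms)
  moreover have "op_dist G B C \<le> op_dist G (A n) B + op_dist G (A n) C" for n
    using op_dist_triangle[OF assms(2) assms(1) assms(3)] op_dist_commute[OF assms(1,2)] by metis
  ultimately show "op_dist G B C \<le> 0" by (intro LIMSEQ_le_const[of _ 0]) auto
qed

text \<open>\<open>A B - C D = A (B - D) + (A - C) D\<close>, with the norm of \<open>A\<close>
  estimated by that of \<open>C\<close> plus the distance. When \<open>A\<close> runs through a
  sequence with limit \<open>C\<close>, the bound tends to 0 without a separate bound on the norms
  in the sequence.\<close>

lemma op_dist_mult:
  assumes A: "A \<in> carrier (vN G)" and B: "B \<in> carrier (vN G)"
    and C: "C \<in> carrier (vN G)" and D: "D \<in> carrier (vN G)"
  shows "op_dist G (A \<otimes>\<^bsub>vN G\<^esub> B) (C \<otimes>\<^bsub>vN G\<^esub> D) \<le>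
    (op_norm G C + op_dist G A C) * op_dist G B D + op_dist G A C * op_norm G D"
proof (rule op_dist_leI)
  have nn: "0 \<le> op_norm G C" "0 \<le> op_norm G D" "0 \<le> op_dist G A C" "0 \<le> op_dist G B D" "0 \<le> op_norm G A"
    by (intro op_norm_ge_0 op_dist_nonneg A B C D)+
  then show "0 \<le> (op_norm G C + op_dist G A C) * op_dist G B D + op_dist G A C * op_norm G D"
    by simp
  fix x assume x: "x \<in> Lp 2 G"
  have "l2_norm G (A (B x) - C (D x)) \<le> l2_norm G (A (B x) - A (D x)) + l2_norm G (A (D x) - C (D x))"
    by (intro l2_norm_diff_triangle vN_closed[OF A] vN_closed[OF B] vN_closed[OF C] vN_closed[OF D] A B C D x)
  moreover have "l2_norm G (A (D x) - C (D x)) \<le> op_dist G A C * l2_norm G (D x)"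
    by (intro op_dist_bound vN_closed[OF A] vN_closed[OF C] vN_closed[OF D] A C D x)
  moreover have "op_dist G A C * l2_norm G (D x) \<le> op_dist G A C * (op_norm G D * l2_norm G x)"
    by (intro mult_left_mono op_norm_bound D x nn)
  moreover have "l2_norm G (A (B x) - A (D x)) \<le> op_norm G A * l2_norm G (B x - D x)"
    using op_norm_bound[OF A l2_diff[OF vN_closed[OF B x] vN_closed[OF D x]]]
    by (simp add: vN_diff[OF A] vN_closed[OF B x] vN_closed[OF D x])
  moreover have "op_norm G A * l2_norm G (B x - D x) \<le>
      (op_norm G C + op_dist G A C) * (op_dist G B D * l2_norm G x)"
    using nn by (intro mult_mono op_dist_bound B D x op_norm_triangle A C) auto
  ultimately show "l2_norm G ((A \<otimes>\<^bsub>vN G\<^esub> B) x - (C \<otimes>\<^bsub>vN G\<^esub> D) x) \<le>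
      ((op_norm G C + op_dist G A C) * op_dist G B D + op_dist G A C * op_norm G D) * l2_norm G x"
    using x by (simp add: algebra_simps)
qed

lemma op_limit_mult:
  assumes A: "\<And>n. A n \<in> carrier (vN G)" and B: "\<And>n. B n \<in> carrier (vN G)"
    and C: "C \<in> carrier (vN G)" and D: "D \<in> carrier (vN G)"
    and lim: "(\<lambda>n. op_dist G (A n) C) \<longlonglongrightarrow> 0" "(\<lambda>n. op_dist G (B n) D) \<longlonglongrightarrow> 0"
  shows "(\<lambda>n. op_dist G (A n \<otimes>\<^bsub>vN G\<^esub> B n) (C \<otimes>\<^bsub>vN G\<^esub> D)) \<longlonglongrightarrow> 0"
proof (rule tendsto_sandwich[of "\<lambda>_. 0"])
  show "(\<lambda>n. (op_norm G C + op_dist G (A n) C) * op_dist G (B n) D + op_dist G (A n) C * op_norm G D)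
      \<longlonglongrightarrow> 0"
    using lim by (auto intro!: tendsto_eq_intros)
qed (use A B C D in \<open>auto intro!: always_eventually op_dist_mult op_dist_nonneg vN_mult_closed\<close>)

text \<open>The limit is taken vector by vector. Its linearity and its commutation with left
  translations are read off coordinatewise; the Cauchy condition makes the convergence uniform on
  the unit ball.\<close>

lemma op_complete:
  assumes A: "\<And>n. A n \<in> carrier (vN G)"
    and Cauchy: "\<And>e. e > 0 \<Longrightarrow> \<exists>M. \<forall>m\<ge>M. \<forall>n\<ge>M. op_dist G (A m) (A n) < e"
  shows "\<exists>B\<in>carrier (vN G). (\<lambda>n. op_dist G (A n) B) \<longlonglongrightarrow> 0"
proof -
  have "\<exists>y\<in>Lp 2 G. (\<lambda>n. l2_norm G (A n x - y)) \<longlonglongrightarrow> 0" if x: "x \<in> Lp 2 G" for x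
  proof (rule l2_complete)
    fix e :: real assume "e > 0"
    \<comment> \<open>\<open>+ 1\<close> keeps the denominator positive when \<open>x\<close> is
      zero.\<close>
    let ?e = "e / (l2_norm G x + 1)"
    have pos: "0 < l2_norm G x + 1" using l2_norm_nonneg[of G x] by linarith
    then have "?e > 0" using \<open>e > 0\<close> by simp
    then obtain M where M: "\<forall>m\<ge>M. \<forall>n\<ge>M. op_dist G (A m) (A n) < ?e" using Cauchy by blast
    have "l2_norm G (A m x - A n x) < e" if "m \<ge> M" "n \<ge> M" for m n
    proof -
      have "l2_norm G (A m x - A n x) \<le> op_dist G (A m) (A n) * l2_norm G x"
        by (rule op_dist_bound[OF A A x])
      also have "\<dots> \<le> ?e * l2_norm G x" using M that by (intro mult_right_mono) (auto intro: less_imp_le)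
      also have "\<dots> < ?e * (l2_norm G x + 1)" using \<open>?e > 0\<close> by (intro mult_strict_left_mono) auto
      also have "\<dots> = e" using pos by simp
      finally show ?thesis .
    qed
    then show "\<exists>M. \<forall>m\<ge>M. \<forall>n\<ge>M. l2_norm G (A m x - A n x) < e" by blast
  qed (rule vN_closed[OF A x])
  then obtain B0 where B0: "\<And>x. x \<in> Lp 2 G \<Longrightarrow> B0 x \<in> Lp 2 G"
    "\<And>x. x \<in> Lp 2 G \<Longrightarrow> (\<lambda>n. l2_norm G (A n x - B0 x)) \<longlonglongrightarrow> 0" by metis
  define B where "B = restrict B0 (Lp 2 G)"
  have B: "B x \<in> Lp 2 G" "(\<lambda>n. l2_norm G (A n x - B x)) \<longlonglongrightarrow> 0" if "x \<in> Lp 2 G" for x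
    using B0 that by (simp_all add: B_def)
  have pt: "(\<lambda>n. A n x g) \<longlonglongrightarrow> B x g" if x: "x \<in> Lp 2 G" for x g
  proof -
    have "(\<lambda>n. A n x g - B x g) \<longlonglongrightarrow> 0"
      by (rule Lim_null_comparison[OF _ B(2)[OF x]])
        (use cmod_le_l2_norm[OF l2_diff[OF vN_closed[OF A x] B(1)[OF x]]] in auto)
    then show ?thesis by (simp add: LIM_zero_iff)
  qed
  \<comment> \<open>Identities for \<open>B\<close> will follow from uniqueness of coordinatewise
    limits.\<close>
  have ptI: "B x = y" if "x \<in> Lp 2 G" "\<And>g. (\<lambda>n. A n x g) \<longlonglongrightarrow> y g" for x y
    using LIMSEQ_unique[OF pt[OF that(1)] that(2)] by auto
  \<comment> \<open>Here \<open>n\<close> is fixed and \<open>m\<close> tends to infinity. The index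
    \<open>M\<close> does not depend on \<open>x\<close>, as convergence in operator norm
    demands.\<close>
  have near: "\<exists>M. \<forall>n\<ge>M. \<forall>x\<in>Lp 2 G. l2_norm G (A n x - B x) \<le> e * l2_norm G x" if e: "e > 0" for e
  proof -
    obtain M where M: "\<forall>m\<ge>M. \<forall>n\<ge>M. op_dist G (A m) (A n) < e" using Cauchy e by blast
    have "l2_norm G (A n x - B x) \<le> e * l2_norm G x" if "n \<ge> M" and x: "x \<in> Lp 2 G" for n x
    proof (rule LIMSEQ_le_const[of "\<lambda>m. e * l2_norm G x + l2_norm G (A m x - B x)"])
      show "(\<lambda>m. e * l2_norm G x + l2_norm G (A m x - B x)) \<longlonglongrightarrow> e * l2_norm G x"
        using tendsto_add[OF tendsto_const B(2)[OF x]] by simp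
      have "l2_norm G (A n x - B x) \<le> e * l2_norm G x + l2_norm G (A m x - B x)" if "m \<ge> M" for m
      proof -
        have "l2_norm G (A n x - B x) \<le> l2_norm G (A n x - A m x) + l2_norm G (A m x - B x)"
          by (intro l2_norm_diff_triangle vN_closed[OF A] B x)
        moreover have "l2_norm G (A n x - A m x) \<le> op_dist G (A n) (A m) * l2_norm G x"
          by (rule op_dist_bound[OF A A x])
        moreover have "\<dots> \<le> e * l2_norm G x"
          using M that \<open>n \<ge> M\<close> by (intro mult_right_mono) (auto intro: less_imp_le)
        ultimately show ?thesis by linarith
      qed
      then show "\<exists>N. \<forall>m\<ge>N. l2_norm G (A n x - B x) \<le> e * l2_norm G x + l2_norm G (A m x - B x)"
        by blast
    qed
    then show ?thesis by blast
  qed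
  have BV: "B \<in> carrier (vN G)"
  proof -
    obtain n where n: "\<forall>x\<in>Lp 2 G. l2_norm G (A n x - B x) \<le> 1 * l2_norm G x"
      using near[of 1] by auto
    show ?thesis
    proof (rule vN_I[where K = "op_norm G (A n) + 1"])
      fix x assume x: "x \<in> Lp 2 G"
      have "l2_norm G (A n x - (A n x - B x)) \<le> l2_norm G (A n x) + l2_norm G (A n x - B x)"
        by (intro l2_norm_diff_le l2_diff vN_closed[OF A] B x)
      then show "l2_norm G (B x) \<le> (op_norm G (A n) + 1) * l2_norm G x"
        using op_norm_bound[OF A x, of n] n x by (force simp: distrib_right)
      show "B (x + y) = B x + B y" if y: "y \<in> Lp 2 G" for y
        by (rule ptI[OF l2_add(1)[OF x y]])
          (use tendsto_add[OF pt[OF x] pt[OF y]] in \<open>simp add: vN_add[OF A x y]\<close>)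
      show "B (c \<odot> x) = c \<odot> B x" for c
        by (rule ptI[OF l2_scale[OF x]])
          (use tendsto_mult[OF tendsto_const pt[OF x]] in \<open>simp add: vN_scale[OF A x]\<close>)
      show "B (left_translate G a x) = left_translate G a (B x)" if a: "a \<in> carrier G" for a
        by (rule ptI[OF left_translate_closed[OF a x]])
          (unfold vN_translate[OF A a x], use pt[OF x] in \<open>auto simp: left_translate_def\<close>)
    qed (use B in \<open>auto simp: B_def\<close>)
  qed
  moreover have "(\<lambda>n. op_dist G (A n) B) \<longlonglongrightarrow> 0"
  proof (rule LIMSEQ_I)
    fix e :: real assume e: "0 < e"
    then obtain M where M: "\<forall>n\<ge>M. \<forall>x\<in>Lp 2 G. l2_norm G (A n x - B x) \<le> e/2 * l2_norm G x"
      using near[of "e/2"] by auto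
    have "op_dist G (A n) B \<le> e/2" if "n \<ge> M" for n
      using M that e by (intro op_dist_leI) auto
    then show "\<exists>M. \<forall>n\<ge>M. norm (op_dist G (A n) B - 0) < e"
      using e op_dist_nonneg[OF A BV] by (intro exI[of _ M]) force
  qed
  ultimately show ?thesis by blast
qed

section \<open>The canonical trace, and limits of self-adjoint operators\<close>

lemma delta_closed:
  assumes "a \<in> carrier G"
  shows "delta a \<in> Lp 2 G" "l2_norm G (delta a) = 1"
proof -
  have "((\<lambda>g. (cmod (delta a g))\<^sup>2) has_sum 1) (carrier G)"
    by (rule has_sum_finite_neutralI[of "{a}"]) (use assms in \<open>auto simp: delta_def\<close>)
  then show "delta a \<in> Lp 2 G" "l2_norm G (delta a) = 1"
    using assms by (auto simp: Lp_def delta_def l2_norm_def infsumI has_sum_imp_summable)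
qed

lemma l2_inner_delta:
  assumes "a \<in> carrier G"
  shows "l2_inner G x (delta a) = x a"
proof -
  have "((\<lambda>g. x g * cnj (delta a g)) has_sum x a) (carrier G)"
    by (rule has_sum_finite_neutralI[of "{a}"]) (use assms in \<open>auto simp: delta_def\<close>)
  then show ?thesis by (simp add: l2_inner_def infsumI)
qed

lemma vN_trace_apply: "vN_trace G A = A (delta \<one>) \<one>"
  by (simp add: vN_trace_def l2_inner_delta)

text \<open>\<open>delta \<one>\<close> is a unit vector and the trace is one coordinate of its
  image, so the trace is 1-Lipschitz for the operator norm. This carries norm limits to
  traces.\<close>

lemma vN_trace_dist:
  assumes "A \<in> carrier (vN G)" "B \<in> carrier (vN G)"
  shows "cmod (vN_trace G A - vN_trace G B) \<le> op_dist G A B"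
  using op_dist_bound[OF assms delta_closed(1)[OF one_closed]]
    cmod_le_l2_norm[OF l2_diff[OF vN_closed[OF assms(1)] vN_closed[OF assms(2)]], of "delta \<one>" "delta \<one>" \<one>]
  by (simp add: vN_trace_apply delta_closed)

text \<open>Cauchy-Schwarz passes the identity to the limit on each side. The intended case is the
  square root of \<open>A\<^sup>*A\<close>, a norm limit of real polynomials in
  \<open>A\<^sup>*A\<close>.\<close>

lemma self_adjoint_limit:
  assumes A: "\<And>n. A n \<in> carrier (vN G)" and B: "B \<in> carrier (vN G)"
    and lim: "(\<lambda>n. op_dist G (A n) B) \<longlonglongrightarrow> 0" and sa: "\<And>n. self_adjoint G (A n)"
  shows "self_adjoint G B"
  unfolding self_adjoint_def
proof (intro ballI)
  fix x y assume x: "x \<in> Lp 2 G" and y: "y \<in> Lp 2 G"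
  have l: "(\<lambda>n. l2_norm G (A n z - B z)) \<longlonglongrightarrow> 0" if z: "z \<in> Lp 2 G" for z
  proof (rule tendsto_sandwich[of "\<lambda>_. 0"])
    show "(\<lambda>n. op_dist G (A n) B * l2_norm G z) \<longlonglongrightarrow> 0"
      using tendsto_mult[OF lim tendsto_const] by simp
  qed (use A B z in \<open>auto intro!: always_eventually op_dist_bound\<close>)
  have 1: "(\<lambda>n. l2_inner G (A n x) y) \<longlonglongrightarrow> l2_inner G (B x) y"
  proof (subst LIM_zero_iff[symmetric], rule Lim_null_comparison)
    show "(\<lambda>n. l2_norm G (A n x - B x) * l2_norm G y) \<longlonglongrightarrow> 0"
      using tendsto_mult[OF l[OF x] tendsto_const] by simp
    show "\<forall>\<^sub>F n in sequentially. cmod (l2_inner G (A n x) y - l2_inner G (B x) y) \<le>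
        l2_norm G (A n x - B x) * l2_norm G y"
      using l2_Cauchy_Schwarz[OF l2_diff[OF vN_closed[OF A x] vN_closed[OF B x]] y]
      by (intro always_eventually) (simp add: l2_inner_diff_left vN_closed[OF A x] vN_closed[OF B x] y)
  qed
  have 2: "(\<lambda>n. l2_inner G x (A n y)) \<longlonglongrightarrow> l2_inner G x (B y)"
  proof (subst LIM_zero_iff[symmetric], rule Lim_null_comparison)
    show "(\<lambda>n. l2_norm G x * l2_norm G (A n y - B y)) \<longlonglongrightarrow> 0"
      using tendsto_mult[OF tendsto_const l[OF y]] by simp
    show "\<forall>\<^sub>F n in sequentially. cmod (l2_inner G x (A n y) - l2_inner G x (B y)) \<le>
        l2_norm G x * l2_norm G (A n y - B y)"
      using l2_Cauchy_Schwarz[OF x l2_diff[OF vN_closed[OF A y] vN_closed[OF B y]]]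
      by (intro always_eventually) (simp add: l2_inner_diff_right vN_closed[OF A y] vN_closed[OF B y] x)
  qed
  have "l2_inner G (A n x) y = l2_inner G x (A n y)" for n
    using sa x y by (simp add: self_adjoint_def)
  then show "l2_inner G (B x) y = l2_inner G x (B y)" using 1 2 LIMSEQ_unique by simp
qed

end

section \<open>Spectra of self-adjoint operators\<close>

context group
begin

section \<open>Criteria for invertibility\<close>

lemma op_shift_closed: "A \<in> carrier (vN G) \<Longrightarrow> op_shift G A z \<in> carrier (vN G)"
  by (intro vN_intros)

lemma op_scalar_surj:
  assumes "c \<noteq> 0" "y \<in> Lp 2 G"
  shows "\<exists>x\<in>Lp 2 G. op_scale G c (op_id G) x = y"
  using assms by (intro bexI[of _ "inverse c \<odot> y"]) (simp_all add: l2_scale)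

lemma op_shift_apply: "x \<in> Lp 2 G \<Longrightarrow> op_shift G A z x = A x - z \<odot> x"
  by (simp add: cscale_minus_left)

text \<open>The lower bound serves twice: it makes \<open>A\<close> injective, so that every
  identity for the set-theoretic inverse is checked after applying \<open>A\<close>, and it bounds
  that inverse by \<open>inverse d\<close>.\<close>

lemma vN_UnitsI:
  assumes A: "A \<in> carrier (vN G)" and d: "d > 0"
    and lower: "\<And>x. x \<in> Lp 2 G \<Longrightarrow> d * l2_norm G x \<le> l2_norm G (A x)"
    and surj: "\<And>y. y \<in> Lp 2 G \<Longrightarrow> \<exists>x\<in>Lp 2 G. A x = y"
  shows "A \<in> Units (vN G)"
proof -
  obtain B0 where B0: "\<And>y. y \<in> Lp 2 G \<Longrightarrow> B0 y \<in> Lp 2 G" "\<And>y. y \<in> Lp 2 G \<Longrightarrow> A (B0 y) = y"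
    using surj by metis
  define B where "B = restrict B0 (Lp 2 G)"
  have B: "B y \<in> Lp 2 G" "A (B y) = y" if "y \<in> Lp 2 G" for y
    using B0 that by (simp_all add: B_def)
  have inj: "x = y" if x: "x \<in> Lp 2 G" and y: "y \<in> Lp 2 G" and eq: "A x = A y" for x y
  proof -
    have "d * l2_norm G (x - y) \<le> 0"
      using lower[OF l2_diff[OF x y]] eq by (simp add: vN_diff[OF A x y])
    then have "l2_norm G (x - y) = 0"
      using d l2_norm_nonneg[of G "x - y"] by (simp add: mult_le_0_iff)
    then show ?thesis using l2_norm_eq_0[OF l2_diff[OF x y]] by simp
  qed
  have BV: "B \<in> carrier (vN G)"
  proof (rule vN_I[where K = "inverse d"])
    fix x assume x: "x \<in> Lp 2 G"
    show "B (x + y) = B x + B y" if y: "y \<in> Lp 2 G" for y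
      by (rule inj) (simp_all add: B x y l2_add vN_add[OF A])
    show "B (c \<odot> x) = c \<odot> B x" for c
      by (rule inj) (simp_all add: B x l2_scale vN_scale[OF A])
    show "B (left_translate G a x) = left_translate G a (B x)" if a: "a \<in> carrier G" for a
      by (rule inj) (simp_all add: B x left_translate_closed a vN_translate[OF A a])
    show "l2_norm G (B x) \<le> inverse d * l2_norm G x"
      using lower[OF B(1)[OF x]] B(2)[OF x] d by (simp add: field_simps)
  qed (use B in \<open>auto simp: B_def\<close>)
  have "A \<otimes>\<^bsub>vN G\<^esub> B = \<one>\<^bsub>vN G\<^esub>"
    by (rule vN_eqI[where G = G]) (auto intro!: vN_mult_closed A BV simp: vN_one op_id_closed B)
  moreover have "B (A x) = x" if "x \<in> Lp 2 G" for x
    by (rule inj) (simp_all add: that B vN_closed[OF A])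
  then have "B \<otimes>\<^bsub>vN G\<^esub> A = \<one>\<^bsub>vN G\<^esub>"
    by (intro vN_eqI[where G = G]) (auto intro!: vN_mult_closed A BV simp: vN_one op_id_closed)
  ultimately show ?thesis using A BV by (auto simp: Units_def)
qed

lemma vN_UnitsD:
  assumes "A \<in> Units (vN G)"
  shows "\<exists>d>0. \<forall>x\<in>Lp 2 G. d * l2_norm G x \<le> l2_norm G (A x)"
    and "y \<in> Lp 2 G \<Longrightarrow> \<exists>x\<in>Lp 2 G. A x = y"
proof -
  obtain B where B: "B \<in> carrier (vN G)" "B \<otimes>\<^bsub>vN G\<^esub> A = op_id G" "A \<otimes>\<^bsub>vN G\<^esub> B = op_id G"
    and A: "A \<in> carrier (vN G)"
    using assms by (auto simp: Units_def vN_one)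
  have BA: "B (A x) = x" and AB: "A (B x) = x" if "x \<in> Lp 2 G" for x
    using that fun_cong[OF B(2), of x] fun_cong[OF B(3), of x] by simp_all
  obtain K where K: "K \<ge> 0" "\<forall>x\<in>Lp 2 G. l2_norm G (B x) \<le> K * l2_norm G x"
    using vN_bounded[OF B(1)] by blast
  \<comment> \<open>\<open>K + 1\<close> in place of \<open>K\<close> makes the constant positive
    even if \<open>K = 0\<close>.\<close>
  have "inverse (K + 1) * l2_norm G x \<le> l2_norm G (A x)" if x: "x \<in> Lp 2 G" for x
  proof -
    have "l2_norm G x \<le> K * l2_norm G (A x)" using K(2) vN_closed[OF A x] BA[OF x] by force
    also have "\<dots> \<le> (K + 1) * l2_norm G (A x)" by (intro mult_right_mono) auto
    finally show ?thesis using K(1) by (simp add: field_simps)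
  qed
  then show "\<exists>d>0. \<forall>x\<in>Lp 2 G. d * l2_norm G x \<le> l2_norm G (A x)"
    using K(1) by (intro exI[of _ "inverse (K + 1)"]) auto
  show "\<exists>x\<in>Lp 2 G. A x = y" if "y \<in> Lp 2 G"
    using AB[OF that] vN_closed[OF B(1) that] by blast
qed

text \<open>\<open>(U + T) x = y\<close> holds at every solution of the fixed point equation
  \<open>x = R (y - T x)\<close>, where \<open>R\<close> is a right inverse of \<open>U\<close>. The
  lower bound on \<open>U\<close> makes its right-hand side a contraction with factor
  \<open>c / d\<close>.\<close>

lemma Units_perturb:
  assumes U: "U \<in> carrier (vN G)" and T: "T \<in> carrier (vN G)" and c: "0 \<le> c" "c < d"
    and lower: "\<And>x. x \<in> Lp 2 G \<Longrightarrow> d * l2_norm G x \<le> l2_norm G (U x)"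
    and surj: "\<And>y. y \<in> Lp 2 G \<Longrightarrow> \<exists>x\<in>Lp 2 G. U x = y"
    and small: "\<And>x. x \<in> Lp 2 G \<Longrightarrow> l2_norm G (T x) \<le> c * l2_norm G x"
  shows "op_add G U T \<in> Units (vN G)"
proof (rule vN_UnitsI)
  show "op_add G U T \<in> carrier (vN G)" by (intro vN_intros U T)
  show "0 < d - c" using c by simp
  fix y assume y: "y \<in> Lp 2 G"
  have "l2_norm G ((U y + T y) - T y) \<le> l2_norm G (U y + T y) + l2_norm G (T y)"
    by (intro l2_norm_diff_le l2_add(1) vN_closed[OF U] vN_closed[OF T] y)
  then show "(d - c) * l2_norm G y \<le> l2_norm G (op_add G U T y)"
    using lower[OF y] small[OF y] y by (simp add: left_diff_distrib)
  obtain R where R: "\<And>z. z \<in> Lp 2 G \<Longrightarrow> R z \<in> Lp 2 G" "\<And>z. z \<in> Lp 2 G \<Longrightarrow> U (R z) = z"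
    using surj by metis
  define f where "f x = R (y - T x)" for x
  interpret Metric_space "Lp 2 G" "\<lambda>x y. l2_norm G (x - y)" by (rule Metric_space_l2)
  have Ty: "y - T x \<in> Lp 2 G" if "x \<in> Lp 2 G" for x
    using that by (intro l2_diff y vN_closed[OF T])
  have contract: "l2_norm G (f u - f v) \<le> c / d * l2_norm G (u - v)"
    if u: "u \<in> Lp 2 G" and v: "v \<in> Lp 2 G" for u v
  proof -
    have "d * l2_norm G (f u - f v) \<le> l2_norm G (U (f u - f v))"
      unfolding f_def by (intro lower l2_diff R Ty u v)
    also have "U (f u - f v) = T v - T u"
      unfolding f_def by (simp add: vN_diff[OF U] R Ty u v)
    also have "l2_norm G (T v - T u) = l2_norm G (T (u - v))"
      by (simp add: vN_diff[OF T] u v l2_norm_diff_commute[of G "T v"])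
    also have "\<dots> \<le> c * l2_norm G (u - v)" by (intro small l2_diff u v)
    finally have "l2_norm G (f u - f v) * d \<le> c * l2_norm G (u - v)" by (simp only: mult.commute)
    then show ?thesis using c unfolding times_divide_eq_left by (intro mult_imp_le_div_pos) auto
  qed
  obtain x where x: "x \<in> Lp 2 G" "f x = x"
  proof (rule Banach_fixedpoint_thm[OF mcomplete_l2, of f "c / d"])
    show "Lp 2 G \<noteq> {}" using y by blast
    show "f \<in> Lp 2 G \<rightarrow> Lp 2 G" by (auto simp: f_def intro!: R Ty)
    show "c / d < 1" using c by simp
  qed (use contract in auto)
  have "U x = y - T x" using R(2)[OF Ty[OF x(1)]] x(2) by (simp add: f_def)
  then show "\<exists>x\<in>Lp 2 G. op_add G U T x = y" using x by (intro bexI[of _ x]) auto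
qed

text \<open>Far out on the ray the shift dominates \<open>H\<close>; from there a single perturbation step reaches
  every point of the open ray, since the lower bound at distance \<open>N\<close> is \<open>N\<close>.\<close>

lemma op_shift_ray_Units:
  assumes H: "H \<in> carrier (vN G)" and u: "cmod u = 1" and t: "t > 0"
    and lower: "\<And>t x. t > 0 \<Longrightarrow> x \<in> Lp 2 G \<Longrightarrow>
      t * l2_norm G x \<le> l2_norm G (op_shift G H (s + of_real t * u) x)"
  shows "op_shift G H (s + of_real t * u) \<in> Units (vN G)"
proof -
  obtain K where K: "K \<ge> 0" "\<forall>x\<in>Lp 2 G. l2_norm G (op_shift G H s x) \<le> K * l2_norm G x"
    using vN_bounded[OF op_shift_closed[OF H]] by blast
  define N where "N = K + t + 1"
  have N: "K < N" "t < N" "N > 0" using K t by (auto simp: N_def)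
  have u0: "u \<noteq> 0" using u by auto
  let ?U = "op_scale G (- (of_real N * u)) (op_id G)"
  have "op_add G ?U (op_shift G H s) \<in> Units (vN G)"
  proof (rule Units_perturb[OF _ op_shift_closed[OF H] K(1) N(1)])
    show "?U \<in> carrier (vN G)" by (intro vN_intros)
    show "N * l2_norm G x \<le> l2_norm G (?U x)" if "x \<in> Lp 2 G" for x
      using that N u by (simp add: l2_norm_scale norm_mult)
    show "\<exists>x\<in>Lp 2 G. ?U x = y" if "y \<in> Lp 2 G" for y
      using N u0 by (intro op_scalar_surj that) auto
  qed (use K in auto)
  also have "op_add G ?U (op_shift G H s) = op_shift G H (s + of_real N * u)"
    by (rule vN_eqI[where G = G])
      (auto intro!: vN_intros H simp: fun_eq_iff algebra_simps)
  finally have far: "op_shift G H (s + of_real N * u) \<in> Units (vN G)" .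
  have "op_add G (op_shift G H (s + of_real N * u)) (op_scale G (of_real (N - t) * u) (op_id G))
      \<in> Units (vN G)"
  proof (rule Units_perturb[where c = "N - t" and d = N])
    show "N * l2_norm G x \<le> l2_norm G (op_shift G H (s + of_real N * u) x)" if "x \<in> Lp 2 G" for x
      by (rule lower[OF N(3) that])
    show "\<exists>x\<in>Lp 2 G. op_shift G H (s + of_real N * u) x = y" if "y \<in> Lp 2 G" for y
      by (rule vN_UnitsD(2)[OF far that])
    show "l2_norm G (op_scale G (of_real (N - t) * u) (op_id G) x) \<le> (N - t) * l2_norm G x"
      if "x \<in> Lp 2 G" for x
    proof -
      have "cmod (of_real (N - t) * u) = N - t" using N(2) u by (simp only: norm_mult norm_of_real) simp
      then show ?thesis using that by (simp add: l2_norm_scale del: of_real_diff)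
    qed
  qed (use N t in \<open>auto intro!: vN_intros H\<close>)
  also have "op_add G (op_shift G H (s + of_real N * u)) (op_scale G (of_real (N - t) * u) (op_id G))
      = op_shift G H (s + of_real t * u)"
    by (rule vN_eqI[where G = G])
      (auto intro!: vN_intros H simp: fun_eq_iff algebra_simps)
  finally show ?thesis .
qed

text \<open>Cauchy-Schwarz turns distance from the numerical range of \<open>H\<close> into the
  lower bound of \<open>op_shift_ray_Units\<close>. The hypothesis covers the whole open ray because
  the argument there starts far out.\<close>

lemma op_shift_ray_Units_inner:
  assumes H: "H \<in> carrier (vN G)" and u: "cmod u = 1" and t: "t > 0"
    and lower: "\<And>t x. t > 0 \<Longrightarrow> x \<in> Lp 2 G \<Longrightarrow>
      t * (l2_norm G x)\<^sup>2 \<le> cmod (l2_inner G (H x) x - (s + of_real t * u) * of_real ((l2_norm G x)\<^sup>2))"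
  shows "op_shift G H (s + of_real t * u) \<in> Units (vN G)"
proof (rule op_shift_ray_Units[OF H u t])
  fix t :: real and x assume t: "t > 0" and x: "x \<in> Lp 2 G"
  let ?z = "s + of_real t * u"
  have cl: "op_shift G H ?z x \<in> Lp 2 G" by (rule vN_closed[OF op_shift_closed[OF H] x])
  have "t * (l2_norm G x)\<^sup>2 \<le> cmod (l2_inner G (op_shift G H ?z x) x)"
    unfolding op_shift_apply[OF x] using lower[OF t x] x
    by (simp add: l2_inner_diff_left l2_inner_scale_left vN_closed[OF H] l2_scale l2_inner_self)
  also have "\<dots> \<le> l2_norm G (op_shift G H ?z x) * l2_norm G x"
    by (rule l2_Cauchy_Schwarz[OF cl x])
  finally have "(t * l2_norm G x) * l2_norm G x \<le> l2_norm G (op_shift G H ?z x) * l2_norm G x"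
    by (simp add: power2_eq_square mult.assoc)
  then show "t * l2_norm G x \<le> l2_norm G (op_shift G H ?z x)"
    by (cases "l2_norm G x = 0") (use l2_norm_nonneg[of G x] in auto)
qed

section \<open>Where the spectrum lies\<close>

lemma self_adjoint_inner_real:
  assumes "self_adjoint G H" "x \<in> Lp 2 G"
  shows "Im (l2_inner G (H x) x) = 0"
proof -
  have "l2_inner G (H x) x = cnj (l2_inner G (H x) x)"
    using assms l2_inner_commute[of G x "H x"] by (simp add: self_adjoint_def)
  then have "Im (l2_inner G (H x) x) = - Im (l2_inner G (H x) x)" by (metis cnj.sel(2))
  then show ?thesis by simp
qed

text \<open>A non-real \<open>z\<close> lies on the vertical ray from \<open>Re z\<close>. The
  quadratic form of \<open>H\<close> is real, so on this ray the imaginary part alone provides the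
  required distance \<open>t\<close>.\<close>

lemma spectrum_self_adjoint_real:
  assumes H: "H \<in> carrier (vN G)" and sa: "self_adjoint G H" and z: "z \<in> spectrum G H"
  shows "Im z = 0"
proof (rule ccontr)
  assume nz: "Im z \<noteq> 0"
  let ?u = "of_real (sgn (Im z)) * \<i>" and ?s = "complex_of_real (Re z)" and ?t = "\<bar>Im z\<bar>"
  have z_eq: "?s + of_real ?t * ?u = z" using nz by (auto simp: complex_eq_iff abs_sgn_eq sgn_if)
  have "op_shift G H (?s + of_real ?t * ?u) \<in> Units (vN G)"
  proof (rule op_shift_ray_Units_inner[OF H])
    fix t :: real and x assume t: "t > 0" and x: "x \<in> Lp 2 G"
    let ?w = "l2_inner G (H x) x - (?s + of_real t * ?u) * of_real ((l2_norm G x)\<^sup>2)"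
    have "t * (l2_norm G x)\<^sup>2 = \<bar>Im ?w\<bar>"
      using t nz self_adjoint_inner_real[OF sa x] by (auto simp: abs_mult sgn_if simp flip: of_real_power)
    also have "\<dots> \<le> cmod ?w" by (rule abs_Im_le_cmod)
    finally show "t * (l2_norm G x)\<^sup>2 \<le> cmod ?w" .
  qed (use nz in \<open>auto simp: norm_mult sgn_if\<close>)
  then show False using z z_eq by (simp add: spectrum_def)
qed

text \<open>A point \<open>r < m\<close> lies on the leftward ray from \<open>m\<close>, at
  parameter \<open>m - r\<close>. On unit vectors the real part of the form keeps distance
  \<open>t\<close> from \<open>m - t\<close>.\<close>

lemma spectrum_self_adjoint_ge:
  assumes H: "H \<in> carrier (vN G)" and sa: "self_adjoint G H" and z: "complex_of_real r \<in> spectrum G H"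
    and lower: "\<And>x. x \<in> Lp 2 G \<Longrightarrow> m * (l2_norm G x)\<^sup>2 \<le> Re (l2_inner G (H x) x)"
  shows "m \<le> r"
proof (rule ccontr)
  assume "\<not> m \<le> r"
  have "op_shift G H (of_real m + of_real (m - r) * (-1)) \<in> Units (vN G)"
  proof (rule op_shift_ray_Units_inner[OF H])
    fix t :: real and x assume t: "t > 0" and x: "x \<in> Lp 2 G"
    let ?w = "l2_inner G (H x) x - (of_real m + of_real t * (-1)) * of_real ((l2_norm G x)\<^sup>2)"
    have "t * (l2_norm G x)\<^sup>2 \<le> Re ?w"
      using lower[OF x] by (simp add: algebra_simps flip: of_real_power)
    also have "\<dots> \<le> cmod ?w" by (rule complex_Re_le_cmod)
    finally show "t * (l2_norm G x)\<^sup>2 \<le> cmod ?w" .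
  qed (use \<open>\<not> m \<le> r\<close> in auto)
  moreover have "complex_of_real m + of_real (m - r) * (-1) = of_real r" by simp
  ultimately show False using z by (simp add: spectrum_def)
qed

text \<open>\<open>H - z = (w - z) + (H - w)\<close> perturbs an invertible scalar as soon as
  \<open>|z - w| > r\<close>. With \<open>w = 0\<close> this bounds the spectrum by the norm; with
  the midpoint of an interval as \<open>w\<close> it yields both ends at once.\<close>

lemma spectrum_norm_le:
  assumes H: "H \<in> carrier (vN G)" and z: "z \<in> spectrum G H" and r: "0 \<le> r"
    and near: "\<And>x. x \<in> Lp 2 G \<Longrightarrow> l2_norm G (H x - w \<odot> x) \<le> r * l2_norm G x"
  shows "cmod (z - w) \<le> r"
proof (rule ccontr)
  assume far: "\<not> cmod (z - w) \<le> r"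
  then have nz: "z - w \<noteq> 0" using r by auto
  let ?U = "op_scale G (w - z) (op_id G)"
  have "op_add G ?U (op_shift G H w) \<in> Units (vN G)"
  proof (rule Units_perturb[OF _ op_shift_closed[OF H] r])
    show "?U \<in> carrier (vN G)" by (intro vN_intros)
    show "r < cmod (z - w)" using far by simp
    show "cmod (z - w) * l2_norm G x \<le> l2_norm G (?U x)" if "x \<in> Lp 2 G" for x
      using that by (simp add: l2_norm_scale norm_minus_commute)
    show "\<exists>x\<in>Lp 2 G. ?U x = y" if "y \<in> Lp 2 G" for y
      using nz by (intro op_scalar_surj that) auto
  qed (use near in \<open>simp add: op_shift_apply del: op_add_apply\<close>)
  also have "op_add G ?U (op_shift G H w) = op_shift G H z"
    by (rule vN_eqI[where G = G]) (auto intro!: vN_intros H simp: fun_eq_iff algebra_simps)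
  finally show False using z by (simp add: spectrum_def)
qed

end

section \<open>Polynomials in an operator\<close>

lemmas fun_apply = plus_fun_apply zero_fun_apply minus_apply uminus_apply cscale_apply

text \<open>As simp rules these rewrite equations between functions to pointwise form, where linearity of
  operators no longer applies.\<close>

declare fun_apply [simp del]

lemma sum_fun_apply: "(sum f I) g = (\<Sum>i\<in>I. f i g)" for f :: "'i \<Rightarrow> 'a \<Rightarrow> 'b::comm_monoid_add"
  by (induction I rule: infinite_finite_induct) (auto simp: fun_apply)

text \<open>\<open>op_poly\<close> with complex coefficients, since splitting off linear factors
  needs complex roots. The sum is one of functions, to which linearity of \<open>A\<close>
  applies.\<close>

definition op_cpoly :: "('a, 'b) monoid_scheme \<Rightarrow> complex poly \<Rightarrow> 'a l2_op \<Rightarrow> 'a l2_op" where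
  "op_cpoly G p A = (\<lambda>x\<in>Lp 2 G. \<Sum>i\<le>degree p. coeff p i \<odot> (A ^^ i) x)"

abbreviation cpoly :: "real poly \<Rightarrow> complex poly" where
  "cpoly \<equiv> map_poly of_real"

lemma cpoly_add: "cpoly (p + q) = cpoly p + cpoly q"
  and cpoly_diff: "cpoly (p - q) = cpoly p - cpoly q"
  and cpoly_mult: "cpoly (p * q) = cpoly p * cpoly q"
  and cpoly_smult: "cpoly (smult c p) = smult (of_real c) (cpoly p)"
  by (simp_all add: poly_eq_iff coeff_map_poly coeff_mult)

lemma poly_cpoly: "poly (cpoly p) (of_real t) = of_real (poly p t)"
  by (induction p) (auto simp: map_poly_pCons)

lemma op_poly_conv: "op_poly G p A = op_cpoly G (cpoly p) A"
  by (auto simp: op_poly_def op_cpoly_def fun_eq_iff restrict_def sum_fun_apply degree_map_poly coeff_map_poly fun_apply)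

lemma op_cpoly_sum:
  assumes "x \<in> Lp 2 G" "degree p \<le> n"
  shows "op_cpoly G p A x = (\<Sum>i\<le>n. coeff p i \<odot> (A ^^ i) x)"
  unfolding op_cpoly_def restrict_apply using assms
  by (simp, intro sum.mono_neutral_left) (auto simp: coeff_eq_0)

lemma op_cpoly_0 [simp]: "x \<in> Lp 2 G \<Longrightarrow> op_cpoly G 0 A x = 0"
  by (simp add: op_cpoly_def)

context group
begin

lemma vN_sum:
  assumes A: "A \<in> carrier (vN G)" and "\<And>i. i \<in> I \<Longrightarrow> u i \<in> Lp 2 G"
  shows "(\<Sum>i\<in>I. u i) \<in> Lp 2 G \<and> A (\<Sum>i\<in>I. u i) = (\<Sum>i\<in>I. A (u i))"
  using assms(2)
  by (induction I rule: infinite_finite_induct) (auto simp: vN_zero[OF A] vN_add[OF A] l2_add(1))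

lemma funpow_closed: "A \<in> carrier (vN G) \<Longrightarrow> x \<in> Lp 2 G \<Longrightarrow> (A ^^ i) x \<in> Lp 2 G"
  by (induction i) (auto intro: vN_closed[of A G])

text \<open>Horner's step, which turns the algebraic rules below into inductions over
  \<open>pCons\<close>.\<close>

lemma op_cpoly_pCons:
  assumes A: "A \<in> carrier (vN G)" and x: "x \<in> Lp 2 G"
  shows "op_cpoly G (pCons a p) A x = a \<odot> x + A (op_cpoly G p A x)"
proof -
  have "op_cpoly G (pCons a p) A x = (\<Sum>i\<le>Suc (degree p). coeff (pCons a p) i \<odot> (A ^^ i) x)"
    by (rule op_cpoly_sum[OF x degree_pCons_le])
  also have "\<dots> = a \<odot> x + (\<Sum>i\<le>degree p. coeff p i \<odot> A ((A ^^ i) x))"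
    by (simp only: sum.atMost_Suc_shift) simp
  also have "(\<Sum>i\<le>degree p. coeff p i \<odot> A ((A ^^ i) x)) = (\<Sum>i\<le>degree p. A (coeff p i \<odot> (A ^^ i) x))"
    by (simp add: vN_scale[OF A funpow_closed[OF A x]])
  also have "\<dots> = A (op_cpoly G p A x)"
    using vN_sum[OF A, of "{..degree p}" "\<lambda>i. coeff p i \<odot> (A ^^ i) x"] funpow_closed[OF A x] x
    by (simp add: op_cpoly_def l2_scale)
  finally show ?thesis .
qed

lemma op_cpoly_closed:
  assumes A: "A \<in> carrier (vN G)"
  shows "op_cpoly G p A \<in> carrier (vN G)"
proof (induction p)
  case 0
  have "op_cpoly G 0 A = op_scale G 0 (op_id G)"
    by (auto simp: op_cpoly_def op_scale_def restrict_def fun_eq_iff fun_apply)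
  then show ?case by (simp add: vN_intros)
next
  case (pCons a p)
  have "op_cpoly G (pCons a p) A = op_add G (op_scale G a (op_id G)) (A \<otimes>\<^bsub>vN G\<^esub> op_cpoly G p A)"
  proof (rule extensionalityI[of _ "Lp 2 G"])
    show "op_cpoly G (pCons a p) A x = op_add G (op_scale G a (op_id G)) (A \<otimes>\<^bsub>vN G\<^esub> op_cpoly G p A) x"
      if "x \<in> Lp 2 G" for x
      using that by (simp add: op_cpoly_pCons[OF A])
  qed (auto simp: op_cpoly_def op_add_def)
  then show ?case using pCons by (simp add: vN_intros A)
qed

context
  fixes A :: "'a l2_op"
  assumes A: "A \<in> carrier (vN G)"
begin

lemma op_cpoly_apply_closed: "x \<in> Lp 2 G \<Longrightarrow> op_cpoly G p A x \<in> Lp 2 G"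
  by (rule vN_closed[OF op_cpoly_closed[OF A]])

lemma op_cpoly_add:
  assumes "x \<in> Lp 2 G"
  shows "op_cpoly G (p + q) A x = op_cpoly G p A x + op_cpoly G q A x"
  by (induction p q rule: poly_induct2)
    (simp_all add: assms op_cpoly_pCons[OF A] vN_add[OF A] op_cpoly_apply_closed cscale_add_left)

lemma op_cpoly_smult:
  assumes "x \<in> Lp 2 G"
  shows "op_cpoly G (smult c p) A x = c \<odot> op_cpoly G p A x"
  by (induction p)
    (simp_all add: assms op_cpoly_pCons[OF A] vN_scale[OF A] op_cpoly_apply_closed cscale_add_right)

lemma op_cpoly_diff:
  assumes "x \<in> Lp 2 G"
  shows "op_cpoly G (p - q) A x = op_cpoly G p A x - op_cpoly G q A x"
  using op_cpoly_add[OF assms, of p "smult (-1) q"] op_cpoly_smult[OF assms, of "-1" q]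
  by (simp add: cscale_minus_one)

lemma op_cpoly_commute:
  assumes "x \<in> Lp 2 G"
  shows "op_cpoly G p A (A x) = A (op_cpoly G p A x)"
  by (induction p)
    (simp_all add: assms op_cpoly_pCons[OF A] vN_zero[OF A] vN_scale[OF A] vN_add[OF A] vN_closed[OF A]
      op_cpoly_apply_closed l2_scale)

lemma op_cpoly_mult:
  assumes "x \<in> Lp 2 G"
  shows "op_cpoly G (p * q) A x = op_cpoly G p A (op_cpoly G q A x)"
  by (induction p)
    (simp_all add: assms mult_pCons_left op_cpoly_add op_cpoly_smult op_cpoly_pCons[OF A]
      op_cpoly_apply_closed)

lemma op_cpoly_const: "x \<in> Lp 2 G \<Longrightarrow> op_cpoly G [:c:] A x = c \<odot> x"
  by (simp add: op_cpoly_pCons[OF A] vN_zero[OF A])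

lemma op_cpoly_X: "x \<in> Lp 2 G \<Longrightarrow> op_cpoly G [:0, 1:] A x = A x"
  by (simp add: op_cpoly_pCons[OF A] vN_zero[OF A])

text \<open>Needed with the square as inner polynomial, to rewrite polynomials in
  \<open>|A|\<^sup>2\<close> as polynomials in \<open>A\<^sup>*A\<close>.\<close>

lemma op_cpoly_pcompose:
  assumes "x \<in> Lp 2 G"
  shows "op_cpoly G (pcompose p q) A x = op_cpoly G p (op_cpoly G q A) x"
  by (induction p)
    (simp_all add: assms pcompose_pCons op_cpoly_add op_cpoly_mult op_cpoly_const
      op_cpoly_pCons[OF op_cpoly_closed[OF A]])

lemma op_poly_closed: "op_poly G p A \<in> carrier (vN G)"
  unfolding op_poly_conv by (rule op_cpoly_closed[OF A])

text \<open>Scalars leave the second argument of the inner product conjugated, so this rests on the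
  coefficients being real.\<close>

lemma self_adjoint_op_poly:
  assumes sa: "self_adjoint G A"
  shows "self_adjoint G (op_poly G p A)"
  unfolding op_poly_conv self_adjoint_def
proof (intro ballI)
  fix x y assume x: "x \<in> Lp 2 G" and y: "y \<in> Lp 2 G"
  \<comment> \<open>\<open>y\<close> is generalized because the induction step moves
    \<open>A\<close> across and uses the hypothesis at \<open>A y\<close>.\<close>
  have "\<forall>y\<in>Lp 2 G. l2_inner G (op_cpoly G (cpoly p) A x) y = l2_inner G x (op_cpoly G (cpoly p) A y)"
  proof (induction p)
    case 0
    then show ?case using x by (simp add: l2_inner_def fun_apply)
  next
    case (pCons a p)
    show ?case
    proof
      fix y assume y: "y \<in> Lp 2 G"
      let ?p = "op_cpoly G (cpoly p) A"
      have "l2_inner G (op_cpoly G (cpoly (pCons a p)) A x) y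
          = of_real a * l2_inner G x y + l2_inner G (A (?p x)) y"
        using x y by (simp add: map_poly_pCons op_cpoly_pCons[OF A] l2_inner_add_left l2_scale
            vN_closed[OF A] op_cpoly_apply_closed l2_inner_scale_left)
      also have "l2_inner G (A (?p x)) y = l2_inner G (?p x) (A y)"
        using sa x y by (simp add: self_adjoint_def op_cpoly_apply_closed)
      also have "\<dots> = l2_inner G x (?p (A y))" using pCons.IH y vN_closed[OF A] by blast
      also have "?p (A y) = A (?p y)" by (rule op_cpoly_commute[OF y])
      also have "of_real a * l2_inner G x y + l2_inner G x (A (?p y))
          = l2_inner G x (op_cpoly G (cpoly (pCons a p)) A y)"
        using x y by (simp add: map_poly_pCons op_cpoly_pCons[OF A] l2_inner_add_right l2_scale
            vN_closed[OF A] op_cpoly_apply_closed l2_inner_scale_right)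
      finally show "l2_inner G (op_cpoly G (cpoly (pCons a p)) A x) y
          = l2_inner G x (op_cpoly G (cpoly (pCons a p)) A y)" .
    qed
  qed
  then show "l2_inner G (op_cpoly G (cpoly p) A x) y = l2_inner G x (op_cpoly G (cpoly p) A y)"
    using y by blast
qed

text \<open>Over the complex numbers \<open>q(A)\<close> is a nonzero constant times a product of
  shifts \<open>A - z\<close> over the roots \<open>z\<close> of \<open>q\<close>. If every root
  avoided the spectrum, all factors would be units. The induction splits off one root at a
  time.\<close>

lemma op_cpoly_not_Units:
  assumes "q \<noteq> 0" "op_cpoly G q A \<notin> Units (vN G)"
  shows "\<exists>z\<in>spectrum G A. poly q z = 0"
  using assms
proof (induction "degree q" arbitrary: q rule: less_induct)
  case less
  show ?case
  proof (cases "degree q = 0")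
    case True
    then obtain c where c: "q = [:c:]" "c \<noteq> 0" using less.prems(1) by (auto elim: degree_eq_zeroE)
    have "op_cpoly G q A \<in> Units (vN G)"
    proof (rule vN_UnitsI[OF op_cpoly_closed[OF A]])
      show "cmod c > 0" using c by simp
      show "\<exists>x\<in>Lp 2 G. op_cpoly G q A x = y" if "y \<in> Lp 2 G" for y
        using that c by (intro bexI[of _ "inverse c \<odot> y"]) (simp_all add: l2_scale op_cpoly_const)
    qed (use c in \<open>simp add: op_cpoly_const l2_norm_scale\<close>)
    then show ?thesis using less.prems(2) by blast
  next
    case False
    then obtain z where z: "poly q z = 0"
      using fundamental_theorem_of_algebra[of q] by (auto simp: constant_degree)
    then obtain r where r: "q = [:- z, 1:] * r" by (metis poly_eq_0_iff_dvd dvdE)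
    have r0: "r \<noteq> 0" using less.prems(1) r by auto
    have deg: "degree r < degree q" using r0 unfolding r by (subst degree_mult_eq) auto
    show ?thesis
    proof (cases "z \<in> spectrum G A")
      case True
      then show ?thesis using z by blast
    next
      case False
      interpret vN: monoid "vN G" by (rule monoid_vN)
      have "op_cpoly G [:- z, 1:] A x = op_shift G A z x" if "x \<in> Lp 2 G" for x
        using that by (simp add: op_cpoly_pCons[OF A] vN_zero[OF A] add.commute)
      then have "op_cpoly G q A = op_shift G A z \<otimes>\<^bsub>vN G\<^esub> op_cpoly G r A"
        unfolding r by (intro vN_eqI[where G = G] op_cpoly_closed vN_mult_closed op_shift_closed A)
          (simp add: op_cpoly_mult op_cpoly_apply_closed del: mult_pCons_left op_add_apply)
      moreover have "op_shift G A z \<in> Units (vN G)" using False by (simp add: spectrum_def)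
      ultimately have "op_cpoly G r A \<notin> Units (vN G)" using less.prems(2) by auto
      then show ?thesis using less.hyps[OF deg r0] unfolding r by auto
    qed
  qed
qed

end

text \<open>For a self-adjoint \<open>K\<close> of norm \<open>c\<close>, almost maximizing unit vectors are approximate
  eigenvectors of \<open>K\<^sup>2\<close> for \<open>c\<^sup>2\<close>, because
  \<open>\<parallel>(K\<^sup>2 - c\<^sup>2) x\<parallel>\<^sup>2 \<le> c\<^sup>4 - c\<^sup>2 \<parallel>K x\<parallel>\<^sup>2\<close>.\<close>

lemma op_norm_square_not_Units:
  assumes K: "K \<in> carrier (vN G)" and sa: "self_adjoint G K" and c: "c = op_norm G K" "c > 0"
    and W: "W \<in> Units (vN G)" "\<And>x. x \<in> Lp 2 G \<Longrightarrow> W x = K (K x) - of_real (c\<^sup>2) \<odot> x"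
  shows False
proof -
  obtain d where d: "d > 0" "\<forall>x\<in>Lp 2 G. d * l2_norm G x \<le> l2_norm G (W x)"
    using vN_UnitsD(1)[OF W(1)] by blast
  have key: "(c * l2_norm G (K x))\<^sup>2 \<le> (c^4 - d\<^sup>2) * (l2_norm G x)\<^sup>2" if x: "x \<in> Lp 2 G" for x
  proof -
    have Kx: "K x \<in> Lp 2 G" and KKx: "K (K x) \<in> Lp 2 G" by (intro vN_closed[OF K] x)+
    have cx: "of_real (c\<^sup>2) \<odot> x \<in> Lp 2 G" by (rule l2_scale[OF x])
    have "complex_of_real ((l2_norm G (W x))\<^sup>2) = l2_inner G (W x) (W x)"
      using W x KKx cx by (simp add: l2_inner_self l2_diff)
    also have "l2_inner G (W x) (W x) = of_real ((l2_norm G (K (K x)))\<^sup>2) - of_real (2 * c\<^sup>2 * (l2_norm G (K x))\<^sup>2)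
        + of_real (c^4 * (l2_norm G x)\<^sup>2)"
    proof -
      have "l2_inner G (K (K x)) x = l2_inner G (K x) (K x)" "l2_inner G x (K (K x)) = l2_inner G (K x) (K x)"
        using sa Kx x by (simp_all add: self_adjoint_def)
      moreover have "l2_inner G (W x) (W x) = l2_inner G (K (K x)) (K (K x)) - of_real (c\<^sup>2) * l2_inner G x (K (K x))
          - (of_real (c\<^sup>2) * l2_inner G (K (K x)) x - of_real (c\<^sup>2) * of_real (c\<^sup>2) * l2_inner G x x)"
        unfolding W(2)[OF x] using x KKx cx
        by (simp add: l2_diff l2_inner_diff_left l2_inner_diff_right l2_inner_scale_left
            l2_inner_scale_right algebra_simps)
      ultimately show ?thesis
        by (simp add: l2_inner_self x Kx KKx algebra_simps power4_eq_xxxx power2_eq_square)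
    qed
    finally have "(l2_norm G (W x))\<^sup>2
        = (l2_norm G (K (K x)))\<^sup>2 - 2 * c\<^sup>2 * (l2_norm G (K x))\<^sup>2 + c^4 * (l2_norm G x)\<^sup>2"
      by (simp only: of_real_add[symmetric] of_real_diff[symmetric] of_real_eq_iff)
    moreover have "(d * l2_norm G x)\<^sup>2 \<le> (l2_norm G (W x))\<^sup>2"
      using d x by (intro power_mono) auto
    moreover have "(l2_norm G (K (K x)))\<^sup>2 \<le> (c * l2_norm G (K x))\<^sup>2"
      using op_norm_bound[OF K Kx] c by (intro power_mono) auto
    ultimately show ?thesis by (simp add: power_mult_distrib left_diff_distrib)
  qed
  \<comment> \<open>\<open>key\<close> bounds \<open>\<parallel>K x\<parallel>\<close> by
    \<open>b \<parallel>x\<parallel>\<close>, and \<open>b < c\<close> contradicts the choice of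
    \<open>c\<close> as the norm. \<open>max 0\<close> covers the case
    \<open>c^4 < d\<^sup>2\<close>.\<close>
  define b where "b = sqrt (max 0 (c^4 - d\<^sup>2)) / c"
  have "op_norm G K \<le> b"
  proof (rule op_norm_leI)
    show "0 \<le> b" using c by (simp add: b_def)
    fix x assume x: "x \<in> Lp 2 G"
    have "(c * l2_norm G (K x))\<^sup>2 \<le> max 0 (c^4 - d\<^sup>2) * (l2_norm G x)\<^sup>2"
      using key[OF x] by (rule order_trans) (intro mult_right_mono, auto)
    then have "c * l2_norm G (K x) \<le> sqrt (max 0 (c^4 - d\<^sup>2) * (l2_norm G x)\<^sup>2)"
      by (rule real_le_rsqrt)
    then have "c * l2_norm G (K x) \<le> sqrt (max 0 (c^4 - d\<^sup>2)) * l2_norm G x"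
      by (simp add: real_sqrt_mult)
    then show "l2_norm G (K x) \<le> b * l2_norm G x" using c by (simp add: b_def field_simps)
  qed
  moreover have "b < c"
  proof -
    have "sqrt (max 0 (c^4 - d\<^sup>2)) < sqrt (c^4)" using c d by (intro real_sqrt_less_mono) auto
    also have "sqrt (c^4) = c\<^sup>2" using c by (simp add: real_sqrt_unique power2_eq_square power4_eq_xxxx)
    finally show ?thesis using c by (simp add: b_def power2_eq_square field_simps)
  qed
  ultimately show False using c by simp
qed

text \<open>For \<open>c = \<parallel>H\<parallel> > 0\<close> the operator
  \<open>H\<^sup>2 - c\<^sup>2\<close> is not a unit, so \<open>c\<close> or \<open>-c\<close> is a
  spectral point. If the norm is zero, invertibility of \<open>H\<close> would contradict
  \<open>H (delta \<one>) = 0\<close>. Constant polynomials, and later the ordering of the interval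
  ends, depend on having a spectral point.\<close>

lemma spectrum_nonempty:
  assumes H: "H \<in> carrier (vN G)" and sa: "self_adjoint G H"
  shows "spectrum G H \<noteq> {}"
proof (cases "op_norm G H = 0")
  case True
  have "0 \<in> spectrum G H"
  proof (rule ccontr)
    assume "0 \<notin> spectrum G H"
    then have "op_shift G H 0 \<in> Units (vN G)" by (simp add: spectrum_def)
    then obtain d where d: "d > 0" "\<forall>x\<in>Lp 2 G. d * l2_norm G x \<le> l2_norm G (op_shift G H 0 x)"
      using vN_UnitsD(1) by blast
    have "d \<le> l2_norm G (H (delta \<one>))" using d(2) delta_closed[OF one_closed] by force
    also have "\<dots> \<le> 0"
      using op_norm_bound[OF H delta_closed(1)[OF one_closed]] True by simp
    finally show False using d(1) by simp
  qed
  then show ?thesis by blast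
next
  case False
  then have pos: "op_norm G H > 0" using op_norm_ge_0[OF H] by linarith
  let ?q = "[:- of_real ((op_norm G H)\<^sup>2), 0, 1:] :: complex poly"
  have "op_cpoly G ?q H \<notin> Units (vN G)"
    using op_norm_square_not_Units[OF H sa refl pos, of "op_cpoly G ?q H"]
    by (auto simp: op_cpoly_pCons[OF H] vN_zero[OF H] vN_closed[OF H] cscale_minus_left)
  then show ?thesis using op_cpoly_not_Units[OF H, of ?q] by auto
qed

text \<open>Let \<open>c\<close> be the norm of \<open>p(H)\<close>. Since
  \<open>p(H)\<^sup>2 - c\<^sup>2\<close> is not a unit when \<open>c > 0\<close>, the polynomial
  \<open>p\<^sup>2 - c\<^sup>2\<close> vanishes at a spectral point. That point is real, and there
  \<open>|p| = c\<close>.\<close>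

lemma op_norm_op_poly_le:
  assumes H: "H \<in> carrier (vN G)" and sa: "self_adjoint G H" and e: "0 \<le> e"
    and le: "\<And>t. complex_of_real t \<in> spectrum G H \<Longrightarrow> \<bar>poly p t\<bar> \<le> e"
  shows "op_norm G (op_poly G p H) \<le> e"
proof (rule ccontr)
  define c where "c = op_norm G (op_poly G p H)"
  assume "\<not> op_norm G (op_poly G p H) \<le> e"
  then have c: "c > e" by (simp add: c_def)
  define q where "q = cpoly (p * p - [:c\<^sup>2:])"
  have q: "op_cpoly G q H \<notin> Units (vN G)"
  proof
    assume U: "op_cpoly G q H \<in> Units (vN G)"
    show False
    proof (rule op_norm_square_not_Units[OF op_poly_closed[OF H] self_adjoint_op_poly[OF H sa] c_def _ U])
      show "c > 0" using c e by simp
      show "op_cpoly G q H x = op_poly G p H (op_poly G p H x) - of_real (c\<^sup>2) \<odot> x"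
        if "x \<in> Lp 2 G" for x
        using that unfolding q_def op_poly_conv
        by (simp add: cpoly_diff cpoly_mult op_cpoly_diff[OF H] op_cpoly_mult[OF H] op_cpoly_const[OF H]
            map_poly_pCons)
    qed
  qed
  have "\<exists>z\<in>spectrum G H. poly q z = 0"
  proof (cases "q = 0")
    \<comment> \<open>This happens when \<open>p\<close> is the constant \<open>c\<close> or
      \<open>-c\<close>; every spectral point is then a root.\<close>
    case True
    then show ?thesis using spectrum_nonempty[OF H sa] by auto
  next
    case False
    then show ?thesis by (rule op_cpoly_not_Units[OF H _ q])
  qed
  then obtain z where z: "z \<in> spectrum G H" "poly q z = 0" by blast
  define t where "t = Re z"
  have zt: "z = of_real t"
    using spectrum_self_adjoint_real[OF H sa z(1)] by (simp add: complex_eq_iff t_def)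
  have "poly p t * poly p t - c\<^sup>2 = 0"
    using z(2) unfolding zt q_def poly_cpoly by (simp only: of_real_eq_0_iff poly_diff poly_mult) simp
  then have "(poly p t)\<^sup>2 = c\<^sup>2" by (simp add: power2_eq_square)
  then have "\<bar>poly p t\<bar> = c" using c e by (auto simp: power2_eq_iff)
  then show False using le[of t] z(1) zt c by simp
qed

lemma op_dist_op_poly_le:
  assumes H: "H \<in> carrier (vN G)" and sa: "self_adjoint G H" and e: "0 \<le> e"
    and le: "\<And>t. complex_of_real t \<in> spectrum G H \<Longrightarrow> \<bar>poly p t - poly q t\<bar> \<le> e"
  shows "op_dist G (op_poly G p H) (op_poly G q H) \<le> e"
proof -
  have "op_add G (op_poly G p H) (op_scale G (-1) (op_poly G q H)) = op_poly G (p - q) H"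
  proof (rule vN_eqI[where G = G])
    show "op_add G (op_poly G p H) (op_scale G (-1) (op_poly G q H)) x = op_poly G (p - q) H x"
      if "x \<in> Lp 2 G" for x
      using that by (simp add: op_poly_conv cpoly_diff op_cpoly_diff[OF H] cscale_minus_one)
  qed (intro vN_intros op_poly_closed[OF H])+
  then show ?thesis using op_norm_op_poly_le[OF H sa e, of "p - q"] le by simp
qed

end

section \<open>Functional calculus and the logarithm of the determinant\<close>

lemma Weierstrass_poly:
  fixes h :: "real \<Rightarrow> real"
  assumes "continuous_on {a..b} h"
  shows "\<exists>p :: nat \<Rightarrow> real poly. uniform_limit {a..b} (\<lambda>n. poly (p n)) h sequentially"
proof -
  have "\<exists>p. \<forall>t\<in>{a..b}. \<bar>h t - poly p t\<bar> < inverse (real (Suc n))" for n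
  proof -
    obtain g where g: "real_polynomial_function g" "\<And>t. t \<in> {a..b} \<Longrightarrow> \<bar>h t - g t\<bar> < inverse (real (Suc n))"
      using Stone_Weierstrass_real_polynomial_function[OF compact_Icc assms, of "inverse (real (Suc n))"]
      by auto
    obtain c N where "g = (\<lambda>t. \<Sum>i\<le>N. c i * t ^ i)"
      using g(1) real_polynomial_function_iff_sum by blast
    then have "g t = poly (\<Sum>i\<le>N. monom (c i) i) t" for t by (simp add: poly_sum poly_monom)
    then show ?thesis using g(2) by (intro exI[of _ "\<Sum>i\<le>N. monom (c i) i"]) auto
  qed
  then obtain p where p: "\<And>n t. t \<in> {a..b} \<Longrightarrow> \<bar>h t - poly (p n) t\<bar> < inverse (real (Suc n))"
    by metis
  have "uniform_limit {a..b} (\<lambda>n. poly (p n)) h sequentially"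
  proof (rule uniform_limitI)
    fix e :: real assume "e > 0"
    then have "\<forall>\<^sub>F n in sequentially. inverse (real (Suc n)) < e"
      using LIMSEQ_inverse_real_of_nat order_tendstoD(2) by blast
    then show "\<forall>\<^sub>F n in sequentially. \<forall>t\<in>{a..b}. dist (poly (p n) t) (h t) < e"
    proof eventually_elim
      case (elim n)
      then show ?case
        unfolding dist_real_def using p[of _ n] by (metis abs_minus_commute order.strict_trans)
    qed
  qed
  then show ?thesis by blast
qed

lemma cpoly_pcompose: "cpoly (pcompose p q) = pcompose (cpoly p) (cpoly q)"
  by (induction p) (simp_all add: pcompose_pCons map_poly_pCons cpoly_add cpoly_mult)

abbreviation real_spectrum :: "('a, 'b) monoid_scheme \<Rightarrow> 'a l2_op \<Rightarrow> real set" where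
  "real_spectrum G H \<equiv> {t. complex_of_real t \<in> spectrum G H}"

context group
begin

lemma op_poly_limits:
  assumes H: "H \<in> carrier (vN G)" and sa: "self_adjoint G H"
    and "uniform_limit (real_spectrum G H) (\<lambda>n. poly (p n)) h sequentially"
    and "uniform_limit (real_spectrum G H) (\<lambda>n. poly (q n)) h sequentially"
  shows "(\<lambda>n. op_dist G (op_poly G (p n) H) (op_poly G (q n) H)) \<longlonglongrightarrow> 0"
proof (rule tendstoI)
  fix e :: real assume e: "e > 0"
  then have "e / 4 > 0" by simp
  have "\<forall>\<^sub>F n in sequentially. op_dist G (op_poly G (p n) H) (op_poly G (q n) H) \<le> e / 2"
    using uniform_limitD[OF assms(3) \<open>e / 4 > 0\<close>] uniform_limitD[OF assms(4) \<open>e / 4 > 0\<close>]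
  proof eventually_elim
    case (elim n)
    show ?case
    proof (rule op_dist_op_poly_le[OF H sa])
      fix t assume "complex_of_real t \<in> spectrum G H"
      then have "\<bar>poly (p n) t - h t\<bar> < e / 4" "\<bar>poly (q n) t - h t\<bar> < e / 4"
        using elim by (auto simp: dist_real_def)
      then show "\<bar>poly (p n) t - poly (q n) t\<bar> \<le> e / 2" by linarith
    qed (use e in simp)
  qed
  then show "\<forall>\<^sub>F n in sequentially. dist (op_dist G (op_poly G (p n) H) (op_poly G (q n) H)) 0 < e"
    by eventually_elim
      (use e in \<open>simp add: op_dist_nonneg[OF op_poly_closed[OF H] op_poly_closed[OF H]]\<close>)
qed

text \<open>Existence comes from \<open>op_complete\<close>, independence of the sequence from
  \<open>op_poly_limits\<close>. Continuity on an interval around the spectrum provides an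
  approximating sequence in the first place; if there were none, every operator of the algebra would
  satisfy the condition in \<open>cfc\<close>.\<close>

lemma cfc_correct:
  assumes H: "H \<in> carrier (vN G)" and sa: "self_adjoint G H"
    and spec: "real_spectrum G H \<subseteq> {a..b}" and h: "continuous_on {a..b} h"
  shows "cfc G h H \<in> carrier (vN G) \<and> (\<forall>p. uniform_limit (real_spectrum G H) (\<lambda>n. poly (p n)) h sequentially
    \<longrightarrow> (\<lambda>n. op_dist G (op_poly G (p n) H) (cfc G h H)) \<longlonglongrightarrow> 0)"
proof -
  obtain r :: "nat \<Rightarrow> real poly" where r0: "uniform_limit {a..b} (\<lambda>n. poly (r n)) h sequentially"
    using Weierstrass_poly[OF h] by blast
  have r: "uniform_limit (real_spectrum G H) (\<lambda>n. poly (r n)) h sequentially"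
    by (rule uniform_limit_on_subset[OF r0 spec])
  note cl = op_poly_closed[OF H]
  have "\<exists>M. \<forall>m\<ge>M. \<forall>n\<ge>M. op_dist G (op_poly G (r m) H) (op_poly G (r n) H) < e" if e: "e > 0" for e
  proof -
    have "e / 4 > 0" using e by simp
    then obtain M where M: "\<forall>n\<ge>M. \<forall>t\<in>real_spectrum G H. \<bar>poly (r n) t - h t\<bar> < e / 4"
      using r unfolding uniform_limit_sequentially_iff dist_real_def by blast
    have "op_dist G (op_poly G (r m) H) (op_poly G (r n) H) \<le> e / 2" if "m \<ge> M" "n \<ge> M" for m n
    proof (rule op_dist_op_poly_le[OF H sa])
      fix t assume "complex_of_real t \<in> spectrum G H"
      then have "\<bar>poly (r m) t - h t\<bar> < e / 4" "\<bar>poly (r n) t - h t\<bar> < e / 4"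
        using M that by auto
      then show "\<bar>poly (r m) t - poly (r n) t\<bar> \<le> e / 2" by linarith
    qed (use e in simp)
    then show ?thesis using e by (intro exI[of _ M]) force
  qed
  then obtain B where B: "B \<in> carrier (vN G)" and lim: "(\<lambda>n. op_dist G (op_poly G (r n) H) B) \<longlonglongrightarrow> 0"
    using op_complete[of "\<lambda>n. op_poly G (r n) H", OF cl] by blast
  have all: "(\<lambda>n. op_dist G (op_poly G (p n) H) B) \<longlonglongrightarrow> 0"
    if p: "uniform_limit (real_spectrum G H) (\<lambda>n. poly (p n)) h sequentially" for p
  proof (rule tendsto_sandwich[of "\<lambda>_. 0"])
    show "(\<lambda>n. op_dist G (op_poly G (p n) H) (op_poly G (r n) H) + op_dist G (op_poly G (r n) H) B) \<longlonglongrightarrow> 0"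
      using tendsto_add[OF op_poly_limits[OF H sa p r] lim] by simp
  qed (auto intro!: always_eventually op_dist_triangle op_dist_nonneg cl B)
  have "cfc G h H = B"
    unfolding cfc_def
  proof (rule the_equality)
    show "B \<in> carrier (vN G) \<and> (\<forall>p. uniform_limit (real_spectrum G H) (\<lambda>n. poly (p n)) h sequentially
        \<longrightarrow> (\<lambda>n. op_dist G (op_poly G (p n) H) B) \<longlonglongrightarrow> 0)"
      using B all by blast
    fix C assume "C \<in> carrier (vN G) \<and> (\<forall>p. uniform_limit (real_spectrum G H) (\<lambda>n. poly (p n)) h sequentially
        \<longrightarrow> (\<lambda>n. op_dist G (op_poly G (p n) H) C) \<longlonglongrightarrow> 0)"
    then show "C = B" using op_limit_unique[of "\<lambda>n. op_poly G (r n) H", OF cl _ B _ lim] r by blast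
  qed
  then show ?thesis using B all by simp
qed

lemma adjoint_op_eq:
  assumes "A \<in> carrier (vN G)" "A' \<in> carrier (vN G)"
    and adj: "\<And>x y. x \<in> Lp 2 G \<Longrightarrow> y \<in> Lp 2 G \<Longrightarrow> l2_inner G (A x) y = l2_inner G x (A' y)"
  shows "adjoint_op G A = A'"
  unfolding adjoint_op_def
proof (rule the_equality)
  fix B assume B: "B \<in> carrier (vN G) \<and> (\<forall>x\<in>Lp 2 G. \<forall>y\<in>Lp 2 G. l2_inner G (A x) y = l2_inner G x (B y))"
  show "B = A'"
  proof (rule vN_eqI[where G = G])
    fix y assume y: "y \<in> Lp 2 G"
    have cl: "B y \<in> Lp 2 G" "A' y \<in> Lp 2 G" using B assms(2) y vN_closed by blast+
    have "l2_inner G x (B y - A' y) = 0" if "x \<in> Lp 2 G" for x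
      using B adj that y cl by (simp add: l2_inner_diff_right)
    then have "B y - A' y = 0" using cl by (intro l2_inner_eq_0[where G = G] l2_diff)
    then show "B y = A' y" by simp
  qed (use B assms in auto)
qed (use assms in auto)

lemma vN_trace_scale: "A \<in> carrier (vN G) \<Longrightarrow> vN_trace G (op_scale G c A) = c * vN_trace G A"
  by (simp add: vN_trace_apply delta_closed fun_apply)

text \<open>With \<open>P = A\<^sup>*A\<close> and \<open>B = |A|\<close>, a polynomial \<open>l\<close> close to \<open>ln\<close> on the spectrum of \<open>P\<close> yields the
  polynomial \<open>s \<mapsto> l (s\<^sup>2) / 2\<close>, which is close to \<open>ln\<close> on the spectrum of \<open>B\<close>; and \<open>B\<^sup>2 = P\<close>.\<close>

lemma fk_det_inv_approx:
  assumes A: "A \<in> carrier (vN G)" and A': "A' \<in> carrier (vN G)"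
    and adj: "\<And>x y. x \<in> Lp 2 G \<Longrightarrow> y \<in> Lp 2 G \<Longrightarrow> l2_inner G (A x) y = l2_inner G x (A' y)"
    and d: "d > 0" "\<And>x. x \<in> Lp 2 G \<Longrightarrow> d * l2_norm G x \<le> l2_norm G (A x)"
    and K: "K \<ge> 0" "\<And>x. x \<in> Lp 2 G \<Longrightarrow> l2_norm G (A x) \<le> K * l2_norm G x"
      "\<And>x. x \<in> Lp 2 G \<Longrightarrow> l2_norm G (A' x) \<le> K * l2_norm G x"
    and e: "e \<ge> 0" and l: "\<And>t. t \<in> {d\<^sup>2..K\<^sup>2} \<Longrightarrow> \<bar>poly l t - ln t\<bar> \<le> e"
  shows "\<bar>2 * ln (fk_det_inv G A) - Re (vN_trace G (op_poly G l (A' \<otimes>\<^bsub>vN G\<^esub> A)))\<bar> \<le> e"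
proof -
  define P where "P = A' \<otimes>\<^bsub>vN G\<^esub> A"
  have P: "P \<in> carrier (vN G)" unfolding P_def by (intro vN_intros A A')
  have Px: "P x = A' (A x)" if "x \<in> Lp 2 G" for x using that by (simp add: P_def)
  note clA = vN_closed[OF A] and clA' = vN_closed[OF A']
  have inner_P: "l2_inner G (P x) y = l2_inner G (A x) (A y)" if "x \<in> Lp 2 G" "y \<in> Lp 2 G" for x y
  proof -
    have "l2_inner G (A' (A x)) y = cnj (l2_inner G y (A' (A x)))" by (rule l2_inner_commute)
    also have "\<dots> = cnj (l2_inner G (A y) (A x))" using that by (simp add: adj clA)
    also have "\<dots> = l2_inner G (A x) (A y)" by (rule l2_inner_commute[symmetric])
    finally show ?thesis using that by (simp add: Px)
  qed
  have saP: "self_adjoint G P"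
    unfolding self_adjoint_def using inner_P by (simp add: Px adj clA)
  \<comment> \<open>The lower end comes from the quadratic form
    \<open>\<parallel>A x\<parallel>\<^sup>2\<close>, the upper end from the norm bounds on
    \<open>A\<close> and its adjoint.\<close>
  have specP: "real_spectrum G P \<subseteq> {d\<^sup>2..K\<^sup>2}"
  proof
    fix t assume "t \<in> real_spectrum G P"
    then have t: "complex_of_real t \<in> spectrum G P" by simp
    have "d\<^sup>2 \<le> t"
    proof (rule spectrum_self_adjoint_ge[OF P saP t])
      fix x assume x: "x \<in> Lp 2 G"
      have "(d * l2_norm G x)\<^sup>2 \<le> (l2_norm G (A x))\<^sup>2" using d x by (intro power_mono) auto
      then show "d\<^sup>2 * (l2_norm G x)\<^sup>2 \<le> Re (l2_inner G (P x) x)"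
        by (simp add: inner_P x l2_inner_self clA power_mult_distrib)
    qed
    moreover have "cmod (complex_of_real t - 0) \<le> K\<^sup>2"
    proof (rule spectrum_norm_le[OF P t])
      fix x assume x: "x \<in> Lp 2 G"
      have "l2_norm G (P x) \<le> K * (K * l2_norm G x)"
        using K(3)[OF clA[OF x]] mult_left_mono[OF K(2)[OF x] K(1)] by (simp add: Px x)
      then show "l2_norm G (P x - 0 \<odot> x) \<le> K\<^sup>2 * l2_norm G x" by (simp add: power2_eq_square mult.assoc)
    qed simp
    ultimately show "t \<in> {d\<^sup>2..K\<^sup>2}" by simp
  qed
  \<comment> \<open>A spectral point of \<open>P\<close> shows \<open>d \<le> K\<close>, which makes
    the radius \<open>r\<close> below nonnegative.\<close>
  obtain z where z: "z \<in> spectrum G P" using spectrum_nonempty[OF P saP] by blast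
  have "z = of_real (Re z)" using spectrum_self_adjoint_real[OF P saP z] by (simp add: complex_eq_iff)
  then have "Re z \<in> real_spectrum G P" using z by (metis mem_Collect_eq)
  then have "Re z \<in> {d\<^sup>2..K\<^sup>2}" by (rule subsetD[OF specP])
  then have "d\<^sup>2 \<le> K\<^sup>2" by simp
  then have dK: "d \<le> K" using K(1) by (rule power2_le_imp_le)
  note clP = op_poly_closed[OF P]

  define B where "B = cfc G sqrt P"
  have "continuous_on {d\<^sup>2..K\<^sup>2} sqrt" by (intro continuous_intros)
  note cfcB = cfc_correct[OF P saP specP this, folded B_def]
  have B: "B \<in> carrier (vN G)" using cfcB by blast
  obtain p :: "nat \<Rightarrow> real poly" where p0: "uniform_limit {d\<^sup>2..K\<^sup>2} (\<lambda>n. poly (p n)) sqrt sequentially"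
    using Weierstrass_poly[OF \<open>continuous_on {d\<^sup>2..K\<^sup>2} sqrt\<close>] by blast
  have p: "uniform_limit (real_spectrum G P) (\<lambda>n. poly (p n)) sqrt sequentially"
    by (rule uniform_limit_on_subset[OF p0 specP])
  have limB: "(\<lambda>n. op_dist G (op_poly G (p n) P) B) \<longlonglongrightarrow> 0" using cfcB p by blast
  have saB: "self_adjoint G B"
    by (rule self_adjoint_limit[OF clP B limB self_adjoint_op_poly[OF P saP]])
  \<comment> \<open>The squares of the \<open>p n\<close> tend to the identity function on the
    spectrum, so their values at \<open>P\<close> tend to \<open>P\<close>. They also tend to
    \<open>B\<^sup>2\<close>.\<close>
  have BB: "B \<otimes>\<^bsub>vN G\<^esub> B = P"
  proof (rule op_limit_unique[of "\<lambda>n. op_poly G (p n * p n) P", OF clP _ P])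
    show "B \<otimes>\<^bsub>vN G\<^esub> B \<in> carrier (vN G)" by (intro vN_intros B)
    have "op_poly G (p n * p n) P = op_poly G (p n) P \<otimes>\<^bsub>vN G\<^esub> op_poly G (p n) P" for n
    proof (rule vN_eqI[where G = G])
      show "op_poly G (p n * p n) P x = (op_poly G (p n) P \<otimes>\<^bsub>vN G\<^esub> op_poly G (p n) P) x"
        if "x \<in> Lp 2 G" for x
        using that by (simp add: op_poly_conv cpoly_mult op_cpoly_mult[OF P])
    qed (intro vN_intros clP)+
    then show "(\<lambda>n. op_dist G (op_poly G (p n * p n) P) (B \<otimes>\<^bsub>vN G\<^esub> B)) \<longlonglongrightarrow> 0"
      using op_limit_mult[of "\<lambda>n. op_poly G (p n) P" "\<lambda>n. op_poly G (p n) P", OF clP clP B B limB limB]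
      by simp
    have "uniform_limit (real_spectrum G P) (\<lambda>n t. poly (p n) t * poly (p n) t) (\<lambda>t. sqrt t * sqrt t) sequentially"
    proof (rule uniform_lim_mult[OF p p])
      \<comment> \<open>The rule for products of uniform limits asks for bounded limit
        functions.\<close>
      have "bounded (sqrt ` {d\<^sup>2..K\<^sup>2})"
        by (rule compact_imp_bounded[OF compact_continuous_image[OF \<open>continuous_on {d\<^sup>2..K\<^sup>2} sqrt\<close> compact_Icc]])
      then show "bounded (sqrt ` real_spectrum G P)" "bounded (sqrt ` real_spectrum G P)"
        by (rule bounded_subset[OF _ image_mono[OF specP]])+
    qed
    also have "?this \<longleftrightarrow> uniform_limit (real_spectrum G P) (\<lambda>n. poly (p n * p n)) (\<lambda>t. t) sequentially"
    proof (rule uniform_limit_cong')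
      show "sqrt t * sqrt t = t" if "t \<in> real_spectrum G P" for t
      proof -
        have "0 \<le> d\<^sup>2" by simp
        also have "d\<^sup>2 \<le> t" using that specP by auto
        finally show ?thesis by simp
      qed
    qed simp
    finally have "(\<lambda>n. op_dist G (op_poly G (p n * p n) P) (op_poly G [:0, 1:] P)) \<longlonglongrightarrow> 0"
      by (rule op_poly_limits[OF P saP]) (simp add: uniform_limit_iff)
    moreover have "op_poly G [:0, 1:] P = P"
    proof (rule vN_eqI[where G = G, OF clP P])
      show "op_poly G [:0, 1:] P x = P x" if "x \<in> Lp 2 G" for x
        using that by (simp add: op_poly_conv map_poly_pCons op_cpoly_X[OF P])
    qed
    ultimately show "(\<lambda>n. op_dist G (op_poly G (p n * p n) P) P) \<longlonglongrightarrow> 0" by simp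
  qed

  \<comment> \<open>Centre and half-length of \<open>[d, K]\<close>. On the spectrum of
    \<open>P\<close> the square root stays within \<open>r\<close> of \<open>c\<close>, so
    \<open>B\<close> is within \<open>r\<close> of the scalar \<open>c\<close>, and
    \<open>spectrum_norm_le\<close> confines the real spectrum of \<open>B\<close> to
    \<open>[d, K]\<close>, where \<open>ln\<close> is continuous.\<close>
  define c r where "c = (K + d) / 2" and "r = (K - d) / 2"
  have near: "op_dist G B (op_poly G [:c:] P) \<le> r"
  proof (rule field_le_epsilon)
    fix \<epsilon> :: real assume eps: "\<epsilon> > 0"
    then have "\<epsilon> / 2 > 0" by simp
    have "\<forall>\<^sub>F n in sequentially. op_dist G (op_poly G (p n) P) B < \<epsilon> / 2"
      using limB \<open>\<epsilon> / 2 > 0\<close> by (rule order_tendstoD(2))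
    then have "\<forall>\<^sub>F n in sequentially. op_dist G B (op_poly G [:c:] P) \<le> r + \<epsilon>"
      using uniform_limitD[OF p \<open>\<epsilon> / 2 > 0\<close>]
    proof eventually_elim
      case (elim n)
      have "op_dist G (op_poly G (p n) P) (op_poly G [:c:] P) \<le> r + \<epsilon> / 2"
      proof (rule op_dist_op_poly_le[OF P saP])
        show "0 \<le> r + \<epsilon> / 2" using dK eps by (simp add: r_def)
        fix t assume t: "complex_of_real t \<in> spectrum G P"
        then have "d\<^sup>2 \<le> t" "t \<le> K\<^sup>2" using specP by auto
        then have "d \<le> sqrt t" "sqrt t \<le> K"
          using d(1) K(1) by (auto intro: real_le_rsqrt real_le_lsqrt)
        moreover have "\<bar>poly (p n) t - sqrt t\<bar> < \<epsilon> / 2" using elim(2) t by (simp add: dist_real_def)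
        ultimately show "\<bar>poly (p n) t - poly [:c:] t\<bar> \<le> r + \<epsilon> / 2"
          by (simp add: c_def r_def abs_if field_simps split: if_splits)
      qed
      then show ?case
        using op_dist_triangle[OF B clP clP, of "[:c:]" "p n"] op_dist_commute[OF B clP, of "p n"] elim(1)
        by linarith
    qed
    then show "op_dist G B (op_poly G [:c:] P) \<le> r + \<epsilon>" by simp
  qed
  have specB: "real_spectrum G B \<subseteq> {d..K}"
  proof
    fix t assume "t \<in> real_spectrum G B"
    then have t: "complex_of_real t \<in> spectrum G B" by simp
    have "cmod (complex_of_real t - complex_of_real c) \<le> r"
    proof (rule spectrum_norm_le[OF B t])
      show "0 \<le> r" using dK by (simp add: r_def)
      fix x assume x: "x \<in> Lp 2 G"
      have "op_poly G [:c:] P x = complex_of_real c \<odot> x"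
        using x by (simp add: op_poly_conv map_poly_pCons op_cpoly_const[OF P])
      then show "l2_norm G (B x - complex_of_real c \<odot> x) \<le> r * l2_norm G x"
        using op_dist_bound[OF B clP x, of "[:c:]"] mult_right_mono[OF near, of "l2_norm G x"] by simp
    qed
    then have "\<bar>t - c\<bar> \<le> r" by (simp only: of_real_diff[symmetric] norm_of_real)
    then have "t - c \<le> r" "- (t - c) \<le> r" by (rule abs_le_D1, rule abs_le_D2)
    then have "d \<le> t" "t \<le> K" by (simp_all add: c_def r_def field_simps)
    then show "t \<in> {d..K}" by simp
  qed

  define C where "C = cfc G ln B"
  have "continuous_on {d..K} ln" using d(1) by (intro continuous_intros) auto
  note cfcC = cfc_correct[OF B saB specB this, folded C_def]
  have C: "C \<in> carrier (vN G)" using cfcC by blast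
  have "continuous_on {d\<^sup>2..K\<^sup>2} ln"
  proof (intro continuous_on_ln continuous_on_id ballI)
    fix t assume "t \<in> {d\<^sup>2..K\<^sup>2}"
    moreover have "d\<^sup>2 > 0" using d(1) by simp
    ultimately show "t \<noteq> 0" by auto
  qed
  then obtain q :: "nat \<Rightarrow> real poly" where q: "uniform_limit {d\<^sup>2..K\<^sup>2} (\<lambda>n. poly (q n)) ln sequentially"
    using Weierstrass_poly by blast
  define q' where "q' n = smult (1/2) (pcompose (q n) [:0, 0, 1:])" for n
  have "uniform_limit {d..K} (\<lambda>n s. poly (q n) (s\<^sup>2)) (\<lambda>s. ln (s\<^sup>2)) sequentially"
    using d(1) by (intro uniform_limit_compose'[OF q]) (auto intro: power_mono)
  then have "uniform_limit {d..K} (\<lambda>n s. 1/2 * poly (q n) (s\<^sup>2)) (\<lambda>s. 1/2 * ln (s\<^sup>2)) sequentially"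
    by (intro uniform_limit_intros)
  also have "?this \<longleftrightarrow> uniform_limit {d..K} (\<lambda>n. poly (q' n)) ln sequentially"
    using d(1) by (intro uniform_limit_cong')
      (auto simp: q'_def poly_pcompose power2_eq_square ln_mult)
  finally have "uniform_limit (real_spectrum G B) (\<lambda>n. poly (q' n)) ln sequentially"
    by (rule uniform_limit_on_subset[OF _ specB])
  then have limC: "(\<lambda>n. op_dist G (op_poly G (q' n) B) C) \<longlonglongrightarrow> 0" using cfcC by blast
  have "op_cpoly G [:0, 0, 1:] B = P"
  proof (rule vN_eqI[where G = G, OF op_cpoly_closed[OF B] P])
    show "op_cpoly G [:0, 0, 1:] B x = P x" if "x \<in> Lp 2 G" for x
      using that fun_cong[OF BB, of x] by (simp add: op_cpoly_pCons[OF B] vN_zero[OF B] vN_closed[OF B])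
  qed
  then have "op_poly G (q' n) B = op_scale G (1/2) (op_poly G (q n) P)" for n
  proof (intro vN_eqI[where G = G])
    show "op_poly G (q' n) B x = op_scale G (1/2) (op_poly G (q n) P) x" if "x \<in> Lp 2 G" for x
      using that \<open>op_cpoly G [:0, 0, 1:] B = P\<close>
      by (simp add: q'_def op_poly_conv cpoly_smult cpoly_pcompose map_poly_pCons op_cpoly_smult[OF B]
          op_cpoly_pcompose[OF B])
  qed (intro vN_intros op_poly_closed B P)+
  then have tr: "vN_trace G (op_poly G (q' n) B) = vN_trace G (op_poly G (q n) P) / 2" for n
    by (simp add: vN_trace_scale[OF clP])
  have "(\<lambda>n. vN_trace G (op_poly G (q n) P) / 2) \<longlonglongrightarrow> vN_trace G C"
    unfolding tr[symmetric]
  proof (subst LIM_zero_iff[symmetric], rule Lim_null_comparison[OF _ limC])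
    show "\<forall>\<^sub>F n in sequentially. cmod (vN_trace G (op_poly G (q' n) B) - vN_trace G C)
        \<le> op_dist G (op_poly G (q' n) B) C"
      by (intro always_eventually allI vN_trace_dist op_poly_closed[OF B] C)
  qed
  from tendsto_mult[OF tendsto_const[of 2] this]
  have limtr: "(\<lambda>n. vN_trace G (op_poly G (q n) P)) \<longlonglongrightarrow> 2 * vN_trace G C" by simp
  \<comment> \<open>The \<open>q n\<close> stand in for \<open>ln\<close>: on the spectrum of
    \<open>P\<close> they come within \<open>\<epsilon>\<close> of it, hence within
    \<open>e + \<epsilon>\<close> of \<open>l\<close>, and the trace is 1-Lipschitz.\<close>
  have "cmod (2 * vN_trace G C - vN_trace G (op_poly G l P)) \<le> e"
  proof (rule field_le_epsilon)
    fix \<epsilon> :: real assume eps: "\<epsilon> > 0"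
    show "cmod (2 * vN_trace G C - vN_trace G (op_poly G l P)) \<le> e + \<epsilon>"
    proof (rule tendsto_upperbound)
      show "(\<lambda>n. cmod (vN_trace G (op_poly G (q n) P) - vN_trace G (op_poly G l P)))
          \<longlonglongrightarrow> cmod (2 * vN_trace G C - vN_trace G (op_poly G l P))"
        by (intro tendsto_intros limtr)
      show "\<forall>\<^sub>F n in sequentially. cmod (vN_trace G (op_poly G (q n) P) - vN_trace G (op_poly G l P)) \<le> e + \<epsilon>"
        using uniform_limitD[OF q eps]
      proof eventually_elim
        case (elim n)
        have "op_dist G (op_poly G (q n) P) (op_poly G l P) \<le> e + \<epsilon>"
        proof (rule op_dist_op_poly_le[OF P saP])
          fix t assume "complex_of_real t \<in> spectrum G P"
          then have t: "t \<in> {d\<^sup>2..K\<^sup>2}" using specP by blast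
          have "\<bar>poly (q n) t - ln t\<bar> < \<epsilon>" using elim t by (auto simp: dist_real_def)
          then show "\<bar>poly (q n) t - poly l t\<bar> \<le> e + \<epsilon>" using l[OF t] by linarith
        qed (use e eps in simp)
        then show ?case using vN_trace_dist[OF clP clP, of "q n" l] by linarith
      qed
    qed simp
  qed
  then have "\<bar>Re (2 * vN_trace G C - vN_trace G (op_poly G l P))\<bar> \<le> e"
    using abs_Re_le_cmod order_trans by blast
  moreover have "op_abs G A = B"
    unfolding op_abs_def B_def P_def by (simp add: adjoint_op_eq[OF A A' adj])
  ultimately show ?thesis by (simp add: fk_det_inv_def C_def P_def)
qed

end

section \<open>The representation of \<open>L\<^sup>1\<close> of the source of a homomorphism\<close>

text \<open>This is the operator of the pushed-forward series (\<open>L1_rep_push_forward\<close>).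
  Summing over the source group keeps the fibres of \<open>h\<close> out of all later computations,
  and makes convolution, involution and powers take place in one algebra for all
  \<open>h\<close>.\<close>

definition hom_rep :: "('a, 'b) monoid_scheme \<Rightarrow> ('c, 'd) monoid_scheme \<Rightarrow> ('a \<Rightarrow> 'c) \<Rightarrow>
    ('a \<Rightarrow> complex) \<Rightarrow> 'c l2_op" where
  "hom_rep G H h f = (\<lambda>x\<in>Lp 2 H. \<lambda>g. if g \<in> carrier H
     then infsum (\<lambda>w. f w * x (g \<otimes>\<^bsub>H\<^esub> h w)) (carrier G) else 0)"

definition l1_norm :: "('a, 'b) monoid_scheme \<Rightarrow> ('a \<Rightarrow> complex) \<Rightarrow> real" where
  "l1_norm G f = infsum (\<lambda>w. cmod (f w)) (carrier G)"

definition l1_star :: "('a, 'b) monoid_scheme \<Rightarrow> ('a \<Rightarrow> complex) \<Rightarrow> 'a \<Rightarrow> complex" where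
  "l1_star G f = (\<lambda>w. if w \<in> carrier G then cnj (f (inv\<^bsub>G\<^esub> w)) else 0)"

text \<open>Left convolution is iterated to match \<open>A ^^ i\<close> in
  \<open>op_poly\<close>.\<close>

definition l1_power :: "('a, 'b) monoid_scheme \<Rightarrow> ('a \<Rightarrow> complex) \<Rightarrow> nat \<Rightarrow> 'a \<Rightarrow> complex" where
  "l1_power G f n = (conv G f ^^ n) (delta \<one>\<^bsub>G\<^esub>)"

lemma l1_summable: "f \<in> Lp 1 G \<Longrightarrow> (\<lambda>w. cmod (f w)) summable_on carrier G"
  by (simp add: Lp_def)

lemma l1_norm_nonneg [simp]: "0 \<le> l1_norm G f"
  by (simp add: l1_norm_def infsum_nonneg)

lemma L2_set_sum_le: "L2_set (\<lambda>g. cmod (\<Sum>w\<in>W. u w g)) F \<le> (\<Sum>w\<in>W. L2_set (\<lambda>g. cmod (u w g)) F)"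
proof (induction W rule: infinite_finite_induct)
  case (insert w W)
  have "L2_set (\<lambda>g. cmod (\<Sum>v\<in>insert w W. u v g)) F
      \<le> L2_set (\<lambda>g. cmod (u w g) + cmod (\<Sum>v\<in>W. u v g)) F"
    using insert.hyps by (intro L2_set_mono) (auto intro: norm_triangle_ineq)
  also have "\<dots> \<le> L2_set (\<lambda>g. cmod (u w g)) F + L2_set (\<lambda>g. cmod (\<Sum>v\<in>W. u v g)) F"
    by (rule L2_set_triangle_ineq)
  finally show ?case using insert by simp
qed (simp_all add: L2_set_def)

context group
begin

section \<open>The involutive algebra \<open>L^1\<close> of a group\<close>

lemma right_mult_bij: "a \<in> carrier G \<Longrightarrow> bij_betw (\<lambda>g. g \<otimes> a) (carrier G) (carrier G)"
  by (rule bij_betwI[of _ _ _ "\<lambda>g. g \<otimes> inv a"]) (auto simp: m_assoc)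

lemma left_mult_bij: "a \<in> carrier G \<Longrightarrow> bij_betw (\<lambda>g. a \<otimes> g) (carrier G) (carrier G)"
  by (rule bij_betwI[of _ _ _ "\<lambda>g. inv a \<otimes> g"]) (auto simp flip: m_assoc)

lemma inv_bij: "bij_betw (\<lambda>g. inv g) (carrier G) (carrier G)"
  by (rule bij_betwI[of _ _ _ "\<lambda>g. inv g"]) auto

lemma right_shift_l2:
  assumes a: "a \<in> carrier G" and x: "x \<in> Lp 2 G"
  shows "(\<lambda>g. if g \<in> carrier G then x (g \<otimes> a) else 0) \<in> Lp 2 G"
    and "l2_norm G (\<lambda>g. if g \<in> carrier G then x (g \<otimes> a) else 0) = l2_norm G x"
proof -
  note b = right_mult_bij[OF a]
  have "(\<lambda>g. (cmod (x (g \<otimes> a)))\<^sup>2) summable_on carrier G"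
    using summable_on_reindex_bij_betw[OF b, of "\<lambda>g. (cmod (x g))\<^sup>2"] l2_summable[OF x] by blast
  then show "(\<lambda>g. if g \<in> carrier G then x (g \<otimes> a) else 0) \<in> Lp 2 G"
    by (auto simp: Lp_def cong: summable_on_cong)
  show "l2_norm G (\<lambda>g. if g \<in> carrier G then x (g \<otimes> a) else 0) = l2_norm G x"
    using infsum_reindex_bij_betw[OF b, of "\<lambda>g. (cmod (x g))\<^sup>2"]
    by (simp add: l2_norm_def cong: infsum_cong)
qed

text \<open>For fixed \<open>u\<close>, left translation permutes the group, so the inner sum is
  \<open>|f u|\<close> times the norm of \<open>k\<close>. Absolute summability over the product
  justifies swapping sums in \<open>conv_closed\<close> and \<open>hom_rep_conv\<close>.\<close>

lemma conv_abs_summable: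
  assumes f: "f \<in> Lp 1 G" and k: "k \<in> Lp 1 G"
  shows "(\<lambda>(u, w). cmod (f u * k (inv u \<otimes> w))) summable_on carrier G \<times> carrier G"
proof -
  have "((\<lambda>w. cmod (f u * k (inv u \<otimes> w))) has_sum (cmod (f u) * l1_norm G k)) (carrier G)"
    if u: "u \<in> carrier G" for u
  proof -
    note b = left_mult_bij[OF inv_closed[OF u]]
    have "((\<lambda>w. cmod (k (inv u \<otimes> w))) has_sum l1_norm G k) (carrier G)"
      using summable_on_reindex_bij_betw[OF b, of "\<lambda>w. cmod (k w)"]
        infsum_reindex_bij_betw[OF b, of "\<lambda>w. cmod (k w)"] l1_summable[OF k]
      by (simp add: has_sum_iff l1_norm_def)
    then show ?thesis by (simp add: norm_mult has_sum_cmult_right)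
  qed
  moreover have "(\<lambda>u. cmod (f u) * l1_norm G k) summable_on carrier G"
    by (intro summable_on_cmult_left l1_summable f)
  ultimately show ?thesis
    by (intro summable_on_SigmaI[where g = "\<lambda>u. cmod (f u) * l1_norm G k"]) auto
qed

lemma conv_closed:
  assumes f: "f \<in> Lp 1 G" and k: "k \<in> Lp 1 G"
  shows "conv G f k \<in> Lp 1 G"
proof -
  have s: "(\<lambda>(w, u). cmod (f u * k (inv u \<otimes> w))) summable_on carrier G \<times> carrier G"
    using conv_abs_summable[OF f k]
    by (subst (asm) summable_on_swap) (simp add: case_prod_unfold)
  have "(\<lambda>w. infsum (\<lambda>u. cmod (f u * k (inv u \<otimes> w))) (carrier G)) summable_on carrier G"
    using summable_on_Sigma_banach[OF s] by simp
  moreover have "cmod (conv G f k w) \<le> infsum (\<lambda>u. cmod (f u * k (inv u \<otimes> w))) (carrier G)"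
    if w: "w \<in> carrier G" for w
  proof -
    have "(\<lambda>u. cmod (f u * k (inv u \<otimes> w))) summable_on carrier G"
      using summable_on_SigmaD1[OF s w] by simp
    then show ?thesis using w by (simp add: conv_def norm_infsum_bound)
  qed
  ultimately have "(\<lambda>w. cmod (conv G f k w)) summable_on carrier G"
    by (rule summable_on_comparison_test) auto
  then show ?thesis by (simp add: Lp_def conv_def)
qed

lemma delta_l1: "a \<in> carrier G \<Longrightarrow> delta a \<in> Lp 1 G"
proof -
  assume a: "a \<in> carrier G"
  have "((\<lambda>g. cmod (delta a g)) has_sum 1) (carrier G)"
    by (rule has_sum_finite_neutralI[of "{a}"]) (use a in \<open>auto simp: delta_def\<close>)
  then show ?thesis using a by (auto simp: Lp_def delta_def has_sum_imp_summable)
qed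

lemma l1_power_closed: "f \<in> Lp 1 G \<Longrightarrow> l1_power G f n \<in> Lp 1 G"
  unfolding l1_power_def
  by (induction n) (simp_all add: conv_closed delta_l1 del: One_nat_def)

lemma l1_star_closed:
  assumes "f \<in> Lp 1 G"
  shows "l1_star G f \<in> Lp 1 G" "l1_norm G (l1_star G f) = l1_norm G f"
proof -
  have "(\<lambda>w. cmod (f (inv w))) summable_on carrier G"
    using summable_on_reindex_bij_betw[OF inv_bij, of "\<lambda>w. cmod (f w)"] l1_summable[OF assms] by blast
  then show "l1_star G f \<in> Lp 1 G" by (simp add: Lp_def l1_star_def cong: summable_on_cong)
  show "l1_norm G (l1_star G f) = l1_norm G f"
    using infsum_reindex_bij_betw[OF inv_bij, of "\<lambda>w. cmod (f w)"]
    by (simp add: l1_norm_def l1_star_def cong: infsum_cong)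
qed

end

context group_hom
begin

section \<open>The representation on the target of a homomorphism\<close>

lemma hom_rep_summable:
  assumes f: "f \<in> Lp 1 G" and x: "x \<in> Lp 2 H"
  shows "(\<lambda>w. cmod (f w * x (g \<otimes>\<^bsub>H\<^esub> h w))) summable_on carrier G"
proof (rule summable_on_comparison_test)
  show "(\<lambda>w. cmod (f w) * l2_norm H x) summable_on carrier G"
    by (intro summable_on_cmult_left l1_summable f)
  show "cmod (f w * x (g \<otimes>\<^bsub>H\<^esub> h w)) \<le> cmod (f w) * l2_norm H x" for w
    unfolding norm_mult by (intro mult_left_mono cmod_le_l2_norm x) auto
qed auto

lemma hom_rep_apply:
  assumes "x \<in> Lp 2 H" "g \<in> carrier H"
  shows "hom_rep G H h f x g = infsum (\<lambda>w. f w * x (g \<otimes>\<^bsub>H\<^esub> h w)) (carrier G)"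
  using assms by (simp add: hom_rep_def)

text \<open>Each right translate of \<open>x\<close> has the norm of \<open>x\<close>, so finite
  partial sums obey the bound by Minkowski. On a fixed finite set \<open>F\<close> of coordinates
  the partial sums over \<open>W\<close> converge, and the bound is uniform in
  \<open>F\<close>.\<close>

lemma hom_rep_bound:
  assumes f: "f \<in> Lp 1 G" and x: "x \<in> Lp 2 H"
  shows "hom_rep G H h f x \<in> Lp 2 H" "l2_norm H (hom_rep G H h f x) \<le> l1_norm G f * l2_norm H x"
proof -
  have "L2_set (\<lambda>g. cmod (hom_rep G H h f x g)) F \<le> l1_norm G f * l2_norm H x"
    if F: "finite F" "F \<subseteq> carrier H" for F
  proof (rule tendsto_upperbound)
    show "((\<lambda>W. L2_set (\<lambda>g. cmod (\<Sum>w\<in>W. f w * x (g \<otimes>\<^bsub>H\<^esub> h w))) F) \<longlongrightarrow>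
        L2_set (\<lambda>g. cmod (hom_rep G H h f x g)) F) (finite_subsets_at_top (carrier G))"
      unfolding L2_set_def
    proof (intro tendsto_intros)
      fix g assume "g \<in> F"
      then have g: "g \<in> carrier H" using F by blast
      have "((\<lambda>w. f w * x (g \<otimes>\<^bsub>H\<^esub> h w)) has_sum hom_rep G H h f x g) (carrier G)"
        unfolding hom_rep_apply[OF x g]
        by (intro has_sum_infsum abs_summable_summable[OF hom_rep_summable] f x)
      then show "((\<lambda>W. \<Sum>w\<in>W. f w * x (g \<otimes>\<^bsub>H\<^esub> h w)) \<longlongrightarrow> hom_rep G H h f x g)
          (finite_subsets_at_top (carrier G))" by (simp add: has_sum_def)
    qed
    show "\<forall>\<^sub>F W in finite_subsets_at_top (carrier G).
        L2_set (\<lambda>g. cmod (\<Sum>w\<in>W. f w * x (g \<otimes>\<^bsub>H\<^esub> h w))) F \<le> l1_norm G f * l2_norm H x"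
    proof (rule eventually_finite_subsets_at_top_weakI)
      fix W assume W: "finite W" "W \<subseteq> carrier G"
      have "L2_set (\<lambda>g. cmod (\<Sum>w\<in>W. f w * x (g \<otimes>\<^bsub>H\<^esub> h w))) F
          \<le> (\<Sum>w\<in>W. L2_set (\<lambda>g. cmod (f w * x (g \<otimes>\<^bsub>H\<^esub> h w))) F)" by (rule L2_set_sum_le)
      also have "\<dots> \<le> (\<Sum>w\<in>W. cmod (f w) * l2_norm H x)"
      proof (rule sum_mono)
        fix w assume "w \<in> W"
        then have hw: "h w \<in> carrier H" using W by auto
        let ?y = "\<lambda>g. if g \<in> carrier H then x (g \<otimes>\<^bsub>H\<^esub> h w) else 0"
        have "L2_set (\<lambda>g. cmod (f w * x (g \<otimes>\<^bsub>H\<^esub> h w))) F = cmod (f w) * L2_set (\<lambda>g. cmod (?y g)) F"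
          using F by (auto simp: L2_set_right_distrib norm_mult intro!: L2_set_cong)
        also have "\<dots> \<le> cmod (f w) * l2_norm H x"
          using L2_set_le_l2_norm[OF H.right_shift_l2(1)[OF hw x] F] H.right_shift_l2(2)[OF hw x]
          by (intro mult_left_mono) auto
        finally show "L2_set (\<lambda>g. cmod (f w * x (g \<otimes>\<^bsub>H\<^esub> h w))) F \<le> cmod (f w) * l2_norm H x" .
      qed
      also have "\<dots> = (\<Sum>w\<in>W. cmod (f w)) * l2_norm H x" by (simp add: sum_distrib_right)
      also have "\<dots> \<le> l1_norm G f * l2_norm H x"
        unfolding l1_norm_def
        by (intro mult_right_mono finite_sum_le_infsum l1_summable f W) auto
      finally show "L2_set (\<lambda>g. cmod (\<Sum>w\<in>W. f w * x (g \<otimes>\<^bsub>H\<^esub> h w))) F \<le> l1_norm G f * l2_norm H x" .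
    qed
  qed simp
  note bound = this
  have zero: "hom_rep G H h f x g = 0" if "g \<notin> carrier H" for g
    using x that by (simp add: hom_rep_def)
  show "hom_rep G H h f x \<in> Lp 2 H"
    "l2_norm H (hom_rep G H h f x) \<le> l1_norm G f * l2_norm H x"
    by (rule l2_boundI[OF zero bound]; assumption)+
qed

lemma hom_rep_closed:
  assumes f: "f \<in> Lp 1 G"
  shows "hom_rep G H h f \<in> carrier (vN H)"
proof (rule vN_I)
  fix x assume x: "x \<in> Lp 2 H"
  note s = abs_summable_summable[OF hom_rep_summable[OF f]]
  show "hom_rep G H h f (x + y) = hom_rep G H h f x + hom_rep G H h f y" if y: "y \<in> Lp 2 H" for y
    using x y l2_add(1)[OF x y] infsum_add[OF s[OF x] s[OF y]]
    by (auto simp: hom_rep_def fun_eq_iff fun_apply distrib_left)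
  show "hom_rep G H h f (c \<odot> x) = c \<odot> hom_rep G H h f x" for c
    using x l2_scale[OF x] infsum_cmult_right'[of c "\<lambda>w. f w * x (_ \<otimes>\<^bsub>H\<^esub> h w)" "carrier G"]
    by (auto simp: hom_rep_def fun_eq_iff fun_apply mult.left_commute)
  show "hom_rep G H h f (left_translate H a x) = left_translate H a (hom_rep G H h f x)"
    if a: "a \<in> carrier H" for a
    using x a H.left_translate_closed[OF a x]
    by (auto simp: hom_rep_def left_translate_def fun_eq_iff H.m_assoc intro!: infsum_cong)
qed (use hom_rep_bound[OF f] in \<open>auto simp: hom_rep_def\<close>)

lemma hom_rep_one: "hom_rep G H h (delta \<one>\<^bsub>G\<^esub>) = op_id H"
proof (rule vN_eqI[where G = H])
  fix x assume x: "x \<in> Lp 2 H"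
  have "hom_rep G H h (delta \<one>\<^bsub>G\<^esub>) x g = x g" for g
  proof (cases "g \<in> carrier H")
    case True
    have "((\<lambda>w. delta \<one>\<^bsub>G\<^esub> w * x (g \<otimes>\<^bsub>H\<^esub> h w)) has_sum x g) (carrier G)"
      by (rule has_sum_finite_neutralI[of "{\<one>\<^bsub>G\<^esub>}"]) (use True in \<open>auto simp: delta_def\<close>)
    then show ?thesis using True x by (simp add: hom_rep_apply infsumI)
  qed (use x in \<open>simp add: hom_rep_def l2_zero_outside\<close>)
  then show "hom_rep G H h (delta \<one>\<^bsub>G\<^esub>) x = op_id H x" using x by (simp add: fun_eq_iff)
qed (auto intro!: hom_rep_closed G.delta_l1 H.op_id_closed)

text \<open>Both sides are one double sum over \<open>u\<close> and \<open>w = u v\<close>. The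
  translations append \<open>h u\<close> and \<open>h v\<close> to \<open>g\<close> on the right in
  this order, so products are preserved and not reversed.\<close>

lemma hom_rep_conv:
  assumes f: "f \<in> Lp 1 G" and k: "k \<in> Lp 1 G"
  shows "hom_rep G H h (conv G f k) = hom_rep G H h f \<otimes>\<^bsub>vN H\<^esub> hom_rep G H h k"
proof (rule vN_eqI[where G = H])
  fix x assume x: "x \<in> Lp 2 H"
  have "hom_rep G H h (conv G f k) x g = hom_rep G H h f (hom_rep G H h k x) g" if g: "g \<in> carrier H" for g
  proof -
    let ?t = "\<lambda>u w. f u * k (inv\<^bsub>G\<^esub> u \<otimes>\<^bsub>G\<^esub> w) * x (g \<otimes>\<^bsub>H\<^esub> h w)"
    have inner: "f u * hom_rep G H h k x (g \<otimes>\<^bsub>H\<^esub> h u) = infsum (?t u) (carrier G)"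
      if u: "u \<in> carrier G" for u
    proof -
      have "infsum (?t u) (carrier G) = infsum (\<lambda>v. ?t u (u \<otimes>\<^bsub>G\<^esub> v)) (carrier G)"
        by (rule infsum_reindex_bij_betw[symmetric, OF G.left_mult_bij[OF u]])
      also have "\<dots> = infsum (\<lambda>v. f u * (k v * x (g \<otimes>\<^bsub>H\<^esub> h u \<otimes>\<^bsub>H\<^esub> h v))) (carrier G)"
        by (rule infsum_cong) (use g u in \<open>simp add: H.m_assoc mult.assoc flip: G.m_assoc\<close>)
      also have "\<dots> = f u * hom_rep G H h k x (g \<otimes>\<^bsub>H\<^esub> h u)"
        using g u by (simp add: infsum_cmult_right' hom_rep_apply[OF x])
      finally show ?thesis ..
    qed
    have "(\<lambda>(u, w). ?t u w) summable_on carrier G \<times> carrier G"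
    proof (rule abs_summable_summable, rule summable_on_comparison_test)
      show "(\<lambda>p. (case p of (u, w) \<Rightarrow> cmod (f u * k (inv\<^bsub>G\<^esub> u \<otimes>\<^bsub>G\<^esub> w))) * l2_norm H x)
          summable_on carrier G \<times> carrier G"
        by (intro summable_on_cmult_left G.conv_abs_summable f k)
      show "norm (case p of (u, w) \<Rightarrow> ?t u w)
          \<le> (case p of (u, w) \<Rightarrow> cmod (f u * k (inv\<^bsub>G\<^esub> u \<otimes>\<^bsub>G\<^esub> w))) * l2_norm H x" for p
      proof (cases p)
        case (Pair u w)
        then show ?thesis
          by (simp only: prod.case norm_mult) (intro mult_left_mono cmod_le_l2_norm x, auto)
      qed
    qed auto
    then have swap: "infsum (\<lambda>u. infsum (?t u) (carrier G)) (carrier G)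
        = infsum (\<lambda>w. infsum (\<lambda>u. ?t u w) (carrier G)) (carrier G)"
      by (rule infsum_swap_banach)
    have "hom_rep G H h f (hom_rep G H h k x) g
        = infsum (\<lambda>u. f u * hom_rep G H h k x (g \<otimes>\<^bsub>H\<^esub> h u)) (carrier G)"
      by (rule hom_rep_apply[OF hom_rep_bound(1)[OF k x] g])
    also have "\<dots> = infsum (\<lambda>u. infsum (?t u) (carrier G)) (carrier G)"
      by (rule infsum_cong) (rule inner)
    also have "\<dots> = infsum (\<lambda>w. conv G f k w * x (g \<otimes>\<^bsub>H\<^esub> h w)) (carrier G)"
      unfolding swap by (rule infsum_cong) (simp add: conv_def infsum_cmult_left')
    also have "\<dots> = hom_rep G H h (conv G f k) x g" by (rule hom_rep_apply[OF x g, symmetric])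
    finally show ?thesis ..
  qed
  then show "hom_rep G H h (conv G f k) x = (hom_rep G H h f \<otimes>\<^bsub>vN H\<^esub> hom_rep G H h k) x"
    using x hom_rep_bound(1)[OF k x] by (auto simp: fun_eq_iff hom_rep_def)
qed (intro hom_rep_closed G.conv_closed H.vN_mult_closed f k)+

text \<open>Pairs \<open>f\<close> with the matrix coefficients of the translations, a form in which
  the two sides of the adjoint identity can be compared. Cauchy-Schwarz for each translate justifies
  the interchange of sums.\<close>

lemma hom_rep_inner:
  assumes f: "f \<in> Lp 1 G" and x: "x \<in> Lp 2 H" and y: "y \<in> Lp 2 H"
  shows "l2_inner H (hom_rep G H h f x) y
    = infsum (\<lambda>w. f w * infsum (\<lambda>g. x (g \<otimes>\<^bsub>H\<^esub> h w) * cnj (y g)) (carrier H)) (carrier G)"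
proof -
  let ?t = "\<lambda>w g. f w * (x (g \<otimes>\<^bsub>H\<^esub> h w) * cnj (y g))"
  let ?U = "\<lambda>w g. if g \<in> carrier H then x (g \<otimes>\<^bsub>H\<^esub> h w) else 0"
  have "(\<lambda>(w, g). ?t w g) summable_on carrier G \<times> carrier H"
  proof (rule abs_summable_summable)
    have "(\<lambda>w. infsum (\<lambda>g. cmod (?t w g)) (carrier H)) summable_on carrier G"
    proof (rule summable_on_comparison_test)
      show "(\<lambda>w. cmod (f w) * (l2_norm H x * l2_norm H y)) summable_on carrier G"
        by (intro summable_on_cmult_left l1_summable f)
      fix w assume w: "w \<in> carrier G"
      have hw: "h w \<in> carrier H" using w by simp
      have "infsum (\<lambda>g. cmod (?t w g)) (carrier H) = cmod (f w) * infsum (\<lambda>g. cmod (?U w g * cnj (y g))) (carrier H)"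
        by (simp add: norm_mult infsum_cmult_right' cong: infsum_cong)
      also have "\<dots> \<le> cmod (f w) * (l2_norm H x * l2_norm H y)"
        using l2_prod_summable(2)[OF H.right_shift_l2(1)[OF hw x] y] H.right_shift_l2(2)[OF hw x]
        by (intro mult_left_mono) auto
      finally show "infsum (\<lambda>g. cmod (?t w g)) (carrier H) \<le> cmod (f w) * (l2_norm H x * l2_norm H y)" .
    qed (simp add: infsum_nonneg)
    then show "(\<lambda>p. norm (case p of (w, g) \<Rightarrow> ?t w g)) summable_on carrier G \<times> carrier H"
    proof (intro summable_on_SigmaI[where g = "\<lambda>w. infsum (\<lambda>g. cmod (?t w g)) (carrier H)"])
      fix w assume w: "w \<in> carrier G"
      have hw: "h w \<in> carrier H" using w by simp
      have "(\<lambda>g. cmod (f w) * cmod (?U w g * cnj (y g))) summable_on carrier H"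
        by (intro summable_on_cmult_right l2_prod_summable H.right_shift_l2 hw x y)
      then have "(\<lambda>g. cmod (?t w g)) summable_on carrier H"
        by (simp add: norm_mult cong: summable_on_cong)
      then show "((\<lambda>g. norm (case (w, g) of (w, g) \<Rightarrow> ?t w g)) has_sum infsum (\<lambda>g. cmod (?t w g)) (carrier H))
          (carrier H)" by simp
    qed auto
  qed
  then have swap: "infsum (\<lambda>w. infsum (?t w) (carrier H)) (carrier G)
      = infsum (\<lambda>g. infsum (\<lambda>w. ?t w g) (carrier G)) (carrier H)"
    by (rule infsum_swap_banach)
  have "l2_inner H (hom_rep G H h f x) y = infsum (\<lambda>g. infsum (\<lambda>w. ?t w g) (carrier G)) (carrier H)"
    unfolding l2_inner_def
    by (rule infsum_cong) (simp add: hom_rep_apply[OF x] infsum_cmult_left' flip: mult.assoc)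
  then show ?thesis by (simp add: swap[symmetric] infsum_cmult_right')
qed

text \<open>Two substitutions: replacing \<open>g\<close> by \<open>g h(w)\<close> shows that
  exchanging \<open>x\<close> and \<open>y\<close> and inverting \<open>w\<close> conjugates the
  matrix coefficient, and replacing \<open>w\<close> by its inverse matches
  \<open>l1_star\<close>.\<close>

lemma hom_rep_adjoint:
  assumes f: "f \<in> Lp 1 G" and x: "x \<in> Lp 2 H" and y: "y \<in> Lp 2 H"
  shows "l2_inner H (hom_rep G H h f x) y = l2_inner H x (hom_rep G H h (l1_star G f) y)"
proof -
  let ?c = "\<lambda>x y w. infsum (\<lambda>g. x (g \<otimes>\<^bsub>H\<^esub> h w) * cnj (y g)) (carrier H)"
  have c: "cnj (?c y x (inv\<^bsub>G\<^esub> w)) = ?c x y w" if w: "w \<in> carrier G" for w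
  proof -
    have hw: "h w \<in> carrier H" using w by simp
    have "?c y x (inv\<^bsub>G\<^esub> w) = infsum (\<lambda>g. y (g \<otimes>\<^bsub>H\<^esub> h w \<otimes>\<^bsub>H\<^esub> h (inv\<^bsub>G\<^esub> w)) * cnj (x (g \<otimes>\<^bsub>H\<^esub> h w))) (carrier H)"
      by (rule infsum_reindex_bij_betw[symmetric, OF H.right_mult_bij[OF hw]])
    also have "\<dots> = infsum (\<lambda>g. cnj (x (g \<otimes>\<^bsub>H\<^esub> h w) * cnj (y g))) (carrier H)"
      by (rule infsum_cong) (use w in \<open>simp add: H.m_assoc\<close>)
    also have "\<dots> = cnj (?c x y w)" by (rule infsum_cnj)
    finally show ?thesis by simp
  qed
  have "l2_inner H x (hom_rep G H h (l1_star G f) y) = cnj (infsum (\<lambda>w. l1_star G f w * ?c y x w) (carrier G))"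
    by (subst l2_inner_commute) (simp only: hom_rep_inner[OF G.l1_star_closed(1)[OF f] y x])
  also have "infsum (\<lambda>w. l1_star G f w * ?c y x w) (carrier G)
      = infsum (\<lambda>w. l1_star G f (inv\<^bsub>G\<^esub> w) * ?c y x (inv\<^bsub>G\<^esub> w)) (carrier G)"
    by (rule infsum_reindex_bij_betw[symmetric, OF G.inv_bij])
  also have "cnj \<dots> = infsum (\<lambda>w. cnj (l1_star G f (inv\<^bsub>G\<^esub> w) * ?c y x (inv\<^bsub>G\<^esub> w))) (carrier G)"
    by (rule infsum_cnj[symmetric])
  also have "\<dots> = infsum (\<lambda>w. f w * ?c x y w) (carrier G)"
  proof (rule infsum_cong)
    fix w assume w: "w \<in> carrier G"
    then have "cnj (l1_star G f (inv\<^bsub>G\<^esub> w)) = f w" by (simp add: l1_star_def)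
    then show "cnj (l1_star G f (inv\<^bsub>G\<^esub> w) * ?c y x (inv\<^bsub>G\<^esub> w)) = f w * ?c x y w"
      by (simp only: complex_cnj_mult c[OF w])
  qed
  also have "\<dots> = l2_inner H (hom_rep G H h f x) y" by (rule hom_rep_inner[OF f x y, symmetric])
  finally show ?thesis ..
qed

lemma hom_rep_trace: "vN_trace H (hom_rep G H h f) = infsum f {w \<in> carrier G. h w = \<one>\<^bsub>H\<^esub>}"
proof -
  have "vN_trace H (hom_rep G H h f) = infsum (\<lambda>w. f w * delta \<one>\<^bsub>H\<^esub> (h w)) (carrier G)"
    by (simp add: H.vN_trace_apply hom_rep_apply H.delta_closed cong: infsum_cong)
  also have "\<dots> = infsum f {w \<in> carrier G. h w = \<one>\<^bsub>H\<^esub>}"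
    by (rule infsum_cong_neutral) (auto simp: delta_def)
  finally show ?thesis .
qed

text \<open>The sum over \<open>carrier G\<close> is cut into the fibres of \<open>h\<close>, on
  each of which the translate of \<open>x\<close> is constant.\<close>

lemma L1_rep_push_forward:
  assumes f: "f \<in> Lp 1 G"
  shows "L1_rep H (push_forward G h f) = hom_rep G H h f"
proof (rule ext)
  fix x
  show "L1_rep H (push_forward G h f) x = hom_rep G H h f x"
  proof (cases "x \<in> Lp 2 H")
    case x: True
    have "infsum (\<lambda>a. push_forward G h f a * right_translate H (inv\<^bsub>H\<^esub> a) x g) (carrier H)
        = hom_rep G H h f x g" for g
    proof (cases "g \<in> carrier H")
      case g: True
      let ?B = "\<lambda>a. {w \<in> carrier G. h w = a}"
      \<comment> \<open>The disjoint union of the fibres projects bijectively onto the group, so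
        Fubini over a \<open>Sigma\<close> set applies.\<close>
      have b: "bij_betw snd (Sigma (carrier H) ?B) (carrier G)"
        by (rule bij_betwI[of _ _ _ "\<lambda>w. (h w, w)"]) auto
      have s: "(\<lambda>w. f w * x (g \<otimes>\<^bsub>H\<^esub> h w)) summable_on carrier G"
        by (rule abs_summable_summable[OF hom_rep_summable[OF f x]])
      have s': "(\<lambda>p. f (snd p) * x (g \<otimes>\<^bsub>H\<^esub> h (snd p))) summable_on Sigma (carrier H) ?B"
        using summable_on_reindex_bij_betw[OF b, of "\<lambda>w. f w * x (g \<otimes>\<^bsub>H\<^esub> h w)"] s by simp
      have "infsum (\<lambda>a. push_forward G h f a * right_translate H (inv\<^bsub>H\<^esub> a) x g) (carrier H)
          = infsum (\<lambda>a. infsum (\<lambda>w. f w * x (g \<otimes>\<^bsub>H\<^esub> h w)) (?B a)) (carrier H)"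
      proof (rule infsum_cong)
        fix a assume a: "a \<in> carrier H"
        have "infsum (\<lambda>w. f w * x (g \<otimes>\<^bsub>H\<^esub> h w)) (?B a) = infsum (\<lambda>w. f w * x (g \<otimes>\<^bsub>H\<^esub> a)) (?B a)"
          by (rule infsum_cong) auto
        then show "push_forward G h f a * right_translate H (inv\<^bsub>H\<^esub> a) x g
            = infsum (\<lambda>w. f w * x (g \<otimes>\<^bsub>H\<^esub> h w)) (?B a)"
          using a g by (simp add: push_forward_def right_translate_def infsum_cmult_left')
      qed
      also have "\<dots> = infsum (\<lambda>p. f (snd p) * x (g \<otimes>\<^bsub>H\<^esub> h (snd p))) (Sigma (carrier H) ?B)"
        using infsum_Sigma_banach[OF s'] by simp
      also have "\<dots> = hom_rep G H h f x g"
        unfolding hom_rep_apply[OF x g] by (rule infsum_reindex_bij_betw[OF b])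
      finally show ?thesis .
    qed (use x in \<open>simp add: right_translate_def hom_rep_def\<close>)
    then show ?thesis using x by (simp add: L1_rep_def)
  qed (simp add: L1_rep_def hom_rep_def)
qed

lemma hom_rep_power:
  assumes f: "f \<in> Lp 1 G" and x: "x \<in> Lp 2 H"
  shows "(hom_rep G H h f ^^ n) x = hom_rep G H h (l1_power G f n) x"
proof (induction n)
  case 0
  then show ?case using x by (simp add: l1_power_def hom_rep_one)
next
  case (Suc n)
  have "l1_power G f (Suc n) = conv G f (l1_power G f n)" by (simp add: l1_power_def)
  then show ?case using Suc x by (simp add: hom_rep_conv[OF f G.l1_power_closed[OF f]])
qed

lemma hom_rep_trace_poly:
  assumes f: "f \<in> Lp 1 G"
  shows "vN_trace H (op_poly H p (hom_rep G H h f))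
    = (\<Sum>i\<le>degree p. of_real (coeff p i) * infsum (l1_power G f i) {w \<in> carrier G. h w = \<one>\<^bsub>H\<^esub>})"
  by (simp add: H.vN_trace_apply op_poly_def H.delta_closed hom_rep_power[OF f] flip: hom_rep_trace)

text \<open>The interval does not depend on \<open>h\<close>, so one polynomial serves all homomorphisms at once.\<close>

lemma hom_rep_fk_det:
  assumes f: "f \<in> Lp 1 G" and k: "k \<in> Lp 1 G"
    and inv: "conv G f k = delta \<one>\<^bsub>G\<^esub>" "conv G k f = delta \<one>\<^bsub>G\<^esub>"
    and e: "e \<ge> 0"
    and l: "\<And>t. t \<in> {(inverse (l1_norm G k + 1))\<^sup>2..(l1_norm G f)\<^sup>2} \<Longrightarrow> \<bar>poly l t - ln t\<bar> \<le> e"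
  shows "\<bar>2 * ln (fk_det H (hom_rep G H h f)) - Re (\<Sum>i\<le>degree l. of_real (coeff l i) *
      infsum (l1_power G (conv G (l1_star G f) f) i) {w \<in> carrier G. h w = \<one>\<^bsub>H\<^esub>})\<bar> \<le> e"
    and "fk_det H (hom_rep G H h f) > 0"
proof -
  let ?A = "hom_rep G H h f" and ?A' = "hom_rep G H h (l1_star G f)"
  note star = G.l1_star_closed[OF f]
  have "?A \<otimes>\<^bsub>vN H\<^esub> hom_rep G H h k = \<one>\<^bsub>vN H\<^esub>" "hom_rep G H h k \<otimes>\<^bsub>vN H\<^esub> ?A = \<one>\<^bsub>vN H\<^esub>"
    by (simp_all only: hom_rep_conv[OF f k, symmetric] hom_rep_conv[OF k f, symmetric] inv hom_rep_one vN_one)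
  \<comment> \<open>\<open>fk_det\<close> takes its invertible branch here, so the limit over
    \<open>\<epsilon>\<close> does not arise.\<close>
  then have "?A \<in> Units (vN H)" using hom_rep_closed[OF f] hom_rep_closed[OF k] by (auto simp: Units_def)
  then have det: "fk_det H ?A = fk_det_inv H ?A" by (simp add: fk_det_def)
  then show "fk_det H ?A > 0" by (simp add: fk_det_inv_def)
  have "\<bar>2 * ln (fk_det_inv H ?A) - Re (vN_trace H (op_poly H l (?A' \<otimes>\<^bsub>vN H\<^esub> ?A)))\<bar> \<le> e"
  proof (rule H.fk_det_inv_approx[OF hom_rep_closed[OF f] hom_rep_closed[OF star(1)] hom_rep_adjoint[OF f]
        _ _ l1_norm_nonneg hom_rep_bound(2)[OF f] _ e l])
    \<comment> \<open>\<open>+ 1\<close> makes this positive at once, at the price of a slightly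
      smaller lower bound.\<close>
    show "0 < inverse (l1_norm G k + 1)" by (simp add: add_nonneg_pos)
    show "l2_norm H (?A' x) \<le> l1_norm G f * l2_norm H x" if "x \<in> Lp 2 H" for x
      using hom_rep_bound(2)[OF star(1) that] star(2) by simp
    show "inverse (l1_norm G k + 1) * l2_norm H x \<le> l2_norm H (?A x)" if x: "x \<in> Lp 2 H" for x
    proof -
      have "hom_rep G H h k (?A x) = x"
        using fun_cong[OF \<open>hom_rep G H h k \<otimes>\<^bsub>vN H\<^esub> ?A = \<one>\<^bsub>vN H\<^esub>\<close>, of x] x by (simp add: vN_one)
      then have "l2_norm H x \<le> l1_norm G k * l2_norm H (?A x)"
        using hom_rep_bound(2)[OF k hom_rep_bound(1)[OF f x]] by simp
      also have "\<dots> \<le> (l1_norm G k + 1) * l2_norm H (?A x)" by (intro mult_right_mono) auto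
      finally show ?thesis
        by (simp add: inverse_eq_divide pos_divide_le_eq add_nonneg_pos mult.commute)
    qed
  qed
  also have "?A' \<otimes>\<^bsub>vN H\<^esub> ?A = hom_rep G H h (conv G (l1_star G f) f)"
    by (rule hom_rep_conv[OF star(1) f, symmetric])
  finally show "\<bar>2 * ln (fk_det H ?A) - Re (\<Sum>i\<le>degree l. of_real (coeff l i) *
      infsum (l1_power G (conv G (l1_star G f) f) i) {w \<in> carrier G. h w = \<one>\<^bsub>H\<^esub>})\<bar> \<le> e"
    by (simp only: hom_rep_trace_poly[OF G.conv_closed[OF star(1) f]] det)
qed

end

section \<open>Continuity on the space of marked groups\<close>

text \<open>The trace, reduced to the relations of the marking: it sees \<open>p\<close> only
  through the reduced words that evaluate to the identity.\<close>

definition kernel_sum :: "nat \<Rightarrow> 'a monoid \<times> 'a list \<Rightarrow> (letter list \<Rightarrow> complex) \<Rightarrow> complex" where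
  "kernel_sum d p f = infsum f {w \<in> carrier (free_group d). word_eval (fst p) (snd p) w = \<one>\<^bsub>fst p\<^esub>}"

text \<open>Continuity expressed on representatives and through balls, so that estimates involve
  neither the quotient nor the choice in \<open>class_dist\<close>. It also forces invariance under
  marked isomorphism.\<close>

definition ball_continuous :: "nat \<Rightarrow> ('a monoid \<times> 'a list \<Rightarrow> 'b::metric_space) \<Rightarrow> bool" where
  "ball_continuous d F \<longleftrightarrow> (\<forall>p\<in>marked_groups d. \<forall>e>0. \<exists>n. \<forall>q\<in>marked_groups d.
     ball_iso n p q \<longrightarrow> dist (F q) (F p) < e)"

lemma group_hom_marking:
  assumes "(\<Gamma>, S) \<in> marked_groups d"
  shows "group_hom (free_group d) \<Gamma> (word_eval \<Gamma> S)"
proof -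
  have S: "group \<Gamma>" "set S \<subseteq> carrier \<Gamma>" "length S = d" using marked_groupsD[OF assms] by simp_all
  then show ?thesis
    using group.word_eval_hom[OF S(1,2)] group_free_group[of d]
    by (simp add: group_hom_def group_hom_axioms_def)
qed

lemma trace_marking_push:
  assumes "(\<Gamma>, S) \<in> marked_groups d" "f \<in> Lp 1 (free_group d)"
  shows "vN_trace \<Gamma> (L1_rep \<Gamma> (marking_push \<Gamma> S f)) = kernel_sum d (\<Gamma>, S) f"
proof -
  interpret group_hom "free_group d" \<Gamma> "word_eval \<Gamma> S" by (rule group_hom_marking[OF assms(1)])
  have "length S = d" using marked_groupsD[OF assms(1)] by simp
  then show ?thesis
    by (simp only: marking_push_def L1_rep_push_forward[OF assms(2)] hom_rep_trace kernel_sum_def fst_conv snd_conv)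
qed

section \<open>Descent to isomorphism classes\<close>

lemma marked_class_iff:
  assumes p: "(\<Gamma>, S) \<in> marked_groups d"
  shows "q \<in> marked_class \<Gamma> S \<longleftrightarrow> q \<in> marked_groups d \<and> marked_isomorphic (\<Gamma>, S) q"
  using p marked_groupsD(3)[OF p] by (auto simp: marked_class_def marked_rel_def)

lemma marked_class_in_space:
  assumes p: "(\<Gamma>, S) \<in> marked_groups d"
  shows "marked_class \<Gamma> S \<in> marked_space d" "(\<Gamma>, S) \<in> marked_class \<Gamma> S"
proof -
  have d: "length S = d" using marked_groupsD(3)[OF p] by simp
  show "marked_class \<Gamma> S \<in> marked_space d"
    unfolding marked_class_def marked_space_def d by (rule quotientI[OF p])
  show "(\<Gamma>, S) \<in> marked_class \<Gamma> S"
    unfolding marked_class_def d by (rule equiv_class_self[OF equiv_marked_rel p])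
qed

text \<open>Balls of every radius are isomorphic, so the two values are closer than any positive
  number; if they differed, their own distance would be such a number.\<close>

lemma ball_continuous_isomorphic:
  assumes F: "ball_continuous d F" and p: "p \<in> marked_groups d" and q: "q \<in> marked_groups d"
    and iso: "marked_isomorphic p q"
  shows "F q = F p"
proof (rule ccontr)
  assume "F q \<noteq> F p"
  then have "dist (F q) (F p) > 0" by simp
  then obtain n where n: "\<forall>r\<in>marked_groups d. ball_iso n p r \<longrightarrow> dist (F r) (F p) < dist (F q) (F p)"
    using F p unfolding ball_continuous_def by meson
  have "dist (F q) (F p) < dist (F q) (F p)"
    by (rule n[rule_format, OF q marked_isomorphic_ball_iso[OF p q iso]])
  then show False by simp
qed

text \<open>Invariance makes the image of a class a singleton, which is what gives
  \<open>the_elem\<close> a meaning.\<close>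

lemma the_elem_marked_class:
  assumes F: "ball_continuous d F" and p: "(\<Gamma>, S) \<in> marked_groups d"
  shows "the_elem (F ` marked_class \<Gamma> S) = F (\<Gamma>, S)"
proof -
  have const: "F q = F (\<Gamma>, S)" if "q \<in> marked_class \<Gamma> S" for q
  proof -
    have "q \<in> marked_groups d \<and> marked_isomorphic (\<Gamma>, S) q"
      using that unfolding marked_class_iff[OF p] .
    then show ?thesis by (intro ball_continuous_isomorphic[OF F p]) simp_all
  qed
  have "F ` marked_class \<Gamma> S = (\<lambda>_. F (\<Gamma>, S)) ` marked_class \<Gamma> S"
    by (rule image_cong[OF refl const])
  also have "\<dots> = {F (\<Gamma>, S)}" by (rule image_constant[OF marked_class_in_space(2)[OF p]])
  finally show ?thesis by simp
qed

lemma marked_space_cases: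
  assumes "c \<in> marked_space d"
  obtains \<Gamma> S where "(\<Gamma>, S) \<in> marked_groups d" "c = marked_class \<Gamma> S"
proof -
  obtain p where p: "p \<in> marked_groups d" "c = marked_rel d `` {p}"
    using assms unfolding marked_space_def by (rule quotientE)
  then show ?thesis using that[of "fst p" "snd p"] marked_groupsD(3)[OF p(1)]
    by (simp add: marked_class_def)
qed

lemma continuous_map_marked_top:
  fixes F :: "'a monoid \<times> 'a list \<Rightarrow> 'b::metric_space"
  assumes F: "ball_continuous d F"
  shows "continuous_map (marked_top d) euclidean (\<lambda>c. the_elem (F ` c))"
proof -
  interpret Metric_space "marked_space d :: ('a monoid \<times> 'a list) set set" class_dist
    by (rule Metric_space_marked_space)
  have "openin mtopology {c \<in> marked_space d. the_elem (F ` c) \<in> U}" if U: "open U" for U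
    unfolding openin_mtopology
  proof (intro conjI allI impI subsetI)
    fix c assume "c \<in> {c \<in> marked_space d. the_elem (F ` c) \<in> U}"
    then have c: "c \<in> marked_space d" "the_elem (F ` c) \<in> U" by auto
    obtain \<Gamma> S where p: "(\<Gamma>, S) \<in> marked_groups d" "c = marked_class \<Gamma> S"
      using c(1) by (rule marked_space_cases)
    have FU: "F (\<Gamma>, S) \<in> U" using c(2) the_elem_marked_class[OF F p(1)] p(2) by simp
    then obtain e where e: "e > 0" "\<And>y. dist y (F (\<Gamma>, S)) < e \<Longrightarrow> y \<in> U"
      using U open_dist by blast
    then obtain n where n: "\<And>q. q \<in> marked_groups d \<Longrightarrow> ball_iso n (\<Gamma>, S) q \<Longrightarrow> dist (F q) (F (\<Gamma>, S)) < e"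
      using F p(1) unfolding ball_continuous_def by blast
    \<comment> \<open>\<open>Suc n\<close>, because ball isomorphism can be read off the distance
      only for positive exponents: all distances are at most 1, even when the balls of radius 0
      differ.\<close>
    have "mball c ((1/2) ^ Suc n) \<subseteq> {c \<in> marked_space d. the_elem (F ` c) \<in> U}"
    proof
      fix c' assume "c' \<in> mball c ((1/2) ^ Suc n)"
      then have c': "c' \<in> marked_space d" "class_dist c c' < (1/2) ^ Suc n" by (auto simp: in_mball)
      obtain \<Gamma>' S' where q: "(\<Gamma>', S') \<in> marked_groups d" "c' = marked_class \<Gamma>' S'"
        using c'(1) by (rule marked_space_cases)
      have "class_dist c c' = marked_dist (\<Gamma>, S) (\<Gamma>', S')"
        using class_dist_eq[OF c(1) c'(1)] marked_class_in_space(2)[OF p(1)]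
          marked_class_in_space(2)[OF q(1)] p(2) q(2) by blast
      then have "ball_iso (Suc n) (\<Gamma>, S) (\<Gamma>', S')"
        using c'(2) marked_dist_le_iff[OF p(1) q(1), of "Suc n"] by simp
      then have "ball_iso n (\<Gamma>, S) (\<Gamma>', S')" using ball_iso_mono[OF p(1) q(1)] by simp
      then have "F (\<Gamma>', S') \<in> U" using n[OF q(1)] e(2) by blast
      then show "c' \<in> {c \<in> marked_space d. the_elem (F ` c) \<in> U}"
        using c'(1) the_elem_marked_class[OF F q(1)] q(2) by simp
    qed
    then show "\<exists>r>0. mball c r \<subseteq> {c \<in> marked_space d. the_elem (F ` c) \<in> U}"
      by (intro exI[of _ "(1/2) ^ Suc n"]) simp
  qed simp
  then show ?thesis by (simp add: continuous_map_def marked_top_def)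
qed

text \<open>The isomorphism of balls carries the value of \<open>w\<close> to the value of
  \<open>w\<close> and the identity to the identity, and it is injective on a ball containing
  both.\<close>

lemma word_eval_one_ball_iso:
  assumes p: "p \<in> marked_groups d" and q: "q \<in> marked_groups d" and iso: "ball_iso n p q"
    and w: "fst ` set w \<subseteq> {..<d}" "length w \<le> n"
  shows "word_eval (fst p) (snd p) w = \<one>\<^bsub>fst p\<^esub> \<longleftrightarrow> word_eval (fst q) (snd q) w = \<one>\<^bsub>fst q\<^esub>"
proof -
  obtain \<psi> where \<psi>: "bij_betw \<psi> (cayley_ball p n) (cayley_ball q n)" "\<psi> \<one>\<^bsub>fst p\<^esub> = \<one>\<^bsub>fst q\<^esub>"
      "\<forall>w. fst ` set w \<subseteq> {..<d} \<and> length w \<le> n \<longrightarrow>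
        \<psi> (word_eval (fst p) (snd p) w) = word_eval (fst q) (snd q) w"
    using ball_iso_word_evalD[OF p q iso] by blast
  have len: "length (snd p) = d" using marked_groupsD[OF p] by simp
  have "word_eval (fst p) (snd p) w \<in> cayley_ball p n" using w len by (auto simp: cayley_ball_def)
  moreover have "\<one>\<^bsub>fst p\<^esub> \<in> cayley_ball p n"
    by (auto simp: cayley_ball_def word_eval_def intro!: exI[of _ "[]"])
  ultimately have "word_eval (fst p) (snd p) w = \<one>\<^bsub>fst p\<^esub> \<longleftrightarrow>
      \<psi> (word_eval (fst p) (snd p) w) = \<psi> \<one>\<^bsub>fst p\<^esub>"
    using \<psi>(1) by (auto simp: bij_betw_def inj_on_eq_iff)
  then show ?thesis using \<psi>(2,3) w by simp
qed

lemma ball_continuous_kernel_sum: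
  assumes f: "f \<in> Lp 1 (free_group d)"
  shows "ball_continuous d (\<lambda>p :: 'a monoid \<times> 'a list. kernel_sum d p f)"
  unfolding ball_continuous_def
proof (intro ballI allI impI)
  fix p :: "'a monoid \<times> 'a list" and e :: real
  assume p: "p \<in> marked_groups d" and e: "e > 0"
  let ?F = "carrier (free_group d)"
  let ?K = "\<lambda>p :: 'a monoid \<times> 'a list. {w \<in> ?F. word_eval (fst p) (snd p) w = \<one>\<^bsub>fst p\<^esub>}"
  have s: "(\<lambda>w. cmod (f w)) summable_on ?F" by (rule l1_summable[OF f])
  have sA: "f summable_on A" "(\<lambda>w. cmod (f w)) summable_on A" if "A \<subseteq> ?F" for A
    using summable_on_subset[OF s that] by (auto intro: abs_summable_summable)
  obtain W where W: "finite W" "W \<subseteq> ?F" "infsum (\<lambda>w. cmod (f w)) (?F - W) < e / 2"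
  proof -
    have "((\<lambda>w. cmod (f w)) has_sum infsum (\<lambda>w. cmod (f w)) ?F) ?F" using s by simp
    then have "\<forall>\<^sub>F W in finite_subsets_at_top ?F.
        dist (\<Sum>w\<in>W. cmod (f w)) (infsum (\<lambda>w. cmod (f w)) ?F) < e / 2"
      unfolding has_sum_def using e by (intro tendstoD) auto
    then obtain W where W: "finite W" "W \<subseteq> ?F"
        "dist (\<Sum>w\<in>W. cmod (f w)) (infsum (\<lambda>w. cmod (f w)) ?F) < e / 2"
      unfolding eventually_finite_subsets_at_top by blast
    have "infsum (\<lambda>w. cmod (f w)) (?F - W) = infsum (\<lambda>w. cmod (f w)) ?F - (\<Sum>w\<in>W. cmod (f w))"
      using infsum_Diff[OF s sA(2)[OF W(2)] W(2)] W(1) by simp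
    then show ?thesis using that[OF W(1,2)] W(3) by (simp add: dist_real_def abs_if split: if_splits)
  qed
  \<comment> \<open>\<open>W\<close>, and with it \<open>n\<close>, depends only on \<open>f\<close>
    and \<open>e\<close>; the same tail bound therefore serves both markings.\<close>
  obtain n where n: "\<And>w. w \<in> W \<Longrightarrow> length w \<le> n"
    using finite_nat_set_iff_bounded_le[of "length ` W"] W(1) by auto
  have split: "kernel_sum d q f = infsum f (?K q \<inter> W) + infsum f (?K q - W)" for q :: "'a monoid \<times> 'a list"
    unfolding kernel_sum_def
    by (subst infsum_Un_disjoint[symmetric]) (auto intro!: sA simp: Int_Diff_Un)
  have tail: "cmod (infsum f (?K q - W)) < e / 2" for q :: "'a monoid \<times> 'a list"
  proof -
    have "cmod (infsum f (?K q - W)) \<le> infsum (\<lambda>w. cmod (f w)) (?K q - W)"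
      by (rule norm_infsum_bound) (rule sA, blast)
    also have "\<dots> \<le> infsum (\<lambda>w. cmod (f w)) (?F - W)"
      by (rule infsum_mono_neutral) (auto intro!: sA)
    finally show ?thesis using W(3) by simp
  qed
  have near: "dist (kernel_sum d q f) (kernel_sum d p f) < e"
    if q: "q \<in> marked_groups d" and iso: "ball_iso n p q" for q :: "'a monoid \<times> 'a list"
  proof -
    have "?K q \<inter> W = ?K p \<inter> W"
      using word_eval_one_ball_iso[OF p q iso] n by (auto simp: free_group_def red_words_def)
    then have "kernel_sum d q f - kernel_sum d p f = infsum f (?K q - W) - infsum f (?K p - W)"
      by (simp add: split)
    then show ?thesis
      using tail[of q] tail[of p] norm_triangle_ineq4[of "infsum f (?K q - W)" "infsum f (?K p - W)"]
      by (simp add: dist_norm)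
  qed
  show "\<exists>n. \<forall>q\<in>marked_groups d :: ('a monoid \<times> 'a list) set.
      ball_iso n p q \<longrightarrow> dist (kernel_sum d q f) (kernel_sum d p f) < e"
    by (intro exI[of _ n] ballI impI near)
qed

section \<open>Closure properties of \<open>ball_continuous\<close>, and the determinant\<close>

lemma ball_continuous_compose:
  fixes F :: "'a monoid \<times> 'a list \<Rightarrow> 'b::metric_space"
  assumes F: "ball_continuous d F" and g: "\<And>y. isCont g y"
  shows "ball_continuous d (\<lambda>p. g (F p))"
  unfolding ball_continuous_def
proof (intro ballI allI impI)
  fix p :: "'a monoid \<times> 'a list" and e :: real
  assume p: "p \<in> marked_groups d" and e: "e > 0"
  obtain r where "r > 0" "\<And>y. dist y (F p) < r \<Longrightarrow> dist (g y) (g (F p)) < e"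
    using g[of "F p"] e unfolding continuous_at_eps_delta by blast
  then show "\<exists>n. \<forall>q\<in>marked_groups d. ball_iso n p q \<longrightarrow> dist (g (F q)) (g (F p)) < e"
    using F p unfolding ball_continuous_def by meson
qed

lemma ball_continuous_add:
  fixes F F' :: "'a monoid \<times> 'a list \<Rightarrow> 'b::real_normed_vector"
  assumes F: "ball_continuous d F" and F': "ball_continuous d F'"
  shows "ball_continuous d (\<lambda>p. F p + F' p)"
  unfolding ball_continuous_def
proof (intro ballI allI impI)
  fix p :: "'a monoid \<times> 'a list" and e :: real
  assume p: "p \<in> marked_groups d" and "e > 0"
  then have e: "e / 2 > 0" by simp
  obtain m where m: "\<forall>q\<in>marked_groups d. ball_iso m p q \<longrightarrow> dist (F q) (F p) < e / 2"
    using F p e unfolding ball_continuous_def by blast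
  obtain n where n: "\<forall>q\<in>marked_groups d. ball_iso n p q \<longrightarrow> dist (F' q) (F' p) < e / 2"
    using F' p e unfolding ball_continuous_def by blast
  have "dist (F q + F' q) (F p + F' p) < e"
    if q: "q \<in> marked_groups d" and iso: "ball_iso (max m n) p q" for q
  proof -
    have "ball_iso m p q" "ball_iso n p q" using ball_iso_mono[OF p q iso] by simp_all
    then have "dist (F q) (F p) < e / 2" "dist (F' q) (F' p) < e / 2" using m n q by auto
    then show ?thesis using dist_triangle_add[of "F q" "F' q" "F p" "F' p"] by linarith
  qed
  then show "\<exists>n. \<forall>q\<in>marked_groups d. ball_iso n p q \<longrightarrow> dist (F q + F' q) (F p + F' p) < e"
    by blast
qed

lemma ball_continuous_sum:
  fixes F :: "'i \<Rightarrow> 'a monoid \<times> 'a list \<Rightarrow> 'b::real_normed_vector"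
  assumes "\<And>i. i \<in> I \<Longrightarrow> ball_continuous d (F i)"
  shows "ball_continuous d (\<lambda>p. \<Sum>i\<in>I. F i p)"
  using assms
proof (induction I rule: infinite_finite_induct)
  case (insert i I)
  then show ?case by (simp add: ball_continuous_add)
qed (auto simp: ball_continuous_def)

text \<open>The logarithm comes before the determinant because the estimate of
  \<open>hom_rep_fk_det\<close> is additive. Positivity is recorded alongside, since
  \<open>exp (ln x) = x\<close> will need it.\<close>

lemma ball_continuous_ln_fk_det:
  fixes \<Gamma> :: "'a monoid"
  assumes f: "f \<in> Units (L1_algebra (free_group d))"
  shows "ball_continuous d (\<lambda>(\<Gamma> :: 'a monoid, S). ln (fk_det \<Gamma> (L1_rep \<Gamma> (marking_push \<Gamma> S f))))"
    and "(\<Gamma>, S) \<in> marked_groups d \<Longrightarrow> fk_det \<Gamma> (L1_rep \<Gamma> (marking_push \<Gamma> S f)) > 0"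
proof -
  let ?F = "free_group d"
  interpret F: group ?F by (rule group_free_group)
  obtain k where k: "f \<in> Lp 1 ?F" "k \<in> Lp 1 ?F" "conv ?F f k = delta \<one>\<^bsub>?F\<^esub>" "conv ?F k f = delta \<one>\<^bsub>?F\<^esub>"
    using f unfolding Units_def L1_algebra_def by auto
  let ?a = "(inverse (l1_norm ?F k + 1))\<^sup>2" and ?b = "(l1_norm ?F f)\<^sup>2"
  let ?V = "\<lambda>(\<Gamma> :: 'a monoid, S). ln (fk_det \<Gamma> (L1_rep \<Gamma> (marking_push \<Gamma> S f)))"
  let ?k = "\<lambda>i. l1_power ?F (conv ?F (l1_star ?F f) f) i"
  let ?Q = "\<lambda>l (p :: 'a monoid \<times> 'a list). Re (\<Sum>i\<le>degree l. of_real (coeff l i) * kernel_sum d p (?k i))"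
  have main: "\<bar>2 * ?V p - ?Q l p\<bar> \<le> e" "fk_det (fst p) (L1_rep (fst p) (marking_push (fst p) (snd p) f)) > 0"
    if p: "p \<in> marked_groups d" and e: "e \<ge> 0" and l: "\<And>t. t \<in> {?a..?b} \<Longrightarrow> \<bar>poly l t - ln t\<bar> \<le> e"
    for p :: "'a monoid \<times> 'a list" and e l
  proof -
    obtain \<Gamma> S where [simp]: "p = (\<Gamma>, S)" by (cases p)
    interpret group_hom ?F \<Gamma> "word_eval \<Gamma> S" using group_hom_marking p by simp
    have "length S = d" using marked_groupsD[OF p] by simp
    then have "L1_rep \<Gamma> (marking_push \<Gamma> S f) = hom_rep ?F \<Gamma> (word_eval \<Gamma> S) f"
      by (simp only: marking_push_def L1_rep_push_forward[OF k(1)])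
    then show "\<bar>2 * ?V p - ?Q l p\<bar> \<le> e" "fk_det (fst p) (L1_rep (fst p) (marking_push (fst p) (snd p) f)) > 0"
      using hom_rep_fk_det[OF k(1,2) k(3,4) e l] by (simp_all add: kernel_sum_def)
  qed
  have "l1_norm ?F k + 1 > 0" by (simp add: add_nonneg_pos)
  then have a_pos: "?a > 0" by simp
  have "continuous_on {?a..?b} ln"
    using a_pos by (intro continuous_on_ln continuous_on_id) auto
  then obtain l :: "nat \<Rightarrow> real poly" where l: "uniform_limit {?a..?b} (\<lambda>n. poly (l n)) ln sequentially"
    using Weierstrass_poly by blast
  have approx: "\<exists>l. \<forall>t\<in>{?a..?b}. \<bar>poly l t - ln t\<bar> \<le> e" if "e > 0" for e
  proof -
    have "\<forall>\<^sub>F n in sequentially. \<forall>t\<in>{?a..?b}. dist (poly (l n) t) (ln t) < e"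
      by (rule uniform_limitD[OF l that])
    then obtain n where "\<forall>t\<in>{?a..?b}. dist (poly (l n) t) (ln t) < e"
      using eventually_happens by fastforce
    then show ?thesis by (intro exI[of _ "l n"]) (auto simp: dist_real_def less_imp_le)
  qed
  show "fk_det \<Gamma> (L1_rep \<Gamma> (marking_push \<Gamma> S f)) > 0" if p: "(\<Gamma>, S) \<in> marked_groups d"
  proof -
    \<comment> \<open>Positivity is bundled with the estimate \<open>main\<close>, whose hypothesis
      asks for an approximating polynomial; accuracy 1 is enough.\<close>
    obtain l where "\<forall>t\<in>{?a..?b}. \<bar>poly l t - ln t\<bar> \<le> 1" using approx[of 1] by auto
    then show ?thesis using main(2)[OF p, of 1 l] by simp
  qed
  show "ball_continuous d ?V"
    unfolding ball_continuous_def
  proof (intro ballI allI impI)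
    fix p :: "'a monoid \<times> 'a list" and e :: real
    assume p: "p \<in> marked_groups d" and "e > 0"
    then have e: "e / 2 > 0" by simp
    obtain l where l: "\<And>t. t \<in> {?a..?b} \<Longrightarrow> \<bar>poly l t - ln t\<bar> \<le> e / 2" using approx[OF e] by blast
    have "ball_continuous d (\<lambda>p :: 'a monoid \<times> 'a list. \<Sum>i\<le>degree l. of_real (coeff l i) * kernel_sum d p (?k i))"
    proof (rule ball_continuous_sum)
      fix i
      have "ball_continuous d (\<lambda>p :: 'a monoid \<times> 'a list. kernel_sum d p (?k i))"
        by (intro ball_continuous_kernel_sum F.l1_power_closed F.conv_closed F.l1_star_closed k)
      then show "ball_continuous d (\<lambda>p :: 'a monoid \<times> 'a list. of_real (coeff l i) * kernel_sum d p (?k i))"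
        by (rule ball_continuous_compose[where g = "\<lambda>y. of_real (coeff l i) * y"]) (intro continuous_intros)
    qed
    then have "ball_continuous d (?Q l)"
      by (rule ball_continuous_compose) (rule continuous_Re[OF continuous_ident])
    then obtain n where n: "\<forall>q\<in>marked_groups d. ball_iso n p q \<longrightarrow> dist (?Q l q) (?Q l p) < e / 2"
      using p e unfolding ball_continuous_def by blast
    have near: "dist (?V q) (?V p) < e" if q: "q \<in> marked_groups d" and iso: "ball_iso n p q"
      for q :: "'a monoid \<times> 'a list"
    proof -
      have "\<bar>?Q l q - ?Q l p\<bar> < e / 2" using n q iso by (simp only: dist_real_def)
      moreover have "\<bar>2 * ?V q - ?Q l q\<bar> \<le> e / 2" "\<bar>2 * ?V p - ?Q l p\<bar> \<le> e / 2"
        using main(1)[OF q _ l] main(1)[OF p _ l] e by simp_all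
      \<comment> \<open>Three errors of at most \<open>e / 2\<close> bound
        \<open>2 * |?V q - ?V p|\<close>, so the difference is below \<open>3/4 * e\<close>.\<close>
      ultimately have "\<bar>?V q - ?V p\<bar> < e" by argo
      then show ?thesis by (simp only: dist_real_def)
    qed
    show "\<exists>n. \<forall>q\<in>marked_groups d. ball_iso n p q \<longrightarrow> dist (?V q) (?V p) < e"
      by (intro exI[of _ n] ballI impI near)
  qed
qed

lemma ball_continuous_fk_det:
  assumes f: "f \<in> Units (L1_algebra (free_group d))"
  shows "ball_continuous d (\<lambda>(\<Gamma> :: 'a monoid, S). fk_det \<Gamma> (L1_rep \<Gamma> (marking_push \<Gamma> S f)))"
proof -
  have "ball_continuous d (\<lambda>p :: 'a monoid \<times> 'a list.
      exp (case p of (\<Gamma>, S) \<Rightarrow> ln (fk_det \<Gamma> (L1_rep \<Gamma> (marking_push \<Gamma> S f)))))"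
    by (rule ball_continuous_compose[where g = exp, OF ball_continuous_ln_fk_det(1)[OF f]])
      (rule continuous_exp[OF continuous_ident])
  moreover have "exp (case p of (\<Gamma>, S) \<Rightarrow> ln (fk_det \<Gamma> (L1_rep \<Gamma> (marking_push \<Gamma> S f))))
      = (case p of (\<Gamma>, S) \<Rightarrow> fk_det \<Gamma> (L1_rep \<Gamma> (marking_push \<Gamma> S f)))"
    if "p \<in> marked_groups d" for p :: "'a monoid \<times> 'a list"
    using that ball_continuous_ln_fk_det(2)[OF f] by (cases p) simp
  ultimately show ?thesis unfolding ball_continuous_def by simp
qed

text \<open>\<open>the_elem\<close> of a set with several elements is an unspecified value, so the
  equations on \<open>marked_class\<close> belong to the claim: they express independence of the
  representative. The target \<open>{0<..}\<close> adds positivity to continuity.\<close>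

theorem corollary24:
  fixes d :: nat
  assumes "d \<ge> 1"
  shows
    "(\<forall>f \<in> Lp 1 (free_group d).
        (\<forall>(\<Gamma>, S) \<in> (marked_groups d :: ('a monoid \<times> 'a list) set).
           T_fun f (marked_class \<Gamma> S) = vN_trace \<Gamma> (L1_rep \<Gamma> (marking_push \<Gamma> S f))) \<and>
        continuous_map (marked_top d :: ('a monoid \<times> 'a list) set topology) euclidean (T_fun f)) \<and>
     (\<forall>f \<in> Units (L1_algebra (free_group d)).
        (\<forall>(\<Gamma>, S) \<in> (marked_groups d :: ('a monoid \<times> 'a list) set).
           D_fun f (marked_class \<Gamma> S) = fk_det \<Gamma> (L1_rep \<Gamma> (marking_push \<Gamma> S f))) \<and>
        continuous_map (marked_top d :: ('a monoid \<times> 'a list) set topology)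
          (top_of_set {0<..}) (D_fun f))"
proof (intro conjI ballI)
  fix f assume f: "f \<in> Lp 1 (free_group d)"
  let ?T = "\<lambda>(\<Gamma> :: 'a monoid, S). vN_trace \<Gamma> (L1_rep \<Gamma> (marking_push \<Gamma> S f))"
  have "?T p = kernel_sum d p f" if "p \<in> marked_groups d" for p
    using that trace_marking_push[OF _ f] by (cases p) simp
  then have T: "ball_continuous d ?T"
    using ball_continuous_kernel_sum[OF f, where 'a = 'a] unfolding ball_continuous_def by simp
  show "case p of (\<Gamma>, S) \<Rightarrow> T_fun f (marked_class \<Gamma> S) = vN_trace \<Gamma> (L1_rep \<Gamma> (marking_push \<Gamma> S f))"
    if "p \<in> marked_groups d" for p :: "'a monoid \<times> 'a list"
    using that the_elem_marked_class[OF T] by (cases p) (simp add: T_fun_def)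
  show "continuous_map (marked_top d :: ('a monoid \<times> 'a list) set topology) euclidean (T_fun f)"
    using continuous_map_marked_top[OF T] by (simp add: T_fun_def[abs_def])
next
  fix f assume f: "f \<in> Units (L1_algebra (free_group d))"
  note D = ball_continuous_fk_det[OF f, where 'a = 'a]
  have eq: "D_fun f (marked_class \<Gamma> S) = fk_det \<Gamma> (L1_rep \<Gamma> (marking_push \<Gamma> S f))"
    if "(\<Gamma>, S) \<in> marked_groups d" for \<Gamma> :: "'a monoid" and S
    using the_elem_marked_class[OF D that] by (simp add: D_fun_def)
  then show "case p of (\<Gamma>, S) \<Rightarrow> D_fun f (marked_class \<Gamma> S) = fk_det \<Gamma> (L1_rep \<Gamma> (marking_push \<Gamma> S f))"
    if "p \<in> marked_groups d" for p :: "'a monoid \<times> 'a list"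
    using that by (cases p) simp
  have "continuous_map (marked_top d :: ('a monoid \<times> 'a list) set topology) euclidean (D_fun f)"
    using continuous_map_marked_top[OF D] by (simp add: D_fun_def[abs_def])
  moreover have "D_fun f c \<in> {0<..}" if "c \<in> topspace (marked_top d)" for c :: "('a monoid \<times> 'a list) set"
  proof -
    have "c \<in> marked_space d"
      using that by (simp add: marked_top_def Metric_space.topspace_mtopology[OF Metric_space_marked_space])
    then obtain \<Gamma> S where "(\<Gamma>, S) \<in> marked_groups d" "c = marked_class \<Gamma> S"
      by (rule marked_space_cases)
    then show ?thesis using eq ball_continuous_ln_fk_det(2)[OF f] by simp
  qed
  ultimately show "continuous_map (marked_top d :: ('a monoid \<times> 'a list) set topology)
      (top_of_set {0<..}) (D_fun f)"
    by (auto simp: continuous_map_in_subtopology)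
qed

end
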